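(* Let $\mathcal{P}$ be a skeletally small $k$-category such that $\mathrm{mod}(\mathcal{P})$ is abelian (i.e. $\mathcal{P}$ is coherent). Put $\mathcal{B}=\mathrm{mod}(\mathcal{P})$ and $\mathcal{A}=\mathrm{mod}(\mathcal{B})$. a) The functor $K_R:\mathcal{B}\to\mathcal{A}$ is isomorphic to the Yoneda embedding \[ \mathrm{mod}(\mathcal{P})\to\mathrm{mod}(\mathrm{mod}(\mathcal{P})),\quad M\mapsto M^\wedge=\mathrm{Hom}(?,M). \] In particular, for each injective $I$ of $\mathrm{mod}(\mathcal{P})$, the module $K_R(I)$ is both projective and injective. b) The canonical morphism $K_L(P)\to K_R(P)$ is invertible for all finitely generated projective $\mathcal{P}$-modules $P$. c) Let $M$ be in $\mathrm{mod}(\mathcal{P})$ and let \[ 0\to\Omega M\xrightarrow{\ g\ }P_0\xrightarrow{\ f\ }M\to 0 \] be an exact sequence with finitely generated projective $P_0$. Then the induced sequence \[ 0\to(\Omega M)^\wedge\xrightarrow{\ g^\wedge\ }P_0^\wedge\to K_{LR}(M)\to 0 \] is a projective resolution of $K_{LR}(M)$. If $P_0$ is also injective, then $K_{LR}(M)$ is rigid, i.e. $\mathrm{Ext}^1_{\mathcal{A}}(K_{LR}(M),K_{LR}(M))=0$.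
   Context: Let $k$ be a field. For a skeletally small $k$-category $\mathcal{C}$, $\mathrm{mod}(\mathcal{C})$ is the category of finitely presented $\mathcal{C}$-modules, i.e. $k$-linear functors $M:\mathcal{C}^{op}\to\mathrm{Mod}\,k$ admitting an exact sequence $P_1\to P_0\to M\to 0$ with $P_0,P_1$ finitely generated projective (direct factors of finite direct sums of representable modules $\mathcal{C}(?,X)$). $\mathcal{C}$ is coherent if the kernel of any morphism between finitely generated projective $\mathcal{C}$-modules is finitely generated; equivalently $\mathrm{mod}(\mathcal{C})$ is abelian. The Yoneda embedding $\mathcal{P}\to\mathrm{mod}(\mathcal{P})$ takes $P$ to $P^\wedge=\mathcal{P}(?,P)$; for $M\in\mathrm{mod}(\mathcal{P})$, $M^\wedge=\mathrm{Hom}_{\mathrm{mod}(\mathcal{P})}(?,M)\in\mathcal{A}$. The restriction $\mathrm{res}:\mathcal{A}=\mathrm{mod}(\mathrm{mod}(\mathcal{P}))\to\mathcal{B}=\mathrm{mod}(\mathcal{P})$ along the Yoneda embedding is a localization of abelian categories; $K_L$ and $K_R$ denote its left and right adjoints (both fully faithful). There is a canonical morphism $K_L\to K_R$ (corresponding by adjunction to the isomorphism $\mathbf{1}\to\mathrm{res}\,K_L$), and the intermediate extension $K_{LR}$ is its image. *)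

theory Defs
  imports "HOL-Algebra.Module"
begin

section \<open>Linear categories, functors and natural transformations\<close>

text \<open>
  Spaces over the field \<open>K\<close> are the modules of \<open>HOL-Algebra.Module\<close>; the ring fields
  \<open>mult\<close> and \<open>one\<close> of the record are irrelevant for them.

  The morphism spaces of a \<open>K\<close>-category are \<open>K\<close>-spaces, and those of different
  pairs of objects may overlap. For this reason composition takes the three objects as arguments:
  \<open>Comp C X Y Z g f\<close> is the composite of \<open>f : X \<rightarrow> Y\<close> and \<open>g : Y \<rightarrow> Z\<close>.
\<close>

record ('k, 'o, 'm) kcat =
  Ob :: "'o set"
  Hom :: "'o \<Rightarrow> 'o \<Rightarrow> ('k, 'm) module"
  Comp :: "'o \<Rightarrow> 'o \<Rightarrow> 'o \<Rightarrow> 'm \<Rightarrow> 'm \<Rightarrow> 'm"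
  Ident :: "'o \<Rightarrow> 'm"

abbreviation arr :: "('k, 'o, 'm) kcat \<Rightarrow> 'o \<Rightarrow> 'o \<Rightarrow> 'm set" where
  "arr C X Y \<equiv> carrier (Hom C X Y)"

definition linear_map ::
  "'k ring \<Rightarrow> ('k, 'v) module \<Rightarrow> ('k, 'w) module \<Rightarrow> ('v \<Rightarrow> 'w) \<Rightarrow> bool" where
  "linear_map K V W f \<longleftrightarrow>
     f \<in> carrier V \<rightarrow> carrier W \<and>
     (\<forall>x\<in>carrier V. \<forall>y\<in>carrier V. f (x \<oplus>\<^bsub>V\<^esub> y) = f x \<oplus>\<^bsub>W\<^esub> f y) \<and>
     (\<forall>a\<in>carrier K. \<forall>x\<in>carrier V. f (a \<odot>\<^bsub>V\<^esub> x) = a \<odot>\<^bsub>W\<^esub> f x)"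

definition kcategory :: "'k ring \<Rightarrow> ('k, 'o, 'm) kcat \<Rightarrow> bool" where
  "kcategory K C \<longleftrightarrow>
     (\<forall>X\<in>Ob C. \<forall>Y\<in>Ob C. module K (Hom C X Y)) \<and>
     (\<forall>X\<in>Ob C. Ident C X \<in> arr C X X) \<and>
     (\<forall>X\<in>Ob C. \<forall>Y\<in>Ob C. \<forall>Z\<in>Ob C.
        (\<forall>g\<in>arr C Y Z. linear_map K (Hom C X Y) (Hom C X Z) (\<lambda>f. Comp C X Y Z g f)) \<and>
        (\<forall>f\<in>arr C X Y. linear_map K (Hom C Y Z) (Hom C X Z) (\<lambda>g. Comp C X Y Z g f))) \<and>
     (\<forall>X\<in>Ob C. \<forall>Y\<in>Ob C. \<forall>f\<in>arr C X Y.
        Comp C X X Y f (Ident C X) = f \<and> Comp C X Y Y (Ident C Y) f = f) \<and>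
     (\<forall>W\<in>Ob C. \<forall>X\<in>Ob C. \<forall>Y\<in>Ob C. \<forall>Z\<in>Ob C.
        \<forall>f\<in>arr C W X. \<forall>g\<in>arr C X Y. \<forall>h\<in>arr C Y Z.
          Comp C W Y Z h (Comp C W X Y g f) = Comp C W X Z (Comp C X Y Z h g) f)"

definition op_cat :: "('k, 'o, 'm) kcat \<Rightarrow> ('k, 'o, 'm) kcat" where
  "op_cat C = \<lparr>Ob = Ob C, Hom = (\<lambda>X Y. Hom C Y X),
               Comp = (\<lambda>X Y Z g f. Comp C Z Y X f g), Ident = Ident C\<rparr>"

record ('o, 'm, 'p, 'n) kfun =
  ob_map :: "'o \<Rightarrow> 'p"
  hom_map :: "'o \<Rightarrow> 'o \<Rightarrow> 'm \<Rightarrow> 'n"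

definition kfunctor ::
  "'k ring \<Rightarrow> ('k, 'o, 'm) kcat \<Rightarrow> ('k, 'p, 'n) kcat \<Rightarrow> ('o, 'm, 'p, 'n) kfun \<Rightarrow> bool" where
  "kfunctor K C D F \<longleftrightarrow>
     (\<forall>X\<in>Ob C. ob_map F X \<in> Ob D) \<and>
     (\<forall>X\<in>Ob C. \<forall>Y\<in>Ob C.
        linear_map K (Hom C X Y) (Hom D (ob_map F X) (ob_map F Y)) (hom_map F X Y)) \<and>
     (\<forall>X\<in>Ob C. hom_map F X X (Ident C X) = Ident D (ob_map F X)) \<and>
     (\<forall>X\<in>Ob C. \<forall>Y\<in>Ob C. \<forall>Z\<in>Ob C. \<forall>f\<in>arr C X Y. \<forall>g\<in>arr C Y Z.
        hom_map F X Z (Comp C X Y Z g f) =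
        Comp D (ob_map F X) (ob_map F Y) (ob_map F Z) (hom_map F Y Z g) (hom_map F X Y f))"

definition id_functor :: "('o, 'm, 'o, 'm) kfun" where
  "id_functor = \<lparr>ob_map = (\<lambda>X. X), hom_map = (\<lambda>X Y f. f)\<rparr>"

definition comp_functor ::
  "('p, 'n, 'q, 'l) kfun \<Rightarrow> ('o, 'm, 'p, 'n) kfun \<Rightarrow> ('o, 'm, 'q, 'l) kfun" where
  "comp_functor G F =
     \<lparr>ob_map = (\<lambda>X. ob_map G (ob_map F X)),
      hom_map = (\<lambda>X Y f. hom_map G (ob_map F X) (ob_map F Y) (hom_map F X Y f))\<rparr>"

definition op_functor :: "('o, 'm, 'p, 'n) kfun \<Rightarrow> ('o, 'm, 'p, 'n) kfun" where
  "op_functor F = \<lparr>ob_map = ob_map F, hom_map = (\<lambda>X Y f. hom_map F Y X f)\<rparr>"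

text \<open>Extensionality makes equality of natural transformations the mathematical one.\<close>

definition nat_trans ::
  "'k ring \<Rightarrow> ('k, 'o, 'm) kcat \<Rightarrow> ('k, 'p, 'n) kcat \<Rightarrow>
   ('o, 'm, 'p, 'n) kfun \<Rightarrow> ('o, 'm, 'p, 'n) kfun \<Rightarrow> ('o \<Rightarrow> 'n) \<Rightarrow> bool" where
  "nat_trans K C D F G \<eta> \<longleftrightarrow>
     kfunctor K C D F \<and> kfunctor K C D G \<and> \<eta> \<in> extensional (Ob C) \<and>
     (\<forall>X\<in>Ob C. \<eta> X \<in> arr D (ob_map F X) (ob_map G X)) \<and>
     (\<forall>X\<in>Ob C. \<forall>Y\<in>Ob C. \<forall>f\<in>arr C X Y.
        Comp D (ob_map F X) (ob_map G X) (ob_map G Y) (hom_map G X Y f) (\<eta> X) =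
        Comp D (ob_map F X) (ob_map F Y) (ob_map G Y) (\<eta> Y) (hom_map F X Y f))"

definition inverse_arr :: "('k, 'o, 'm) kcat \<Rightarrow> 'o \<Rightarrow> 'o \<Rightarrow> 'm \<Rightarrow> 'm \<Rightarrow> bool" where
  "inverse_arr C X Y f g \<longleftrightarrow>
     f \<in> arr C X Y \<and> g \<in> arr C Y X \<and>
     Comp C X Y X g f = Ident C X \<and> Comp C Y X Y f g = Ident C Y"

definition invertible :: "('k, 'o, 'm) kcat \<Rightarrow> 'o \<Rightarrow> 'o \<Rightarrow> 'm \<Rightarrow> bool" where
  "invertible C X Y f \<longleftrightarrow> (\<exists>g. inverse_arr C X Y f g)"

definition nat_iso ::
  "'k ring \<Rightarrow> ('k, 'o, 'm) kcat \<Rightarrow> ('k, 'p, 'n) kcat \<Rightarrow>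
   ('o, 'm, 'p, 'n) kfun \<Rightarrow> ('o, 'm, 'p, 'n) kfun \<Rightarrow> ('o \<Rightarrow> 'n) \<Rightarrow> bool" where
  "nat_iso K C D F G \<eta> \<longleftrightarrow>
     nat_trans K C D F G \<eta> \<and> (\<forall>X\<in>Ob C. invertible D (ob_map F X) (ob_map G X) (\<eta> X))"

text \<open>\<open>F\<close> is left adjoint to \<open>G\<close>, with unit \<open>\<eta>\<close> and counit \<open>\<epsilon>\<close>.\<close>

definition adjunction ::
  "'k ring \<Rightarrow> ('k, 'o, 'm) kcat \<Rightarrow> ('k, 'p, 'n) kcat \<Rightarrow>
   ('o, 'm, 'p, 'n) kfun \<Rightarrow> ('p, 'n, 'o, 'm) kfun \<Rightarrow> ('o \<Rightarrow> 'm) \<Rightarrow> ('p \<Rightarrow> 'n) \<Rightarrow> bool" where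
  "adjunction K C D F G \<eta> \<epsilon> \<longleftrightarrow>
     kfunctor K C D F \<and> kfunctor K D C G \<and>
     nat_trans K C C id_functor (comp_functor G F) \<eta> \<and>
     nat_trans K D D (comp_functor F G) id_functor \<epsilon> \<and>
     (\<forall>X\<in>Ob C.
        Comp D (ob_map F X) (ob_map F (ob_map G (ob_map F X))) (ob_map F X)
          (\<epsilon> (ob_map F X)) (hom_map F X (ob_map G (ob_map F X)) (\<eta> X))
        = Ident D (ob_map F X)) \<and>
     (\<forall>Y\<in>Ob D.
        Comp C (ob_map G Y) (ob_map G (ob_map F (ob_map G Y))) (ob_map G Y)
          (hom_map G (ob_map F (ob_map G Y)) Y (\<epsilon> Y)) (\<eta> (ob_map G Y))
        = Ident C (ob_map G Y))"


section \<open>Abelian categories\<close>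

definition monic :: "('k, 'o, 'm) kcat \<Rightarrow> 'o \<Rightarrow> 'o \<Rightarrow> 'm \<Rightarrow> bool" where
  "monic C X Y f \<longleftrightarrow> f \<in> arr C X Y \<and>
     (\<forall>T\<in>Ob C. \<forall>s\<in>arr C T X. \<forall>t\<in>arr C T X. Comp C T X Y f s = Comp C T X Y f t \<longrightarrow> s = t)"

definition epic :: "('k, 'o, 'm) kcat \<Rightarrow> 'o \<Rightarrow> 'o \<Rightarrow> 'm \<Rightarrow> bool" where
  "epic C X Y f \<longleftrightarrow> f \<in> arr C X Y \<and>
     (\<forall>T\<in>Ob C. \<forall>s\<in>arr C Y T. \<forall>t\<in>arr C Y T. Comp C X Y T s f = Comp C X Y T t f \<longrightarrow> s = t)"

definition is_kernel :: "('k, 'o, 'm) kcat \<Rightarrow> 'o \<Rightarrow> 'o \<Rightarrow> 'm \<Rightarrow> 'o \<Rightarrow> 'm \<Rightarrow> bool" where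
  "is_kernel C X Y f N i \<longleftrightarrow>
     N \<in> Ob C \<and> i \<in> arr C N X \<and> Comp C N X Y f i = \<zero>\<^bsub>Hom C N Y\<^esub> \<and>
     (\<forall>T\<in>Ob C. \<forall>t\<in>arr C T X. Comp C T X Y f t = \<zero>\<^bsub>Hom C T Y\<^esub> \<longrightarrow>
        (\<exists>!s. s \<in> arr C T N \<and> Comp C T N X i s = t))"

definition is_cokernel :: "('k, 'o, 'm) kcat \<Rightarrow> 'o \<Rightarrow> 'o \<Rightarrow> 'm \<Rightarrow> 'o \<Rightarrow> 'm \<Rightarrow> bool" where
  "is_cokernel C X Y f Q p \<longleftrightarrow>
     Q \<in> Ob C \<and> p \<in> arr C Y Q \<and> Comp C X Y Q p f = \<zero>\<^bsub>Hom C X Q\<^esub> \<and>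
     (\<forall>T\<in>Ob C. \<forall>t\<in>arr C Y T. Comp C X Y T t f = \<zero>\<^bsub>Hom C X T\<^esub> \<longrightarrow>
        (\<exists>!s. s \<in> arr C Q T \<and> Comp C Y Q T s p = t))"

definition is_image :: "('k, 'o, 'm) kcat \<Rightarrow> 'o \<Rightarrow> 'o \<Rightarrow> 'm \<Rightarrow> 'o \<Rightarrow> 'm \<Rightarrow> bool" where
  "is_image C X Y f Z i \<longleftrightarrow> (\<exists>Q p. is_cokernel C X Y f Q p \<and> is_kernel C Y Q p Z i)"

definition is_zero_object :: "('k, 'o, 'm) kcat \<Rightarrow> 'o \<Rightarrow> bool" where
  "is_zero_object C Z \<longleftrightarrow> Z \<in> Ob C \<and>
     (\<forall>X\<in>Ob C. (\<exists>!f. f \<in> arr C Z X) \<and> (\<exists>!f. f \<in> arr C X Z))"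

text \<open>
  \<open>S\<close> is the direct sum of \<open>Y 0, \<dots>, Y (n - 1)\<close>, with injections \<open>\<iota> i\<close> and projections \<open>\<pi> i\<close>.
\<close>

definition is_direct_sum ::
  "('k, 'o, 'm) kcat \<Rightarrow> nat \<Rightarrow> (nat \<Rightarrow> 'o) \<Rightarrow> 'o \<Rightarrow> (nat \<Rightarrow> 'm) \<Rightarrow> (nat \<Rightarrow> 'm) \<Rightarrow> bool" where
  "is_direct_sum C n Y S \<iota> \<pi> \<longleftrightarrow>
     S \<in> Ob C \<and>
     (\<forall>i<n. Y i \<in> Ob C \<and> \<iota> i \<in> arr C (Y i) S \<and> \<pi> i \<in> arr C S (Y i)) \<and>
     (\<forall>i<n. \<forall>j<n. Comp C (Y i) S (Y j) (\<pi> j) (\<iota> i) =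
        (if i = j then Ident C (Y i) else \<zero>\<^bsub>Hom C (Y i) (Y j)\<^esub>)) \<and>
     finsum (Hom C S S) (\<lambda>i. Comp C S (Y i) S (\<iota> i) (\<pi> i)) {..<n} = Ident C S"

definition direct_factor :: "('k, 'o, 'm) kcat \<Rightarrow> 'o \<Rightarrow> 'o \<Rightarrow> bool" where
  "direct_factor C X S \<longleftrightarrow> (\<exists>Y \<iota> \<pi>. is_direct_sum C 2 Y S \<iota> \<pi> \<and> Y 0 = X)"

definition abelian :: "'k ring \<Rightarrow> ('k, 'o, 'm) kcat \<Rightarrow> bool" where
  "abelian K C \<longleftrightarrow>
     kcategory K C \<and>
     (\<exists>Z. is_zero_object C Z) \<and>
     (\<forall>X\<in>Ob C. \<forall>Y\<in>Ob C. \<exists>S \<iota> \<pi>. is_direct_sum C 2 (\<lambda>i. if i = 0 then X else Y) S \<iota> \<pi>) \<and>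
     (\<forall>X\<in>Ob C. \<forall>Y\<in>Ob C. \<forall>f\<in>arr C X Y.
        (\<exists>N i. is_kernel C X Y f N i) \<and> (\<exists>Q p. is_cokernel C X Y f Q p)) \<and>
     (\<forall>X\<in>Ob C. \<forall>Y\<in>Ob C. \<forall>f. monic C X Y f \<longrightarrow>
        (\<exists>Z\<in>Ob C. \<exists>h\<in>arr C Y Z. is_kernel C Y Z h X f)) \<and>
     (\<forall>X\<in>Ob C. \<forall>Y\<in>Ob C. \<forall>f. epic C X Y f \<longrightarrow>
        (\<exists>Z\<in>Ob C. \<exists>h\<in>arr C Z X. is_cokernel C Z X h Y f))"

text \<open>\<open>0 \<rightarrow> X \<rightarrow> E \<rightarrow> Z \<rightarrow> 0\<close>, with morphisms \<open>a\<close> and \<open>b\<close>, is exact.\<close>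

definition short_exact :: "('k, 'o, 'm) kcat \<Rightarrow> 'o \<Rightarrow> 'o \<Rightarrow> 'o \<Rightarrow> 'm \<Rightarrow> 'm \<Rightarrow> bool" where
  "short_exact C X E Z a b \<longleftrightarrow>
     X \<in> Ob C \<and> E \<in> Ob C \<and> Z \<in> Ob C \<and> is_kernel C E Z b X a \<and> is_cokernel C X E a Z b"

definition projective :: "('k, 'o, 'm) kcat \<Rightarrow> 'o \<Rightarrow> bool" where
  "projective C P \<longleftrightarrow> P \<in> Ob C \<and>
     (\<forall>X\<in>Ob C. \<forall>Y\<in>Ob C. \<forall>p. epic C X Y p \<longrightarrow>
        (\<forall>f\<in>arr C P Y. \<exists>g\<in>arr C P X. Comp C P X Y p g = f))"

definition injective :: "('k, 'o, 'm) kcat \<Rightarrow> 'o \<Rightarrow> bool" where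
  "injective C I \<longleftrightarrow> I \<in> Ob C \<and>
     (\<forall>X\<in>Ob C. \<forall>Y\<in>Ob C. \<forall>i. monic C X Y i \<longrightarrow>
        (\<forall>f\<in>arr C X I. \<exists>g\<in>arr C Y I. Comp C X Y I g i = f))"

text \<open>
  \<open>Ext1 C Z X\<close> is Yoneda's Ext: the extensions of \<open>Z\<close> by \<open>X\<close> up to isomorphism inducing the identity
  on \<open>X\<close> and \<open>Z\<close>. The zero element for the Baer sum is the class of the direct sum \<open>X \<oplus> Z\<close>.
\<close>

definition extensions :: "('k, 'o, 'm) kcat \<Rightarrow> 'o \<Rightarrow> 'o \<Rightarrow> ('o \<times> 'm \<times> 'm) set" where
  "extensions C Z X = {(E, a, b). short_exact C X E Z a b}"

definition extension_equiv ::
  "('k, 'o, 'm) kcat \<Rightarrow> 'o \<Rightarrow> 'o \<Rightarrow> (('o \<times> 'm \<times> 'm) \<times> ('o \<times> 'm \<times> 'm)) set" where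
  "extension_equiv C Z X =
     {((E, a, b), (E', a', b')).
        (E, a, b) \<in> extensions C Z X \<and> (E', a', b') \<in> extensions C Z X \<and>
        (\<exists>h. invertible C E E' h \<and> Comp C X E E' h a = a' \<and> Comp C E E' Z b' h = b)}"

definition Ext1 :: "('k, 'o, 'm) kcat \<Rightarrow> 'o \<Rightarrow> 'o \<Rightarrow> ('o \<times> 'm \<times> 'm) set set" where
  "Ext1 C Z X = extensions C Z X // extension_equiv C Z X"

definition Ext1_zero :: "('k, 'o, 'm) kcat \<Rightarrow> 'o \<Rightarrow> 'o \<Rightarrow> ('o \<times> 'm \<times> 'm) set" where
  "Ext1_zero C Z X =
     {(E, a, b). \<exists>\<iota> \<pi>. is_direct_sum C 2 (\<lambda>i. if i = 0 then X else Z) E \<iota> \<pi> \<and> a = \<iota> 0 \<and> b = \<pi> 1}"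

definition rigid :: "('k, 'o, 'm) kcat \<Rightarrow> 'o \<Rightarrow> bool" where
  "rigid C Z \<longleftrightarrow> Z \<in> Ob C \<and> Ext1 C Z Z = {Ext1_zero C Z Z}"


section \<open>Modules over a linear category\<close>

definition Hom_space :: "'k ring \<Rightarrow> ('k, 'v) module \<Rightarrow> ('k, 'w) module \<Rightarrow> ('k, 'v \<Rightarrow> 'w) module" where
  "Hom_space K V W =
     \<lparr>carrier = {f. f \<in> extensional (carrier V) \<and> linear_map K V W f},
      mult = undefined, one = undefined,
      zero = (\<lambda>x\<in>carrier V. \<zero>\<^bsub>W\<^esub>),
      add = (\<lambda>f g. \<lambda>x\<in>carrier V. f x \<oplus>\<^bsub>W\<^esub> g x),
      smult = (\<lambda>c f. \<lambda>x\<in>carrier V. c \<odot>\<^bsub>W\<^esub> f x)\<rparr>"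

text \<open>
  \<open>Mod_k K\<close> is the category of \<open>K\<close>-vector spaces whose elements lie in the type \<open>'v\<close>, which plays
  the role of the universe.
\<close>

definition Mod_k :: "'k ring \<Rightarrow> ('k, ('k, 'v) module, 'v \<Rightarrow> 'v) kcat" where
  "Mod_k K =
     \<lparr>Ob = {V. module K V}, Hom = Hom_space K,
      Comp = (\<lambda>U V W g f. compose (carrier U) g f),
      Ident = (\<lambda>V. \<lambda>x\<in>carrier V. x)\<rparr>"

definition functor_cat ::
  "'k ring \<Rightarrow> ('k, 'o, 'm) kcat \<Rightarrow> ('k, 'p, 'n) kcat \<Rightarrow>
   ('k, ('o, 'm, 'p, 'n) kfun, 'o \<Rightarrow> 'n) kcat" where
  "functor_cat K C D =
     \<lparr>Ob = {F. kfunctor K C D F},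
      Hom = (\<lambda>F G.
        \<lparr>carrier = {\<eta>. nat_trans K C D F G \<eta>},
         mult = undefined, one = undefined,
         zero = (\<lambda>X\<in>Ob C. \<zero>\<^bsub>Hom D (ob_map F X) (ob_map G X)\<^esub>),
         add = (\<lambda>\<eta> \<theta>. \<lambda>X\<in>Ob C. \<eta> X \<oplus>\<^bsub>Hom D (ob_map F X) (ob_map G X)\<^esub> \<theta> X),
         smult = (\<lambda>c \<eta>. \<lambda>X\<in>Ob C. c \<odot>\<^bsub>Hom D (ob_map F X) (ob_map G X)\<^esub> \<eta> X)\<rparr>),
      Comp = (\<lambda>F G H \<theta> \<eta>. \<lambda>X\<in>Ob C.
        Comp D (ob_map F X) (ob_map G X) (ob_map H X) (\<theta> X) (\<eta> X)),
      Ident = (\<lambda>F. \<lambda>X\<in>Ob C. Ident D (ob_map F X))\<rparr>"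

type_synonym ('k, 'o, 'm, 'v) cmodule = "('o, 'm, ('k, 'v) module, 'v \<Rightarrow> 'v) kfun"

definition Mod ::
  "'k ring \<Rightarrow> ('k, 'o, 'm) kcat \<Rightarrow> ('k, ('k, 'o, 'm, 'v) cmodule, 'o \<Rightarrow> 'v \<Rightarrow> 'v) kcat" where
  "Mod K C = functor_cat K (op_cat C) (Mod_k K)"

text \<open>
  The elements of a morphism space of \<open>C\<close> have type \<open>'m\<close>, whereas modules take values in spaces
  with elements in \<open>'v\<close>. A representable module therefore has as values copies of the morphism
  spaces, along chosen injections. They exist when the morphism spaces of \<open>C\<close> are
  small relative to \<open>'v\<close>, as expressed by \<open>locally_small\<close>. If moreover \<open>'v\<close> is infinite, then \<open>'v\<close>
  also accommodates finite direct sums and quotients of representable modules, hence all finitely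
  presented modules up to isomorphism, and the morphism spaces of \<open>fp_mod K C\<close> are again small
  relative to \<open>'v\<close>.
\<close>

definition locally_small :: "'v itself \<Rightarrow> ('k, 'o, 'm) kcat \<Rightarrow> bool" where
  "locally_small _ C \<longleftrightarrow> (\<forall>X\<in>Ob C. \<forall>Y\<in>Ob C. \<exists>i :: 'm \<Rightarrow> 'v. inj_on i (arr C X Y))"

definition code :: "'m set \<Rightarrow> 'm \<Rightarrow> 'v" where
  "code S = (SOME i. inj_on i S)"

definition decode :: "'m set \<Rightarrow> 'v \<Rightarrow> 'm" where
  "decode S = the_inv_into S (code S)"

definition copy_space :: "('k, 'm) module \<Rightarrow> ('k, 'v) module" where
  "copy_space V =
     \<lparr>carrier = code (carrier V) ` carrier V,
      mult = undefined, one = undefined,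
      zero = code (carrier V) \<zero>\<^bsub>V\<^esub>,
      add = (\<lambda>x y. code (carrier V) (decode (carrier V) x \<oplus>\<^bsub>V\<^esub> decode (carrier V) y)),
      smult = (\<lambda>c x. code (carrier V) (c \<odot>\<^bsub>V\<^esub> decode (carrier V) x))\<rparr>"

definition representable :: "('k, 'o, 'm) kcat \<Rightarrow> 'o \<Rightarrow> ('k, 'o, 'm, 'v) cmodule" where
  "representable C X =
     \<lparr>ob_map = (\<lambda>Y. copy_space (Hom C Y X)),
      hom_map = (\<lambda>Y Y' f. \<lambda>x\<in>carrier (copy_space (Hom C Y X)).
        code (arr C Y' X) (Comp C Y' Y X (decode (arr C Y X) x) f))\<rparr>"

text \<open>The Yoneda embedding, taking \<open>X\<close> to \<open>C(?, X)\<close>.\<close>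

definition yoneda ::
  "('k, 'o, 'm) kcat \<Rightarrow> ('o, 'm, ('k, 'o, 'm, 'v) cmodule, 'o \<Rightarrow> 'v \<Rightarrow> 'v) kfun" where
  "yoneda C =
     \<lparr>ob_map = representable C,
      hom_map = (\<lambda>X X' g. \<lambda>Y\<in>Ob C. \<lambda>x\<in>carrier (copy_space (Hom C Y X)).
        code (arr C Y X') (Comp C Y X X' g (decode (arr C Y X) x)))\<rparr>"

definition fg_projective ::
  "'k ring \<Rightarrow> ('k, 'o, 'm) kcat \<Rightarrow> ('k, 'o, 'm, 'v) cmodule \<Rightarrow> bool" where
  "fg_projective K C M \<longleftrightarrow>
     (\<exists>n X S \<iota> \<pi>. (\<forall>i<n. X i \<in> Ob C) \<and>
        is_direct_sum (Mod K C) n (\<lambda>i. representable C (X i)) S \<iota> \<pi> \<and>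
        direct_factor (Mod K C) M S)"

text \<open>Exactness of a sequence \<open>P1 \<rightarrow> P0 \<rightarrow> M \<rightarrow> 0\<close> of modules is exactness of its values.\<close>

definition finitely_presented ::
  "'k ring \<Rightarrow> ('k, 'o, 'm) kcat \<Rightarrow> ('k, 'o, 'm, 'v) cmodule \<Rightarrow> bool" where
  "finitely_presented K C M \<longleftrightarrow>
     M \<in> Ob (Mod K C) \<and>
     (\<exists>P1 P0. \<exists>u\<in>arr (Mod K C) P1 P0. \<exists>q\<in>arr (Mod K C) P0 M.
        fg_projective K C P1 \<and> fg_projective K C P0 \<and>
        (\<forall>X\<in>Ob C.
           u X ` carrier (ob_map P1 X) = {x \<in> carrier (ob_map P0 X). q X x = \<zero>\<^bsub>ob_map M X\<^esub>} \<and>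
           q X ` carrier (ob_map P0 X) = carrier (ob_map M X)))"

definition fp_mod ::
  "'k ring \<Rightarrow> ('k, 'o, 'm) kcat \<Rightarrow> ('k, ('k, 'o, 'm, 'v) cmodule, 'o \<Rightarrow> 'v \<Rightarrow> 'v) kcat" where
  "fp_mod K C = (Mod K C) \<lparr>Ob := {M. finitely_presented K C M}\<rparr>"


section \<open>Restriction along the Yoneda embedding\<close>

type_synonym ('k, 'o, 'm, 'v) bmodule =
  "('k, ('k, 'o, 'm, 'v) cmodule, 'o \<Rightarrow> 'v \<Rightarrow> 'v, 'v) cmodule"

text \<open>The restriction functor from \<open>fp_mod K (fp_mod K C)\<close> to \<open>fp_mod K C\<close>.\<close>

definition res ::
  "('k, 'o, 'm) kcat \<Rightarrow>
   (('k, 'o, 'm, 'v) bmodule, ('k, 'o, 'm, 'v) cmodule \<Rightarrow> 'v \<Rightarrow> 'v,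
    ('k, 'o, 'm, 'v) cmodule, 'o \<Rightarrow> 'v \<Rightarrow> 'v) kfun" where
  "res C =
     \<lparr>ob_map = (\<lambda>F. comp_functor F (op_functor (yoneda C))),
      hom_map = (\<lambda>F G \<alpha>. \<lambda>X\<in>Ob C. \<alpha> (ob_map (yoneda C) X))\<rparr>"

text \<open>
  Let \<open>L\<close> and \<open>R\<close> be the left and the right adjoint of \<open>r : A \<rightarrow> B\<close>, with units
  \<open>\<eta> : 1 \<rightarrow> r L\<close> and \<open>\<eta>' : 1 \<rightarrow> R r\<close>, where \<open>\<eta>\<close> is invertible. The canonical morphism
  \<open>L M \<rightarrow> R M\<close> corresponds to the inverse \<open>r L M \<rightarrow> M\<close> of \<open>\<eta> M\<close> under the
  adjunction between \<open>r\<close> and \<open>R\<close>.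
\<close>

definition canonical_arr ::
  "('k, 'p, 'n) kcat \<Rightarrow> ('k, 'o, 'm) kcat \<Rightarrow> ('p, 'n, 'o, 'm) kfun \<Rightarrow>
   ('o, 'm, 'p, 'n) kfun \<Rightarrow> ('o, 'm, 'p, 'n) kfun \<Rightarrow>
   ('o \<Rightarrow> 'm) \<Rightarrow> ('p \<Rightarrow> 'n) \<Rightarrow> 'o \<Rightarrow> 'n" where
  "canonical_arr A B r L R \<eta> \<eta>' M =
     (let LM = ob_map L M; rLM = ob_map r LM in
      Comp A LM (ob_map R rLM) (ob_map R M)
        (hom_map R rLM M (THE v. inverse_arr B M rLM (\<eta> M) v)) (\<eta>' LM))"

end

theory Submission
  imports Defs
begin

text \<open>
  Write \<open>B = mod(P)\<close>, \<open>A = mod(B)\<close>, \<open>r : A \<rightarrow> B\<close> for restriction along the Yoneda embedding, and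
  \<open>M\<^sup>\<and> = B(?, M)\<close>.

  The functor \<open>KR\<close> is the Yoneda embedding because \<open>M \<mapsto> M\<^sup>\<and>\<close> has the universal property of a right adjoint
  of \<open>r\<close>. Evaluation at identities is an isomorphism \<open>ev M : r(M\<^sup>\<and>) \<rightarrow> M\<close>. A morphism
  \<open>\<beta> : r(F) \<rightarrow> M\<close> extends uniquely to a morphism \<open>F \<rightarrow> M\<^sup>\<and>\<close>: an element \<open>x\<close> of \<open>F(X)\<close> goes to the morphism
  \<open>X \<rightarrow> M\<close> given by \<open>p \<mapsto> \<beta>(F(p)(x))\<close>, where \<open>p \<in> X(T)\<close> is viewed as a morphism from \<open>P(?, T)\<close> to \<open>X\<close>
  (\<open>ev_existence\<close>, \<open>ev_uniqueness\<close>, \<open>comparison_nat_iso\<close>). In particular \<open>KR\<close> is fully faithful, and formally so is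
  \<open>KL\<close> (\<open>unit_invertible\<close>). The modules \<open>M\<^sup>\<and>\<close> are projective, since epimorphisms in \<open>A\<close> are pointwise surjective
  (\<open>fp_epic_surj\<close>, \<open>rep_projective\<close>). The functor \<open>KR\<close> preserves injectives, since \<open>r\<close> has the left adjoint \<open>KL\<close> and
  so preserves monomorphisms.

  For a representable module \<open>T\<close> over \<open>P\<close>, both \<open>KL T\<close> and \<open>T\<^sup>\<and>\<close> represent the functor \<open>F \<mapsto> F(T)\<close> on \<open>A\<close>, and the
  canonical morphism is the resulting isomorphism (\<open>can_rep_invertible\<close>). By naturality and additivity it
  is invertible on direct factors of finite sums of representables (\<open>can_invertible_sum\<close>).

  Finally let \<open>f : P0 \<rightarrow> M\<close> be an epimorphism with kernel \<open>g\<close> and with \<open>P0\<close> finitely generated projective. The left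
  adjoint \<open>KL\<close> preserves epimorphisms, so the image of \<open>KL M \<rightarrow> KR M\<close> is that of \<open>KL P0 \<rightarrow> KR M\<close>, and by
  the second part that of \<open>f\<^sup>\<and> : P0\<^sup>\<and> \<rightarrow> M\<^sup>\<and>\<close> (\<open>cokernel_can_imp_cokernel_KR\<close>). Images in \<open>A\<close> are
  pointwise, so this image is the cokernel of \<open>g\<^sup>\<and>\<close> (\<open>image_resolution\<close>). If \<open>P0\<close> is injective, then
  so is \<open>P0\<^sup>\<and>\<close>, every morphism from the first syzygy to \<open>KLR M\<close> extends to \<open>P0\<^sup>\<and>\<close>, and \<open>Ext\<^sup>1\<close> vanishes
  (\<open>rigid_of_resolution\<close>). As \<open>Ext\<^sup>1\<close> consists of classes of extensions, this also takes a direct sum of two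
  copies of \<open>KLR M\<close> in \<open>A\<close> (\<open>fp_direct_sum\<close>).

  That cokernels in \<open>A\<close> exist and are pointwise rests on a description of finitely presented modules over a category with finite
  direct sums as the modules with one generator and one morphism of relations (\<open>presented\<close>).
  Quotients are formed from chosen representatives, so they stay in the universe \<open>'v\<close>.
\<close>

section \<open>Linear maps\<close>

lemma linear_in: "linear_map K V W f \<Longrightarrow> x \<in> carrier V \<Longrightarrow> f x \<in> carrier W"
  by (auto simp: linear_map_def)

lemma linear_add:
  "linear_map K V W f \<Longrightarrow> x \<in> carrier V \<Longrightarrow> y \<in> carrier V \<Longrightarrow> f (x \<oplus>\<^bsub>V\<^esub> y) = f x \<oplus>\<^bsub>W\<^esub> f y"
  by (auto simp: linear_map_def)

lemma linear_smult:
  "linear_map K V W f \<Longrightarrow> a \<in> carrier K \<Longrightarrow> x \<in> carrier V \<Longrightarrow> f (a \<odot>\<^bsub>V\<^esub> x) = a \<odot>\<^bsub>W\<^esub> f x"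
  by (auto simp: linear_map_def)

lemma linear_mapI:
  assumes "\<And>x. x \<in> carrier V \<Longrightarrow> f x \<in> carrier W"
    and "\<And>x y. x \<in> carrier V \<Longrightarrow> y \<in> carrier V \<Longrightarrow> f (x \<oplus>\<^bsub>V\<^esub> y) = f x \<oplus>\<^bsub>W\<^esub> f y"
    and "\<And>a x. a \<in> carrier K \<Longrightarrow> x \<in> carrier V \<Longrightarrow> f (a \<odot>\<^bsub>V\<^esub> x) = a \<odot>\<^bsub>W\<^esub> f x"
  shows "linear_map K V W f"
  using assms by (auto simp: linear_map_def)

lemma linear_map_restrict:
  assumes "module K V"
  shows "linear_map K V W (\<lambda>x\<in>carrier V. f x) \<longleftrightarrow> linear_map K V W f"
proof -
  interpret module K V by fact
  show ?thesis unfolding linear_map_def by (auto simp: Pi_iff)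
qed

lemma module_abelian_group: "module K V \<Longrightarrow> abelian_group V"
  by (rule module.axioms(2))

lemma linear_group_hom:
  assumes "linear_map K V W f" "module K V" "module K W"
  shows "group_hom (add_monoid V) (add_monoid W) f"
proof -
  interpret V: module K V by fact
  interpret W: module K W by fact
  show ?thesis
    by (auto simp: group_hom_def group_hom_axioms_def hom_def V.a_group W.a_group
        intro: linear_in[OF assms(1)] linear_add[OF assms(1)])
qed

lemma linear_zero:
  "linear_map K V W f \<Longrightarrow> module K V \<Longrightarrow> module K W \<Longrightarrow> f \<zero>\<^bsub>V\<^esub> = \<zero>\<^bsub>W\<^esub>"
  using group_hom.hom_one[OF linear_group_hom] by fastforce

lemma linear_minus:
  "linear_map K V W f \<Longrightarrow> module K V \<Longrightarrow> module K W \<Longrightarrow> x \<in> carrier V \<Longrightarrow>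
   f (\<ominus>\<^bsub>V\<^esub> x) = \<ominus>\<^bsub>W\<^esub> f x"
  using group_hom.hom_inv[OF linear_group_hom, folded a_inv_def] by fastforce

lemma linear_diff:
  assumes "linear_map K V W f" "module K V" "module K W" "x \<in> carrier V" "y \<in> carrier V"
  shows "f (x \<ominus>\<^bsub>V\<^esub> y) = f x \<ominus>\<^bsub>W\<^esub> f y"
proof -
  interpret V: module K V by fact
  show ?thesis using assms
    by (simp add: a_minus_def linear_add[OF assms(1)] linear_minus)
qed

lemma linear_finsum:
  assumes f: "linear_map K V W f" and V: "module K V" and W: "module K W"
    and x: "\<And>i. i < n \<Longrightarrow> x i \<in> carrier V"
  shows "f (finsum V x {..<n}) = finsum W (\<lambda>i. f (x i)) {..<n::nat}"
proof -
  interpret V: module K V by fact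
  interpret W: module K W by fact
  show ?thesis using x
  proof (induction n)
    case 0
    then show ?case by (simp add: linear_zero[OF f V W])
  next
    case (Suc n)
    have 1: "x \<in> {..<n} \<rightarrow> carrier V" "x n \<in> carrier V"
      using Suc.prems by auto
    have 2: "(\<lambda>i. f (x i)) \<in> {..<n} \<rightarrow> carrier W" "f (x n) \<in> carrier W"
      using 1 linear_in[OF f] by auto
    show ?case
      using Suc.IH Suc.prems 1 2
      by (simp add: lessThan_Suc linear_add[OF f])
  qed
qed

text \<open>
  The linear structure on the image of a map that respects it. Both copies of a space along an
  injection and quotients, with chosen representatives as elements, have this form.
\<close>

lemma image_module:
  assumes V: "module K V"
    and W: "carrier W = p ` carrier V"
    and add: "\<And>x y. x \<in> carrier V \<Longrightarrow> y \<in> carrier V \<Longrightarrow> p x \<oplus>\<^bsub>W\<^esub> p y = p (x \<oplus>\<^bsub>V\<^esub> y)"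
    and smult: "\<And>a x. a \<in> carrier K \<Longrightarrow> x \<in> carrier V \<Longrightarrow> a \<odot>\<^bsub>W\<^esub> p x = p (a \<odot>\<^bsub>V\<^esub> x)"
    and zero: "\<zero>\<^bsub>W\<^esub> = p \<zero>\<^bsub>V\<^esub>"
  shows "module K W"
proof -
  interpret V: module K V by fact
  show ?thesis
  proof (rule moduleI)
    show "cring K" by (rule V.R.is_cring)
    show "abelian_group W"
    proof (rule abelian_groupI)
      fix x assume "x \<in> carrier W"
      then obtain v where v: "v \<in> carrier V" "x = p v" by (auto simp: W)
      show "\<exists>y\<in>carrier W. y \<oplus>\<^bsub>W\<^esub> x = \<zero>\<^bsub>W\<^esub>"
        using v by (intro bexI[of _ "p (\<ominus>\<^bsub>V\<^esub> v)"]) (auto simp: W add zero V.l_neg)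
    qed (auto simp: W add zero V.a_ac)
  qed (auto simp: W add smult V.smult_l_distr V.smult_r_distr V.smult_assoc1)
qed

section \<open>Linear categories\<close>

locale linear_category =
  fixes K :: "'k ring" and C :: "('k, 'o, 'm) kcat"
  assumes kcategory: "kcategory K C"
begin

lemma Hom_module [simp]: "X \<in> Ob C \<Longrightarrow> Y \<in> Ob C \<Longrightarrow> module K (Hom C X Y)"
  using kcategory by (simp add: kcategory_def)

lemma Hom_abelian_group [simp]: "X \<in> Ob C \<Longrightarrow> Y \<in> Ob C \<Longrightarrow> abelian_group (Hom C X Y)"
  by (simp add: module_abelian_group[of K])

lemma ident_in [simp]: "X \<in> Ob C \<Longrightarrow> Ident C X \<in> arr C X X"
  using kcategory by (simp add: kcategory_def)

lemma zero_in [simp]: "X \<in> Ob C \<Longrightarrow> Y \<in> Ob C \<Longrightarrow> \<zero>\<^bsub>Hom C X Y\<^esub> \<in> arr C X Y"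
  by (simp add: abelian_groupE(2))

lemma add_in [simp]:
  "X \<in> Ob C \<Longrightarrow> Y \<in> Ob C \<Longrightarrow> f \<in> arr C X Y \<Longrightarrow> f' \<in> arr C X Y \<Longrightarrow> f \<oplus>\<^bsub>Hom C X Y\<^esub> f' \<in> arr C X Y"
  by (simp add: abelian_groupE(1))

lemma diff_in [simp]:
  "X \<in> Ob C \<Longrightarrow> Y \<in> Ob C \<Longrightarrow> f \<in> arr C X Y \<Longrightarrow> f' \<in> arr C X Y \<Longrightarrow> f \<ominus>\<^bsub>Hom C X Y\<^esub> f' \<in> arr C X Y"
  by (simp add: abelian_group.minus_closed)

lemma finsum_in:
  "X \<in> Ob C \<Longrightarrow> Y \<in> Ob C \<Longrightarrow> (\<And>i. i < n \<Longrightarrow> f i \<in> arr C X Y) \<Longrightarrow>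
   finsum (Hom C X Y) f {..<n::nat} \<in> arr C X Y"
  by (auto intro!: abelian_monoid.finsum_closed abelian_group.axioms(1) Hom_abelian_group)

lemma diff_self: "X \<in> Ob C \<Longrightarrow> Y \<in> Ob C \<Longrightarrow> f \<in> arr C X Y \<Longrightarrow> f \<ominus>\<^bsub>Hom C X Y\<^esub> f = \<zero>\<^bsub>Hom C X Y\<^esub>"
  by (simp add: a_minus_def abelian_group.r_neg)

lemma diff_zero:
  "X \<in> Ob C \<Longrightarrow> Y \<in> Ob C \<Longrightarrow> f \<in> arr C X Y \<Longrightarrow> f \<ominus>\<^bsub>Hom C X Y\<^esub> \<zero>\<^bsub>Hom C X Y\<^esub> = f"
proof -
  assume *: "X \<in> Ob C" "Y \<in> Ob C" "f \<in> arr C X Y"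
  interpret abelian_group "Hom C X Y" using * by simp
  show ?thesis using * by (simp add: a_minus_def)
qed

lemma diff_add_cancel:
  "X \<in> Ob C \<Longrightarrow> Y \<in> Ob C \<Longrightarrow> f \<in> arr C X Y \<Longrightarrow> f' \<in> arr C X Y \<Longrightarrow>
   (f \<ominus>\<^bsub>Hom C X Y\<^esub> f') \<oplus>\<^bsub>Hom C X Y\<^esub> f' = f"
proof -
  assume *: "X \<in> Ob C" "Y \<in> Ob C" "f \<in> arr C X Y" "f' \<in> arr C X Y"
  interpret abelian_group "Hom C X Y" using * by simp
  show ?thesis using * by (simp add: a_minus_def a_assoc l_neg)
qed

lemma add_zero [simp]:
  "X \<in> Ob C \<Longrightarrow> Y \<in> Ob C \<Longrightarrow> f \<in> arr C X Y \<Longrightarrow> f \<oplus>\<^bsub>Hom C X Y\<^esub> \<zero>\<^bsub>Hom C X Y\<^esub> = f"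
  "X \<in> Ob C \<Longrightarrow> Y \<in> Ob C \<Longrightarrow> f \<in> arr C X Y \<Longrightarrow> \<zero>\<^bsub>Hom C X Y\<^esub> \<oplus>\<^bsub>Hom C X Y\<^esub> f = f"
  by (simp_all add: abelian_monoid.r_zero abelian_monoid.l_zero abelian_group.axioms(1))

lemma comp_linear_right:
  "X \<in> Ob C \<Longrightarrow> Y \<in> Ob C \<Longrightarrow> Z \<in> Ob C \<Longrightarrow> g \<in> arr C Y Z \<Longrightarrow>
   linear_map K (Hom C X Y) (Hom C X Z) (\<lambda>f. Comp C X Y Z g f)"
  using kcategory by (simp add: kcategory_def)

lemma comp_linear_left:
  "X \<in> Ob C \<Longrightarrow> Y \<in> Ob C \<Longrightarrow> Z \<in> Ob C \<Longrightarrow> f \<in> arr C X Y \<Longrightarrow>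
   linear_map K (Hom C Y Z) (Hom C X Z) (\<lambda>g. Comp C X Y Z g f)"
  using kcategory by (simp add: kcategory_def)

lemma comp_in [simp]:
  "X \<in> Ob C \<Longrightarrow> Y \<in> Ob C \<Longrightarrow> Z \<in> Ob C \<Longrightarrow> f \<in> arr C X Y \<Longrightarrow> g \<in> arr C Y Z \<Longrightarrow>
   Comp C X Y Z g f \<in> arr C X Z"
  by (rule linear_in[OF comp_linear_right])

lemma comp_ident [simp]:
  "X \<in> Ob C \<Longrightarrow> Y \<in> Ob C \<Longrightarrow> f \<in> arr C X Y \<Longrightarrow> Comp C X X Y f (Ident C X) = f"
  "X \<in> Ob C \<Longrightarrow> Y \<in> Ob C \<Longrightarrow> f \<in> arr C X Y \<Longrightarrow> Comp C X Y Y (Ident C Y) f = f"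
  using kcategory by (simp_all add: kcategory_def)

lemma comp_assoc:
  "W \<in> Ob C \<Longrightarrow> X \<in> Ob C \<Longrightarrow> Y \<in> Ob C \<Longrightarrow> Z \<in> Ob C \<Longrightarrow>
   f \<in> arr C W X \<Longrightarrow> g \<in> arr C X Y \<Longrightarrow> h \<in> arr C Y Z \<Longrightarrow>
   Comp C W X Z (Comp C X Y Z h g) f = Comp C W Y Z h (Comp C W X Y g f)"
  using kcategory by (simp add: kcategory_def)

lemma comp_zero [simp]:
  "X \<in> Ob C \<Longrightarrow> Y \<in> Ob C \<Longrightarrow> Z \<in> Ob C \<Longrightarrow> g \<in> arr C Y Z \<Longrightarrow>
   Comp C X Y Z g \<zero>\<^bsub>Hom C X Y\<^esub> = \<zero>\<^bsub>Hom C X Z\<^esub>"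
  "X \<in> Ob C \<Longrightarrow> Y \<in> Ob C \<Longrightarrow> Z \<in> Ob C \<Longrightarrow> f \<in> arr C X Y \<Longrightarrow>
   Comp C X Y Z \<zero>\<^bsub>Hom C Y Z\<^esub> f = \<zero>\<^bsub>Hom C X Z\<^esub>"
  using linear_zero[OF comp_linear_right] linear_zero[OF comp_linear_left] by simp_all

lemma comp_add:
  "X \<in> Ob C \<Longrightarrow> Y \<in> Ob C \<Longrightarrow> Z \<in> Ob C \<Longrightarrow> g \<in> arr C Y Z \<Longrightarrow> f \<in> arr C X Y \<Longrightarrow> f' \<in> arr C X Y \<Longrightarrow>
   Comp C X Y Z g (f \<oplus>\<^bsub>Hom C X Y\<^esub> f') = Comp C X Y Z g f \<oplus>\<^bsub>Hom C X Z\<^esub> Comp C X Y Z g f'"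
  "X \<in> Ob C \<Longrightarrow> Y \<in> Ob C \<Longrightarrow> Z \<in> Ob C \<Longrightarrow> f \<in> arr C X Y \<Longrightarrow> g \<in> arr C Y Z \<Longrightarrow> g' \<in> arr C Y Z \<Longrightarrow>
   Comp C X Y Z (g \<oplus>\<^bsub>Hom C Y Z\<^esub> g') f = Comp C X Y Z g f \<oplus>\<^bsub>Hom C X Z\<^esub> Comp C X Y Z g' f"
  using linear_add[OF comp_linear_right] linear_add[OF comp_linear_left] by simp_all

lemma comp_diff:
  "X \<in> Ob C \<Longrightarrow> Y \<in> Ob C \<Longrightarrow> Z \<in> Ob C \<Longrightarrow> g \<in> arr C Y Z \<Longrightarrow> f \<in> arr C X Y \<Longrightarrow> f' \<in> arr C X Y \<Longrightarrow>
   Comp C X Y Z g (f \<ominus>\<^bsub>Hom C X Y\<^esub> f') = Comp C X Y Z g f \<ominus>\<^bsub>Hom C X Z\<^esub> Comp C X Y Z g f'"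
  "X \<in> Ob C \<Longrightarrow> Y \<in> Ob C \<Longrightarrow> Z \<in> Ob C \<Longrightarrow> f \<in> arr C X Y \<Longrightarrow> g \<in> arr C Y Z \<Longrightarrow> g' \<in> arr C Y Z \<Longrightarrow>
   Comp C X Y Z (g \<ominus>\<^bsub>Hom C Y Z\<^esub> g') f = Comp C X Y Z g f \<ominus>\<^bsub>Hom C X Z\<^esub> Comp C X Y Z g' f"
  using linear_diff[OF comp_linear_right] linear_diff[OF comp_linear_left] by simp_all

lemma comp_finsum_right:
  "X \<in> Ob C \<Longrightarrow> Y \<in> Ob C \<Longrightarrow> Z \<in> Ob C \<Longrightarrow> g \<in> arr C Y Z \<Longrightarrow> (\<And>i. i < n \<Longrightarrow> f i \<in> arr C X Y) \<Longrightarrow>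
   Comp C X Y Z g (finsum (Hom C X Y) f {..<n::nat}) = finsum (Hom C X Z) (\<lambda>i. Comp C X Y Z g (f i)) {..<n}"
  using linear_finsum[OF comp_linear_right] by simp

lemma comp_finsum_left:
  "X \<in> Ob C \<Longrightarrow> Y \<in> Ob C \<Longrightarrow> Z \<in> Ob C \<Longrightarrow> f \<in> arr C X Y \<Longrightarrow> (\<And>i. i < n \<Longrightarrow> g i \<in> arr C Y Z) \<Longrightarrow>
   Comp C X Y Z (finsum (Hom C Y Z) g {..<n::nat}) f = finsum (Hom C X Z) (\<lambda>i. Comp C X Y Z (g i) f) {..<n}"
  using linear_finsum[OF comp_linear_left] by simp

lemma finsum_Hom_cong:
  assumes "X \<in> Ob C" "Y \<in> Ob C" "\<And>i. i < n \<Longrightarrow> f i = f' i" "\<And>i. i < n \<Longrightarrow> f' i \<in> arr C X Y"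
  shows "finsum (Hom C X Y) f {..<n::nat} = finsum (Hom C X Y) f' {..<n}"
proof -
  interpret abelian_group "Hom C X Y" using assms by simp
  show ?thesis using assms(3,4) by (intro finsum_cong') auto
qed

subsection \<open>Isomorphisms, kernels and cokernels\<close>

lemma invertibleE:
  assumes "invertible C X Y f"
  obtains g where "f \<in> arr C X Y" "g \<in> arr C Y X"
    "Comp C X Y X g f = Ident C X" "Comp C Y X Y f g = Ident C Y"
  using assms by (auto simp: invertible_def inverse_arr_def)

lemma inverse_arr_unique:
  assumes "X \<in> Ob C" "Y \<in> Ob C" "inverse_arr C X Y f g" "inverse_arr C X Y f g'"
  shows "g = g'"
proof -
  have "g = Comp C Y Y X g (Comp C Y X Y f g')"
    using assms by (auto simp: inverse_arr_def)
  also have "\<dots> = Comp C Y X X (Comp C X Y X g f) g'"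
    using assms by (subst comp_assoc) (auto simp: inverse_arr_def)
  also have "\<dots> = g'" using assms by (auto simp: inverse_arr_def)
  finally show ?thesis .
qed

lemma monic_cancel:
  "monic C X Y f \<Longrightarrow> T \<in> Ob C \<Longrightarrow> s \<in> arr C T X \<Longrightarrow> t \<in> arr C T X \<Longrightarrow>
   Comp C T X Y f s = Comp C T X Y f t \<Longrightarrow> s = t"
  by (auto simp: monic_def)

lemma epic_cancel:
  "epic C X Y f \<Longrightarrow> T \<in> Ob C \<Longrightarrow> s \<in> arr C Y T \<Longrightarrow> t \<in> arr C Y T \<Longrightarrow>
   Comp C X Y T s f = Comp C X Y T t f \<Longrightarrow> s = t"
  by (auto simp: epic_def)

lemma kernel_monic:
  assumes k: "is_kernel C X Y f N i" and *: "X \<in> Ob C" "Y \<in> Ob C" "f \<in> arr C X Y"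
  shows "monic C N X i"
  unfolding monic_def
proof (intro conjI ballI impI)
  show "i \<in> arr C N X" using k by (simp add: is_kernel_def)
  fix T s t assume st: "T \<in> Ob C" "s \<in> arr C T N" "t \<in> arr C T N"
    "Comp C T N X i s = Comp C T N X i t"
  have N: "N \<in> Ob C" "i \<in> arr C N X" "Comp C N X Y f i = \<zero>\<^bsub>Hom C N Y\<^esub>"
    using k by (auto simp: is_kernel_def)
  have "Comp C T X Y f (Comp C T N X i s) = \<zero>\<^bsub>Hom C T Y\<^esub>"
    using N * st by (simp add: comp_assoc[symmetric])
  then have "\<exists>!u. u \<in> arr C T N \<and> Comp C T N X i u = Comp C T N X i s"
    using k st N * by (auto simp: is_kernel_def)
  then show "s = t" using st by metis
qed

lemma cokernel_epic:
  assumes k: "is_cokernel C X Y f Q p" and *: "X \<in> Ob C" "Y \<in> Ob C" "f \<in> arr C X Y"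
  shows "epic C Y Q p"
  unfolding epic_def
proof (intro conjI ballI impI)
  show "p \<in> arr C Y Q" using k by (simp add: is_cokernel_def)
  fix T s t assume st: "T \<in> Ob C" "s \<in> arr C Q T" "t \<in> arr C Q T"
    "Comp C Y Q T s p = Comp C Y Q T t p"
  have N: "Q \<in> Ob C" "p \<in> arr C Y Q" "Comp C X Y Q p f = \<zero>\<^bsub>Hom C X Q\<^esub>"
    using k by (auto simp: is_cokernel_def)
  have "Comp C X Y T (Comp C Y Q T s p) f = \<zero>\<^bsub>Hom C X T\<^esub>"
    using N * st by (simp add: comp_assoc)
  then have "\<exists>!u. u \<in> arr C Q T \<and> Comp C Y Q T u p = Comp C Y Q T s p"
    using k st N * by (auto simp: is_cokernel_def)
  then show "s = t" using st by metis
qed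

lemma kernel_factor:
  assumes "is_kernel C X Y f N i" "T \<in> Ob C" "t \<in> arr C T X" "Comp C T X Y f t = \<zero>\<^bsub>Hom C T Y\<^esub>"
  obtains s where "s \<in> arr C T N" "Comp C T N X i s = t"
  using assms unfolding is_kernel_def by blast

lemma cokernel_factor:
  assumes "is_cokernel C X Y f Q p" "T \<in> Ob C" "t \<in> arr C Y T" "Comp C X Y T t f = \<zero>\<^bsub>Hom C X T\<^esub>"
  obtains s where "s \<in> arr C Q T" "Comp C Y Q T s p = t"
  using assms unfolding is_cokernel_def by blast

lemma is_kernelI:
  assumes "N \<in> Ob C" "Comp C N X Y f i = \<zero>\<^bsub>Hom C N Y\<^esub>" "monic C N X i"
    and "\<And>T t. T \<in> Ob C \<Longrightarrow> t \<in> arr C T X \<Longrightarrow> Comp C T X Y f t = \<zero>\<^bsub>Hom C T Y\<^esub> \<Longrightarrow>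
           \<exists>s\<in>arr C T N. Comp C T N X i s = t"
  shows "is_kernel C X Y f N i"
  unfolding is_kernel_def
proof (intro conjI ballI impI)
  fix T t assume t: "T \<in> Ob C" "t \<in> arr C T X" "Comp C T X Y f t = \<zero>\<^bsub>Hom C T Y\<^esub>"
  from assms(4)[OF t] obtain s where s: "s \<in> arr C T N" "Comp C T N X i s = t" by blast
  show "\<exists>!s. s \<in> arr C T N \<and> Comp C T N X i s = t"
    using s monic_cancel[OF assms(3) t(1)] by (intro ex1I[of _ s]) auto
qed (use assms in \<open>auto simp: monic_def\<close>)

lemma is_cokernelI:
  assumes "Q \<in> Ob C" "Comp C X Y Q p f = \<zero>\<^bsub>Hom C X Q\<^esub>" "epic C Y Q p"
    and "\<And>T t. T \<in> Ob C \<Longrightarrow> t \<in> arr C Y T \<Longrightarrow> Comp C X Y T t f = \<zero>\<^bsub>Hom C X T\<^esub> \<Longrightarrow>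
           \<exists>s\<in>arr C Q T. Comp C Y Q T s p = t"
  shows "is_cokernel C X Y f Q p"
  unfolding is_cokernel_def
proof (intro conjI ballI impI)
  fix T t assume t: "T \<in> Ob C" "t \<in> arr C Y T" "Comp C X Y T t f = \<zero>\<^bsub>Hom C X T\<^esub>"
  from assms(4)[OF t] obtain s where s: "s \<in> arr C Q T" "Comp C Y Q T s p = t" by blast
  show "\<exists>!s. s \<in> arr C Q T \<and> Comp C Y Q T s p = t"
    using s epic_cancel[OF assms(3) t(1)] by (intro ex1I[of _ s]) auto
qed (use assms in \<open>auto simp: epic_def\<close>)

text \<open>
  Cokernels, and below kernels, are transported along isomorphisms of the objects involved.
\<close>

lemma cokernel_iso:
  assumes cok: "is_cokernel C X Y f Q p" and u: "invertible C X' X u" and v: "inverse_arr C Y' Y v w"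
    and [simp]: "X \<in> Ob C" "Y \<in> Ob C" "X' \<in> Ob C" "Y' \<in> Ob C" "f \<in> arr C X Y" "f' \<in> arr C X' Y'"
    and eq: "Comp C X' X Y f u = Comp C X' Y' Y v f'"
  shows "is_cokernel C X' Y' f' Q (Comp C Y' Y Q p v)"
proof -
  obtain u' where [simp]: "u \<in> arr C X' X" "u' \<in> arr C X X'" and u': "Comp C X X' X u u' = Ident C X"
    using u by (rule invertibleE)
  have [simp]: "v \<in> arr C Y' Y" "w \<in> arr C Y Y'"
    and vw: "Comp C Y' Y Y' w v = Ident C Y'" "Comp C Y Y' Y v w = Ident C Y"
    using v by (auto simp: inverse_arr_def)
  have [simp]: "Q \<in> Ob C" "p \<in> arr C Y Q" and pf: "Comp C X Y Q p f = \<zero>\<^bsub>Hom C X Q\<^esub>"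
    using cok by (auto simp: is_cokernel_def)
  have ep: "epic C Y Q p" by (rule cokernel_epic[OF cok]) simp_all
  show ?thesis
  proof (rule is_cokernelI)
    have "Comp C X' Y' Q (Comp C Y' Y Q p v) f' = Comp C X' X Q (Comp C X Y Q p f) u"
      by (simp add: comp_assoc eq)
    then show "Comp C X' Y' Q (Comp C Y' Y Q p v) f' = \<zero>\<^bsub>Hom C X' Q\<^esub>" by (simp add: pf)
    show "epic C Y' Q (Comp C Y' Y Q p v)"
      unfolding epic_def
    proof (intro conjI ballI impI)
      fix T s t assume T: "T \<in> Ob C" "s \<in> arr C Q T" "t \<in> arr C Q T"
        and e: "Comp C Y' Q T s (Comp C Y' Y Q p v) = Comp C Y' Q T t (Comp C Y' Y Q p v)"
      have k: "Comp C Y Q T s p = Comp C Y Y' T (Comp C Y' Q T s (Comp C Y' Y Q p v)) w" if "s \<in> arr C Q T" for s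
        using T(1) that by (simp add: comp_assoc vw)
      have "Comp C Y Q T s p = Comp C Y Q T t p" by (simp only: k[OF T(2)] k[OF T(3)] e)
      then show "s = t" by (rule epic_cancel[OF ep T])
    qed simp
    fix T t assume T [simp]: "T \<in> Ob C" "t \<in> arr C Y' T" and 0: "Comp C X' Y' T t f' = \<zero>\<^bsub>Hom C X' T\<^esub>"
    have "Comp C X Y T (Comp C Y Y' T t w) f = Comp C X Y T (Comp C Y Y' T t w) (Comp C X X' Y (Comp C X' X Y f u) u')"
      by (simp add: comp_assoc u')
    also have "\<dots> = Comp C X X' T (Comp C X' Y' T t (Comp C X' Y' Y' (Comp C Y' Y Y' w v) f')) u'"
      unfolding eq by (simp add: comp_assoc)
    also have "\<dots> = \<zero>\<^bsub>Hom C X T\<^esub>" by (simp add: vw 0)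
    finally obtain s where s: "s \<in> arr C Q T" "Comp C Y Q T s p = Comp C Y Y' T t w"
      by (rule cokernel_factor[OF cok T(1), rotated]) simp_all
    have "Comp C Y' Q T s (Comp C Y' Y Q p v) = Comp C Y' Y T (Comp C Y Q T s p) v"
      using s(1) by (simp add: comp_assoc)
    also have "\<dots> = t" unfolding s(2) by (simp add: comp_assoc vw)
    finally show "\<exists>s\<in>arr C Q T. Comp C Y' Q T s (Comp C Y' Y Q p v) = t" using s(1) by blast
  qed simp
qed

lemma kernel_iso:
  assumes ker: "is_kernel C Y Q p Z i" and v: "inverse_arr C Y' Y v w"
    and [simp]: "Y \<in> Ob C" "Y' \<in> Ob C" "Q \<in> Ob C" "p \<in> arr C Y Q"
  shows "is_kernel C Y' Q (Comp C Y' Y Q p v) Z (Comp C Z Y Y' w i)"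
proof -
  have [simp]: "v \<in> arr C Y' Y" "w \<in> arr C Y Y'"
    and vw: "Comp C Y' Y Y' w v = Ident C Y'" "Comp C Y Y' Y v w = Ident C Y"
    using v by (auto simp: inverse_arr_def)
  have [simp]: "Z \<in> Ob C" "i \<in> arr C Z Y" and pi: "Comp C Z Y Q p i = \<zero>\<^bsub>Hom C Z Q\<^esub>"
    using ker by (auto simp: is_kernel_def)
  have mi: "monic C Z Y i" by (rule kernel_monic[OF ker]) simp_all
  have vwi: "Comp C T Y' Y v (Comp C T Z Y' (Comp C Z Y Y' w i) s) = Comp C T Z Y i s"
    if "T \<in> Ob C" "s \<in> arr C T Z" for T s
  proof -
    have "Comp C T Y' Y v (Comp C T Z Y' (Comp C Z Y Y' w i) s) = Comp C T Y Y (Comp C Y Y' Y v w) (Comp C T Z Y i s)"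
      using that by (simp add: comp_assoc)
    then show ?thesis using that by (simp add: vw)
  qed
  show ?thesis
  proof (rule is_kernelI)
    have "Comp C Z Y' Q (Comp C Y' Y Q p v) (Comp C Z Y Y' w i) = Comp C Z Y Q p (Comp C Z Y Y (Comp C Y Y' Y v w) i)"
      by (simp add: comp_assoc)
    then show "Comp C Z Y' Q (Comp C Y' Y Q p v) (Comp C Z Y Y' w i) = \<zero>\<^bsub>Hom C Z Q\<^esub>"
      by (simp add: vw pi)
    show "monic C Z Y' (Comp C Z Y Y' w i)"
      unfolding monic_def
    proof (intro conjI ballI impI)
      fix T s t assume T: "T \<in> Ob C" "s \<in> arr C T Z" "t \<in> arr C T Z"
        and e: "Comp C T Z Y' (Comp C Z Y Y' w i) s = Comp C T Z Y' (Comp C Z Y Y' w i) t"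
      have "Comp C T Z Y i s = Comp C T Z Y i t"
        using vwi[OF T(1,2)] vwi[OF T(1,3)] e by simp
      then show "s = t" by (rule monic_cancel[OF mi T])
    qed simp
    fix T t assume T [simp]: "T \<in> Ob C" "t \<in> arr C T Y'" and 0: "Comp C T Y' Q (Comp C Y' Y Q p v) t = \<zero>\<^bsub>Hom C T Q\<^esub>"
    then have "Comp C T Y Q p (Comp C T Y' Y v t) = \<zero>\<^bsub>Hom C T Q\<^esub>" by (simp add: comp_assoc)
    then obtain s where s: "s \<in> arr C T Z" "Comp C T Z Y i s = Comp C T Y' Y v t"
      by (rule kernel_factor[OF ker T(1), rotated]) simp_all
    have "Comp C T Z Y' (Comp C Z Y Y' w i) s = Comp C T Y Y' w (Comp C T Z Y i s)"
      using s(1) by (simp add: comp_assoc)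
    also have "\<dots> = Comp C T Y' Y' (Comp C Y' Y Y' w v) t" unfolding s(2) by (simp add: comp_assoc)
    also have "\<dots> = t" by (simp add: vw)
    finally show "\<exists>s\<in>arr C T Z. Comp C T Z Y' (Comp C Z Y Y' w i) s = t" using s(1) by blast
  qed simp
qed

lemma projective_iso:
  assumes P: "projective C P" and Q: "Q \<in> Ob C" and u: "invertible C P Q u"
  shows "projective C Q"
  unfolding projective_def
proof (intro conjI ballI allI impI Q)
  fix X Y p f assume *: "X \<in> Ob C" "Y \<in> Ob C" "epic C X Y p" "f \<in> arr C Q Y"
  obtain v where v: "u \<in> arr C P Q" "v \<in> arr C Q P" "Comp C Q P Q u v = Ident C Q"
    using u by (elim invertibleE)
  have P': "P \<in> Ob C" using P by (simp add: projective_def)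
  have p: "p \<in> arr C X Y" using * by (simp add: epic_def)
  have "Comp C P Q Y f u \<in> arr C P Y" using * v P' Q by simp
  then obtain g where g: "g \<in> arr C P X" "Comp C P X Y p g = Comp C P Q Y f u"
    using P * unfolding projective_def by metis
  have "Comp C Q X Y p (Comp C Q P X g v) = Comp C Q P Y (Comp C P X Y p g) v"
    using * v P' Q p g(1) by (simp add: comp_assoc)
  also have "\<dots> = f" using * v P' Q by (simp add: g comp_assoc)
  finally show "\<exists>g\<in>arr C Q X. Comp C Q X Y p g = f"
    using * v P' Q g by (intro bexI[of _ "Comp C Q P X g v"]) auto
qed

lemma injective_iso:
  assumes I: "injective C I" and J: "J \<in> Ob C" and u: "invertible C I J u"
  shows "injective C J"
  unfolding injective_def
proof (intro conjI ballI allI impI J)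
  fix X Y i f assume *: "X \<in> Ob C" "Y \<in> Ob C" "monic C X Y i" "f \<in> arr C X J"
  obtain v where v: "u \<in> arr C I J" "v \<in> arr C J I" "Comp C J I J u v = Ident C J"
    using u by (elim invertibleE)
  have I': "I \<in> Ob C" using I by (simp add: injective_def)
  have i: "i \<in> arr C X Y" using * by (simp add: monic_def)
  have "Comp C X J I v f \<in> arr C X I" using * v I' J by simp
  then obtain g where g: "g \<in> arr C Y I" "Comp C X Y I g i = Comp C X J I v f"
    using I * unfolding injective_def by metis
  have "Comp C X Y J (Comp C Y I J u g) i = Comp C X I J u (Comp C X J I v f)"
    using * v I' J i g by (simp add: comp_assoc)
  also have "\<dots> = f" using * v I' J by (simp add: comp_assoc[symmetric])
  finally show "\<exists>g\<in>arr C Y J. Comp C X Y J g i = f"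
    using * v I' J g by (intro bexI[of _ "Comp C Y I J u g"]) auto
qed

subsection \<open>Direct sums of two objects\<close>

lemma is_direct_sum_2_iff:
  "is_direct_sum C 2 Y S \<iota> \<pi> \<longleftrightarrow>
     S \<in> Ob C \<and> Y 0 \<in> Ob C \<and> Y 1 \<in> Ob C \<and>
     \<iota> 0 \<in> arr C (Y 0) S \<and> \<iota> 1 \<in> arr C (Y 1) S \<and> \<pi> 0 \<in> arr C S (Y 0) \<and> \<pi> 1 \<in> arr C S (Y 1) \<and>
     Comp C (Y 0) S (Y 0) (\<pi> 0) (\<iota> 0) = Ident C (Y 0) \<and>
     Comp C (Y 1) S (Y 1) (\<pi> 1) (\<iota> 1) = Ident C (Y 1) \<and>
     Comp C (Y 0) S (Y 1) (\<pi> 1) (\<iota> 0) = \<zero>\<^bsub>Hom C (Y 0) (Y 1)\<^esub> \<and>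
     Comp C (Y 1) S (Y 0) (\<pi> 0) (\<iota> 1) = \<zero>\<^bsub>Hom C (Y 1) (Y 0)\<^esub> \<and>
     Comp C S (Y 0) S (\<iota> 0) (\<pi> 0) \<oplus>\<^bsub>Hom C S S\<^esub> Comp C S (Y 1) S (\<iota> 1) (\<pi> 1) = Ident C S"
  (is "?L \<longleftrightarrow> ?R")
proof -
  have all2: "(\<forall>i<2. Q i) \<longleftrightarrow> Q 0 \<and> Q 1" for Q :: "nat \<Rightarrow> bool"
    by (auto simp: less_2_cases_iff)
  have fin: "finsum (Hom C S S) (\<lambda>i. Comp C S (Y i) S (\<iota> i) (\<pi> i)) {..<2} =
      Comp C S (Y 0) S (\<iota> 0) (\<pi> 0) \<oplus>\<^bsub>Hom C S S\<^esub> Comp C S (Y 1) S (\<iota> 1) (\<pi> 1)"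
    if *: "S \<in> Ob C" "Y 0 \<in> Ob C" "Y 1 \<in> Ob C" "\<iota> 0 \<in> arr C (Y 0) S" "\<iota> 1 \<in> arr C (Y 1) S"
      "\<pi> 0 \<in> arr C S (Y 0)" "\<pi> 1 \<in> arr C S (Y 1)"
  proof -
    interpret abelian_group "Hom C S S" using * by simp
    have "{..<2::nat} = {0, 1}" by auto
    then show ?thesis using * by simp
  qed
  show ?thesis
    unfolding is_direct_sum_def all2 by (auto simp: fin)
qed

lemma direct_sum_short_exact:
  assumes ds: "is_direct_sum C 2 Y S \<iota> \<pi>"
  shows "short_exact C (Y 0) S (Y 1) (\<iota> 0) (\<pi> 1)"
proof -
  note * = ds[unfolded is_direct_sum_2_iff One_nat_def]
  let ?a = "\<iota> 0" and ?b = "\<pi> (Suc 0)" and ?X = "Y 0" and ?Z = "Y (Suc 0)"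
  have [simp]: "S \<in> Ob C" "?X \<in> Ob C" "?Z \<in> Ob C" "\<iota> 0 \<in> arr C ?X S" "\<iota> (Suc 0) \<in> arr C ?Z S"
     "\<pi> 0 \<in> arr C S ?X" "\<pi> (Suc 0) \<in> arr C S ?Z"
    using * by auto
  have m: "monic C ?X S ?a"
    unfolding monic_def
  proof (intro conjI ballI impI)
    fix T s t assume st: "T \<in> Ob C" "s \<in> arr C T ?X" "t \<in> arr C T ?X" "Comp C T ?X S ?a s = Comp C T ?X S ?a t"
    have "s = Comp C T ?X ?X (Comp C ?X S ?X (\<pi> 0) ?a) s" using st * by simp
    also have "\<dots> = Comp C T ?X ?X (Comp C ?X S ?X (\<pi> 0) ?a) t" using st by (simp add: comp_assoc)
    also have "\<dots> = t" using st * by simp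
    finally show "s = t" .
  qed simp
  have e: "epic C S ?Z ?b"
    unfolding epic_def
  proof (intro conjI ballI impI)
    fix T s t assume st: "T \<in> Ob C" "s \<in> arr C ?Z T" "t \<in> arr C ?Z T" "Comp C S ?Z T s ?b = Comp C S ?Z T t ?b"
    have "s = Comp C ?Z ?Z T s (Comp C ?Z S ?Z ?b (\<iota> (Suc 0)))" using st * by simp
    also have "\<dots> = Comp C ?Z ?Z T t (Comp C ?Z S ?Z ?b (\<iota> (Suc 0)))" using st by (simp add: comp_assoc[symmetric])
    also have "\<dots> = t" using st * by simp
    finally show "s = t" .
  qed simp
  have "is_kernel C S ?Z ?b ?X ?a"
  proof (rule is_kernelI[OF _ _ m])
    fix T t assume t: "T \<in> Ob C" "t \<in> arr C T S" "Comp C T S ?Z ?b t = \<zero>\<^bsub>Hom C T ?Z\<^esub>"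
    have "t = Comp C T S S (Comp C S ?X S ?a (\<pi> 0) \<oplus>\<^bsub>Hom C S S\<^esub> Comp C S ?Z S (\<iota> (Suc 0)) ?b) t"
      using * t by simp
    also have "\<dots> = Comp C T ?X S ?a (Comp C T S ?X (\<pi> 0) t)"
      using t by (simp add: comp_add comp_assoc)
    finally show "\<exists>s\<in>arr C T ?X. Comp C T ?X S ?a s = t"
      using t by (intro bexI[of _ "Comp C T S ?X (\<pi> 0) t"]) simp_all
  qed (use * in auto)
  moreover have "is_cokernel C ?X S ?a ?Z ?b"
  proof (rule is_cokernelI[OF _ _ e])
    fix T t assume t: "T \<in> Ob C" "t \<in> arr C S T" "Comp C ?X S T t ?a = \<zero>\<^bsub>Hom C ?X T\<^esub>"
    have "t = Comp C S S T t (Comp C S ?X S ?a (\<pi> 0) \<oplus>\<^bsub>Hom C S S\<^esub> Comp C S ?Z S (\<iota> (Suc 0)) ?b)"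
      using * t by simp
    also have "\<dots> = Comp C S ?Z T (Comp C ?Z S T t (\<iota> (Suc 0))) ?b"
      using t by (simp add: comp_add comp_assoc[symmetric])
    finally show "\<exists>s\<in>arr C ?Z T. Comp C S ?Z T s ?b = t"
      using t by (intro bexI[of _ "Comp C ?Z S T t (\<iota> (Suc 0))"]) simp_all
  qed (use * in auto)
  ultimately show ?thesis by (simp add: short_exact_def)
qed

text \<open>
  If \<open>t\<close> is a section of \<open>b\<close>, then \<open>1 - t b\<close> is killed by \<open>b\<close>, hence factors through the kernel \<open>a\<close>. The
  factor is the projection onto \<open>X\<close>.
\<close>

lemma split_short_exact_direct_sum:
  assumes se: "short_exact C X E Z a b" and t: "t \<in> arr C Z E" "Comp C Z E Z b t = Ident C Z"
  obtains r where "is_direct_sum C 2 (\<lambda>i. if i = 0 then X else Z) E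
    (\<lambda>i. if i = 0 then a else t) (\<lambda>i. if i = 0 then r else b)"
proof -
  have [simp]: "X \<in> Ob C" "E \<in> Ob C" "Z \<in> Ob C" "a \<in> arr C X E" "b \<in> arr C E Z" "t \<in> arr C Z E"
    and ba: "Comp C X E Z b a = \<zero>\<^bsub>Hom C X Z\<^esub>" and ker: "is_kernel C E Z b X a"
    using se t by (auto simp: short_exact_def is_kernel_def is_cokernel_def)
  note m = kernel_monic[OF ker, simplified]
  let ?e = "Ident C E \<ominus>\<^bsub>Hom C E E\<^esub> Comp C E Z E t b"
  have "Comp C E E Z b ?e = \<zero>\<^bsub>Hom C E Z\<^esub>"
    by (simp add: comp_diff comp_assoc[symmetric] t diff_self)
  then obtain r where r [simp]: "r \<in> arr C E X" and ar: "Comp C E X E a r = ?e"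
    using kernel_factor[OF ker, of E ?e] by auto
  have "Comp C X X E a (Comp C X E X r a) = Comp C X E E (Comp C E X E a r) a"
    by (simp add: comp_assoc)
  also have "\<dots> = Comp C X X E a (Ident C X)"
    unfolding ar by (simp add: comp_diff comp_assoc ba diff_zero)
  finally have ra: "Comp C X E X r a = Ident C X"
    using monic_cancel[OF m, of X "Comp C X E X r a" "Ident C X"] by simp
  have "Comp C Z X E a (Comp C Z E X r t) = Comp C Z E E (Comp C E X E a r) t"
    by (simp add: comp_assoc)
  also have "\<dots> = Comp C Z X E a \<zero>\<^bsub>Hom C Z X\<^esub>"
    unfolding ar by (simp add: comp_diff comp_assoc t diff_self)
  finally have rt: "Comp C Z E X r t = \<zero>\<^bsub>Hom C Z X\<^esub>"
    using monic_cancel[OF m, of Z "Comp C Z E X r t" "\<zero>\<^bsub>Hom C Z X\<^esub>"] by simp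
  show ?thesis
    by (rule that[of r]) (simp add: is_direct_sum_2_iff ra rt ba t ar diff_add_cancel)
qed

text \<open>
  An isomorphism compatible with one injection and the complementary projection is all that
  equivalence of extensions asks for.
\<close>

lemma direct_sum_iso:
  assumes d: "is_direct_sum C 2 Y S \<iota> \<pi>" and d': "is_direct_sum C 2 Y S' \<iota>' \<pi>'"
  shows "\<exists>h. invertible C S S' h \<and> Comp C (Y 0) S S' h (\<iota> 0) = \<iota>' 0 \<and> Comp C S S' (Y 1) (\<pi>' 1) h = \<pi> 1"
proof -
  note * = d[unfolded is_direct_sum_2_iff One_nat_def] and ** = d'[unfolded is_direct_sum_2_iff One_nat_def]
  have [simp]: "S \<in> Ob C" "Y 0 \<in> Ob C" "Y (Suc 0) \<in> Ob C" "\<iota> 0 \<in> arr C (Y 0) S" "\<iota> (Suc 0) \<in> arr C (Y (Suc 0)) S"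
     "\<pi> 0 \<in> arr C S (Y 0)" "\<pi> (Suc 0) \<in> arr C S (Y (Suc 0))" "S' \<in> Ob C" "\<iota>' 0 \<in> arr C (Y 0) S'" "\<iota>' (Suc 0) \<in> arr C (Y (Suc 0)) S'"
     "\<pi>' 0 \<in> arr C S' (Y 0)" "\<pi>' (Suc 0) \<in> arr C S' (Y (Suc 0))"
    using * ** by auto
  define h where "h = Comp C S (Y 0) S' (\<iota>' 0) (\<pi> 0) \<oplus>\<^bsub>Hom C S S'\<^esub> Comp C S (Y 1) S' (\<iota>' 1) (\<pi> 1)"
  define h' where "h' = Comp C S' (Y 0) S (\<iota> 0) (\<pi>' 0) \<oplus>\<^bsub>Hom C S' S\<^esub> Comp C S' (Y 1) S (\<iota> 1) (\<pi>' 1)"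
  have [simp]: "h \<in> arr C S S'" "h' \<in> arr C S' S" by (simp_all add: h_def h'_def)
  have h: "Comp C (Y 0) S S' h (\<iota> 0) = \<iota>' 0" "Comp C (Y 1) S S' h (\<iota> 1) = \<iota>' 1"
    using * by (simp_all add: h_def comp_add comp_assoc)
  have h': "Comp C (Y 0) S' S h' (\<iota>' 0) = \<iota> 0" "Comp C (Y 1) S' S h' (\<iota>' 1) = \<iota> 1"
    using ** by (simp_all add: h'_def comp_add comp_assoc)
  have p: "Comp C S S' (Y 1) (\<pi>' 1) h = \<pi> 1"
    using ** by (simp add: h_def comp_add comp_assoc[symmetric])
  have "Comp C S S' S h' h = Ident C S"
    using * h' by (simp add: h_def comp_add comp_assoc[symmetric])
  moreover have "Comp C S' S S' h h' = Ident C S'"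
    using ** h by (simp add: h'_def comp_add comp_assoc[symmetric])
  ultimately have "inverse_arr C S S' h h'" by (simp add: inverse_arr_def)
  then show ?thesis
    using h p by (auto simp: invertible_def)
qed

subsection \<open>Rigidity\<close>

text \<open>
  If all extensions split, they are direct sums, and these form a single equivalence class. The
  existence of a direct sum ensures that this class is there at all.
\<close>

lemma Ext1_zeroI:
  assumes split: "\<And>E a b. short_exact C X E Z a b \<Longrightarrow> \<exists>t\<in>arr C Z E. Comp C Z E Z b t = Ident C Z"
    and ds: "is_direct_sum C 2 (\<lambda>i. if i = 0 then X else Z) S \<iota> \<pi>"
  shows "Ext1 C Z X = {Ext1_zero C Z X}"
proof -
  let ?Y = "\<lambda>i::nat. if i = 0 then X else Z"
  have eq: "Ext1_zero C Z X = extensions C Z X"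
  proof
    show "Ext1_zero C Z X \<subseteq> extensions C Z X"
      using direct_sum_short_exact by (fastforce simp: Ext1_zero_def extensions_def)
    show "extensions C Z X \<subseteq> Ext1_zero C Z X"
    proof (clarsimp simp: extensions_def)
      fix E a b assume se: "short_exact C X E Z a b"
      then obtain t where "t \<in> arr C Z E" "Comp C Z E Z b t = Ident C Z" using split by blast
      then obtain r where "is_direct_sum C 2 ?Y E (\<lambda>i. if i = 0 then a else t) (\<lambda>i. if i = 0 then r else b)"
        by (rule split_short_exact_direct_sum[OF se])
      then have "\<exists>\<iota> \<pi>. is_direct_sum C 2 ?Y E \<iota> \<pi> \<and> a = \<iota> 0 \<and> b = \<pi> 1"
        by (intro exI[of _ "\<lambda>i. if i = 0 then a else t"] exI[of _ "\<lambda>i. if i = 0 then r else b"]) simp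
      then show "(E, a, b) \<in> Ext1_zero C Z X"
        by (simp add: Ext1_zero_def)
    qed
  qed
  have "extension_equiv C Z X `` {e} = extensions C Z X" if e: "e \<in> extensions C Z X" for e
  proof -
    have "(e, e') \<in> extension_equiv C Z X" if e': "e' \<in> extensions C Z X" for e'
    proof -
      obtain E a b where E: "e = (E, a, b)" by (cases e)
      obtain E' a' b' where E': "e' = (E', a', b')" by (cases e')
      from e obtain \<iota> \<pi> where 1: "is_direct_sum C 2 ?Y E \<iota> \<pi>" "a = \<iota> 0" "b = \<pi> 1"
        unfolding E eq[symmetric] Ext1_zero_def by auto
      from e' obtain \<iota>' \<pi>' where 2: "is_direct_sum C 2 ?Y E' \<iota>' \<pi>'" "a' = \<iota>' 0" "b' = \<pi>' 1"
        unfolding E' eq[symmetric] Ext1_zero_def by auto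
      show ?thesis
        using direct_sum_iso[OF 1(1) 2(1)] e e' 1 2
        by (auto simp: extension_equiv_def E E')
    qed
    then show ?thesis by (auto simp: extension_equiv_def)
  qed
  moreover have "(S, \<iota> 0, \<pi> 1) \<in> extensions C Z X"
    using ds unfolding eq[symmetric] Ext1_zero_def by blast
  ultimately show ?thesis unfolding Ext1_def quotient_def eq by auto
qed

text \<open>
  The resolution identifies \<open>Ext\<^sup>1(Z, Z)\<close> with the cokernel of \<open>Hom(P, Z) \<rightarrow> Hom(N, Z)\<close>, which vanishes
  because every morphism \<open>N \<rightarrow> Z\<close> extends along \<open>g\<close>. In terms of extensions: a lift \<open>s\<close> of \<open>q\<close> along
  \<open>b : E \<rightarrow> Z\<close>, corrected by such an extension, kills \<open>g\<close> and so descends to a section of \<open>b\<close>.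
\<close>

lemma rigid_of_resolution:
  assumes se: "short_exact C N P Z g q" and N: "projective C N" and P: "projective C P" "injective C P"
    and ds: "is_direct_sum C 2 (\<lambda>i. Z) S \<iota> \<pi>"
  shows "rigid C Z"
proof -
  have [simp]: "N \<in> Ob C" "P \<in> Ob C" "Z \<in> Ob C" "g \<in> arr C N P" "q \<in> arr C P Z"
    and qg: "Comp C N P Z q g = \<zero>\<^bsub>Hom C N Z\<^esub>"
    and ker: "is_kernel C P Z q N g" and cok: "is_cokernel C N P g Z q"
    using se by (auto simp: short_exact_def is_kernel_def is_cokernel_def)
  have gm: "monic C N P g" using kernel_monic[OF ker] by simp
  have qe: "epic C P Z q" using cokernel_epic[OF cok] by simp
  \<comment> \<open>Since \<open>N\<close> is projective and \<open>P\<close> injective, every morphism \<open>N \<rightarrow> Z\<close> factors through \<open>g\<close>.\<close>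
  have ext: "\<exists>v\<in>arr C P Z. Comp C N P Z v g = u" if u: "u \<in> arr C N Z" for u
  proof -
    obtain u' where u': "u' \<in> arr C N P" "Comp C N P Z q u' = u"
      using N qe u unfolding projective_def by (meson \<open>P \<in> Ob C\<close> \<open>Z \<in> Ob C\<close>)
    obtain v where v: "v \<in> arr C P P" "Comp C N P P v g = u'"
      using P(2) gm u'(1) unfolding injective_def by (meson \<open>N \<in> Ob C\<close> \<open>P \<in> Ob C\<close>)
    show ?thesis
      using u' v by (intro bexI[of _ "Comp C P P Z q v"]) (simp_all add: comp_assoc)
  qed
  have "Ext1 C Z Z = {Ext1_zero C Z Z}"
  proof (rule Ext1_zeroI)
    show "is_direct_sum C 2 (\<lambda>i. if i = 0 then Z else Z) S \<iota> \<pi>" using ds by simp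
    fix E a b assume se': "short_exact C Z E Z a b"
    have [simp]: "E \<in> Ob C" "a \<in> arr C Z E" "b \<in> arr C E Z"
      and ba: "Comp C Z E Z b a = \<zero>\<^bsub>Hom C Z Z\<^esub>"
      and ker': "is_kernel C E Z b Z a" and cok': "is_cokernel C Z E a Z b"
      using se' by (auto simp: short_exact_def is_kernel_def is_cokernel_def)
    have be: "epic C E Z b" using cokernel_epic[OF cok'] by simp
    obtain s where s [simp]: "s \<in> arr C P E" and bs: "Comp C P E Z b s = q"
      using P(1) be unfolding projective_def by (meson \<open>E \<in> Ob C\<close> \<open>Z \<in> Ob C\<close> \<open>q \<in> arr C P Z\<close>)
    have "Comp C N E Z b (Comp C N P E s g) = \<zero>\<^bsub>Hom C N Z\<^esub>"
      by (simp add: comp_assoc[symmetric] bs qg)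
    then obtain u where u: "u \<in> arr C N Z" "Comp C N Z E a u = Comp C N P E s g"
      by (rule kernel_factor[OF ker', rotated 2]) simp_all
    obtain v where v [simp]: "v \<in> arr C P Z" and vg: "Comp C N P Z v g = u" using ext[OF u(1)] by blast
    let ?s = "s \<ominus>\<^bsub>Hom C P E\<^esub> Comp C P Z E a v"
    have "Comp C N P E ?s g = \<zero>\<^bsub>Hom C N E\<^esub>"
      by (simp add: comp_diff comp_assoc vg u diff_self)
    then obtain t where t: "t \<in> arr C Z E" "Comp C P Z E t q = ?s"
      by (rule cokernel_factor[OF cok, rotated 2]) simp_all
    have "Comp C P Z Z (Comp C Z E Z b t) q = Comp C P E Z b ?s"
      using t by (simp add: comp_assoc)
    also have "\<dots> = Comp C P Z Z (Ident C Z) q"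
      by (simp add: comp_diff comp_assoc[symmetric] bs ba diff_zero)
    finally have "Comp C Z E Z b t = Ident C Z"
      using epic_cancel[OF qe, of Z "Comp C Z E Z b t" "Ident C Z"] t(1) by simp
    then show "\<exists>t\<in>arr C Z E. Comp C Z E Z b t = Ident C Z" using t by blast
  qed
  then show ?thesis by (simp add: rigid_def)
qed

end

section \<open>Linear functors and adjunctions\<close>

locale linear_functor = C: linear_category K C + D: linear_category K D
  for K :: "'k ring" and C :: "('k, 'o, 'm) kcat" and D :: "('k, 'p, 'n) kcat" +
  fixes F :: "('o, 'm, 'p, 'n) kfun"
  assumes kfunctor: "kfunctor K C D F"
begin

lemma ob_in [simp]: "X \<in> Ob C \<Longrightarrow> ob_map F X \<in> Ob D"
  using kfunctor by (simp add: kfunctor_def)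

lemma map_linear:
  "X \<in> Ob C \<Longrightarrow> Y \<in> Ob C \<Longrightarrow>
   linear_map K (Hom C X Y) (Hom D (ob_map F X) (ob_map F Y)) (hom_map F X Y)"
  using kfunctor by (simp add: kfunctor_def)

lemma map_in [simp]:
  "X \<in> Ob C \<Longrightarrow> Y \<in> Ob C \<Longrightarrow> f \<in> arr C X Y \<Longrightarrow> hom_map F X Y f \<in> arr D (ob_map F X) (ob_map F Y)"
  by (rule linear_in[OF map_linear])

lemma map_ident [simp]: "X \<in> Ob C \<Longrightarrow> hom_map F X X (Ident C X) = Ident D (ob_map F X)"
  using kfunctor by (simp add: kfunctor_def)

lemma map_comp:
  "X \<in> Ob C \<Longrightarrow> Y \<in> Ob C \<Longrightarrow> Z \<in> Ob C \<Longrightarrow> f \<in> arr C X Y \<Longrightarrow> g \<in> arr C Y Z \<Longrightarrow>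
   hom_map F X Z (Comp C X Y Z g f) =
   Comp D (ob_map F X) (ob_map F Y) (ob_map F Z) (hom_map F Y Z g) (hom_map F X Y f)"
  using kfunctor by (simp add: kfunctor_def)

lemma map_add:
  "X \<in> Ob C \<Longrightarrow> Y \<in> Ob C \<Longrightarrow> f \<in> arr C X Y \<Longrightarrow> g \<in> arr C X Y \<Longrightarrow>
   hom_map F X Y (f \<oplus>\<^bsub>Hom C X Y\<^esub> g) =
   hom_map F X Y f \<oplus>\<^bsub>Hom D (ob_map F X) (ob_map F Y)\<^esub> hom_map F X Y g"
  by (rule linear_add[OF map_linear])

lemma map_zero [simp]:
  "X \<in> Ob C \<Longrightarrow> Y \<in> Ob C \<Longrightarrow> hom_map F X Y \<zero>\<^bsub>Hom C X Y\<^esub> = \<zero>\<^bsub>Hom D (ob_map F X) (ob_map F Y)\<^esub>"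
  by (rule linear_zero[OF map_linear]) auto

lemma map_finsum:
  "X \<in> Ob C \<Longrightarrow> Y \<in> Ob C \<Longrightarrow> (\<And>i. i < n \<Longrightarrow> f i \<in> arr C X Y) \<Longrightarrow>
   hom_map F X Y (finsum (Hom C X Y) f {..<n::nat}) =
   finsum (Hom D (ob_map F X) (ob_map F Y)) (\<lambda>i. hom_map F X Y (f i)) {..<n}"
  by (rule linear_finsum[OF map_linear]) auto

end

locale adjoint_functors = C: linear_category K C + D: linear_category K D
  for K :: "'k ring" and C :: "('k, 'o, 'm) kcat" and D :: "('k, 'p, 'n) kcat" +
  fixes F :: "('o, 'm, 'p, 'n) kfun" and G :: "('p, 'n, 'o, 'm) kfun"
    and \<eta> :: "'o \<Rightarrow> 'm" and \<epsilon> :: "'p \<Rightarrow> 'n"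
  assumes adjunction: "adjunction K C D F G \<eta> \<epsilon>"
begin

sublocale F: linear_functor K C D F
  using adjunction by unfold_locales (simp add: adjunction_def)

sublocale G: linear_functor K D C G
  using adjunction by unfold_locales (simp add: adjunction_def)

lemma unit_in [simp]: "X \<in> Ob C \<Longrightarrow> \<eta> X \<in> arr C X (ob_map G (ob_map F X))"
  using adjunction by (simp add: adjunction_def nat_trans_def id_functor_def comp_functor_def)

lemma counit_in [simp]: "Y \<in> Ob D \<Longrightarrow> \<epsilon> Y \<in> arr D (ob_map F (ob_map G Y)) Y"
  using adjunction by (simp add: adjunction_def nat_trans_def id_functor_def comp_functor_def)

lemma unit_natural:
  "X \<in> Ob C \<Longrightarrow> Y \<in> Ob C \<Longrightarrow> f \<in> arr C X Y \<Longrightarrow>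
   Comp C X (ob_map G (ob_map F X)) (ob_map G (ob_map F Y))
     (hom_map G (ob_map F X) (ob_map F Y) (hom_map F X Y f)) (\<eta> X) =
   Comp C X Y (ob_map G (ob_map F Y)) (\<eta> Y) f"
  using adjunction by (simp add: adjunction_def nat_trans_def id_functor_def comp_functor_def)

lemma counit_natural:
  "X \<in> Ob D \<Longrightarrow> Y \<in> Ob D \<Longrightarrow> f \<in> arr D X Y \<Longrightarrow>
   Comp D (ob_map F (ob_map G X)) (ob_map F (ob_map G Y)) Y
     (\<epsilon> Y) (hom_map F (ob_map G X) (ob_map G Y) (hom_map G X Y f)) =
   Comp D (ob_map F (ob_map G X)) X Y f (\<epsilon> X)"
  using adjunction by (simp add: adjunction_def nat_trans_def id_functor_def comp_functor_def)

lemma triangle_F: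
  "X \<in> Ob C \<Longrightarrow>
   Comp D (ob_map F X) (ob_map F (ob_map G (ob_map F X))) (ob_map F X)
     (\<epsilon> (ob_map F X)) (hom_map F X (ob_map G (ob_map F X)) (\<eta> X)) = Ident D (ob_map F X)"
  using adjunction by (simp add: adjunction_def)

lemma triangle_G:
  "Y \<in> Ob D \<Longrightarrow>
   Comp C (ob_map G Y) (ob_map G (ob_map F (ob_map G Y))) (ob_map G Y)
     (hom_map G (ob_map F (ob_map G Y)) Y (\<epsilon> Y)) (\<eta> (ob_map G Y)) = Ident C (ob_map G Y)"
  using adjunction by (simp add: adjunction_def)

text \<open>
  The triangle identities say that the two transpositions between \<open>Hom(F X, Y)\<close> and \<open>Hom(X, G Y)\<close> are
  mutually inverse, so that equations between morphisms may be checked after transposition.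
\<close>

lemma transpose_back:
  assumes "X \<in> Ob C" "Y \<in> Ob D" "f \<in> arr D (ob_map F X) Y"
  shows "Comp D (ob_map F X) (ob_map F (ob_map G Y)) Y (\<epsilon> Y)
     (hom_map F X (ob_map G Y)
       (Comp C X (ob_map G (ob_map F X)) (ob_map G Y) (hom_map G (ob_map F X) Y f) (\<eta> X))) = f"
proof -
  let ?FX = "ob_map F X"
  have "Comp D ?FX (ob_map F (ob_map G Y)) Y (\<epsilon> Y) (hom_map F X (ob_map G Y)
       (Comp C X (ob_map G ?FX) (ob_map G Y) (hom_map G ?FX Y f) (\<eta> X)))
    = Comp D ?FX (ob_map F (ob_map G ?FX)) Y
       (Comp D (ob_map F (ob_map G ?FX)) (ob_map F (ob_map G Y)) Y (\<epsilon> Y)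
          (hom_map F (ob_map G ?FX) (ob_map G Y) (hom_map G ?FX Y f)))
       (hom_map F X (ob_map G ?FX) (\<eta> X))"
    using assms by (simp add: F.map_comp D.comp_assoc)
  also have "\<dots> = f"
    using assms by (simp add: counit_natural D.comp_assoc triangle_F)
  finally show ?thesis .
qed

lemma transpose_forth:
  assumes "X \<in> Ob C" "Y \<in> Ob D" "g \<in> arr C X (ob_map G Y)"
  shows "Comp C X (ob_map G (ob_map F X)) (ob_map G Y)
     (hom_map G (ob_map F X) Y
       (Comp D (ob_map F X) (ob_map F (ob_map G Y)) Y (\<epsilon> Y) (hom_map F X (ob_map G Y) g))) (\<eta> X) = g"
proof -
  let ?GY = "ob_map G Y"
  have "Comp C X (ob_map G (ob_map F X)) ?GY (hom_map G (ob_map F X) Y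
       (Comp D (ob_map F X) (ob_map F ?GY) Y (\<epsilon> Y) (hom_map F X ?GY g))) (\<eta> X)
    = Comp C X (ob_map G (ob_map F ?GY)) ?GY (hom_map G (ob_map F ?GY) Y (\<epsilon> Y))
       (Comp C X (ob_map G (ob_map F X)) (ob_map G (ob_map F ?GY))
          (hom_map G (ob_map F X) (ob_map F ?GY) (hom_map F X ?GY g)) (\<eta> X))"
    using assms by (simp add: G.map_comp C.comp_assoc)
  also have "\<dots> = Comp C X ?GY ?GY (Comp C ?GY (ob_map G (ob_map F ?GY)) ?GY
      (hom_map G (ob_map F ?GY) Y (\<epsilon> Y)) (\<eta> ?GY)) g"
    using assms by (simp add: unit_natural C.comp_assoc)
  also have "\<dots> = g" using assms by (simp add: triangle_G)
  finally show ?thesis .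
qed

lemma transpose_left_unique:
  assumes "X \<in> Ob C" "Y \<in> Ob D" "f \<in> arr D (ob_map F X) Y" "f' \<in> arr D (ob_map F X) Y"
    and "Comp C X (ob_map G (ob_map F X)) (ob_map G Y) (hom_map G (ob_map F X) Y f) (\<eta> X) =
         Comp C X (ob_map G (ob_map F X)) (ob_map G Y) (hom_map G (ob_map F X) Y f') (\<eta> X)"
  shows "f = f'"
  by (rule trans[OF transpose_back[OF assms(1,2,3), symmetric]])
     (simp only: assms(5) transpose_back[OF assms(1,2,4)])

lemma transpose_right_unique:
  assumes "X \<in> Ob C" "Y \<in> Ob D" "g \<in> arr C X (ob_map G Y)" "g' \<in> arr C X (ob_map G Y)"
    and "Comp D (ob_map F X) (ob_map F (ob_map G Y)) Y (\<epsilon> Y) (hom_map F X (ob_map G Y) g) =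
         Comp D (ob_map F X) (ob_map F (ob_map G Y)) Y (\<epsilon> Y) (hom_map F X (ob_map G Y) g')"
  shows "g = g'"
  by (rule trans[OF transpose_forth[OF assms(1,2,3), symmetric]])
     (simp only: assms(5) transpose_forth[OF assms(1,2,4)])

text \<open>
  Transposition turns composition with \<open>F f\<close> into composition with \<open>f\<close>, so cancellation carries over
  from \<open>f\<close> to \<open>F f\<close>.
\<close>

lemma left_adjoint_epic:
  assumes "X \<in> Ob C" "Y \<in> Ob C" and e: "epic C X Y f"
  shows "epic D (ob_map F X) (ob_map F Y) (hom_map F X Y f)"
  unfolding epic_def
proof (intro conjI ballI impI)
  have f: "f \<in> arr C X Y" using e by (simp add: epic_def)
  show "hom_map F X Y f \<in> arr D (ob_map F X) (ob_map F Y)" using assms f by simp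
  fix T s t assume T: "T \<in> Ob D" "s \<in> arr D (ob_map F Y) T" "t \<in> arr D (ob_map F Y) T"
    and eq: "Comp D (ob_map F X) (ob_map F Y) T s (hom_map F X Y f) =
             Comp D (ob_map F X) (ob_map F Y) T t (hom_map F X Y f)"
  let ?u = "\<lambda>s. Comp C Y (ob_map G (ob_map F Y)) (ob_map G T) (hom_map G (ob_map F Y) T s) (\<eta> Y)"
  have "Comp C X Y (ob_map G T) (?u s) f =
      Comp C X (ob_map G (ob_map F X)) (ob_map G T)
        (hom_map G (ob_map F X) T (Comp D (ob_map F X) (ob_map F Y) T s (hom_map F X Y f))) (\<eta> X)"
    if "s \<in> arr D (ob_map F Y) T" for s
    using assms f T that by (simp add: G.map_comp C.comp_assoc unit_natural)
  then have "Comp C X Y (ob_map G T) (?u s) f = Comp C X Y (ob_map G T) (?u t) f"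
    using T eq by simp
  then have "?u s = ?u t"
    using assms T C.epic_cancel[OF e, of "ob_map G T" "?u s" "?u t"] by simp
  then show "s = t" by (rule transpose_left_unique[OF assms(2) T(1-3)])
qed

lemma right_adjoint_monic:
  assumes "X \<in> Ob D" "Y \<in> Ob D" and m: "monic D X Y f"
  shows "monic C (ob_map G X) (ob_map G Y) (hom_map G X Y f)"
  unfolding monic_def
proof (intro conjI ballI impI)
  have f: "f \<in> arr D X Y" using m by (simp add: monic_def)
  show "hom_map G X Y f \<in> arr C (ob_map G X) (ob_map G Y)" using assms f by simp
  fix T s t assume T: "T \<in> Ob C" "s \<in> arr C T (ob_map G X)" "t \<in> arr C T (ob_map G X)"
    and eq: "Comp C T (ob_map G X) (ob_map G Y) (hom_map G X Y f) s =
             Comp C T (ob_map G X) (ob_map G Y) (hom_map G X Y f) t"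
  let ?u = "\<lambda>s. Comp D (ob_map F T) (ob_map F (ob_map G X)) X (\<epsilon> X) (hom_map F T (ob_map G X) s)"
  have "Comp D (ob_map F T) X Y f (?u s) =
      Comp D (ob_map F T) (ob_map F (ob_map G Y)) Y (\<epsilon> Y)
        (hom_map F T (ob_map G Y) (Comp C T (ob_map G X) (ob_map G Y) (hom_map G X Y f) s))"
    if "s \<in> arr C T (ob_map G X)" for s
    using assms f T that by (simp add: F.map_comp D.comp_assoc[symmetric] counit_natural)
  then have "Comp D (ob_map F T) X Y f (?u s) = Comp D (ob_map F T) X Y f (?u t)"
    using T eq by simp
  then have "?u s = ?u t"
    using assms T D.monic_cancel[OF m, of "ob_map F T" "?u s" "?u t"] by simp
  then show "s = t" by (rule transpose_right_unique[OF T(1) assms(1) T(2,3)])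
qed

text \<open>
  An extension problem for \<open>G I\<close> along \<open>i\<close> transposes to one for \<open>I\<close> along \<open>F i\<close>.
\<close>

lemma right_adjoint_injective:
  assumes mono: "\<And>X Y i. X \<in> Ob C \<Longrightarrow> Y \<in> Ob C \<Longrightarrow> monic C X Y i \<Longrightarrow>
      monic D (ob_map F X) (ob_map F Y) (hom_map F X Y i)"
    and I: "injective D I"
  shows "injective C (ob_map G I)"
  unfolding injective_def
proof (intro conjI ballI allI impI)
  have I': "I \<in> Ob D" using I by (simp add: injective_def)
  show "ob_map G I \<in> Ob C" using I' by simp
  fix X Y i f assume *: "X \<in> Ob C" "Y \<in> Ob C" "monic C X Y i" "f \<in> arr C X (ob_map G I)"
  have i: "i \<in> arr C X Y" using * by (simp add: monic_def)
  let ?f = "Comp D (ob_map F X) (ob_map F (ob_map G I)) I (\<epsilon> I) (hom_map F X (ob_map G I) f)"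
  have "?f \<in> arr D (ob_map F X) I" using * I' by simp
  then obtain g where g: "g \<in> arr D (ob_map F Y) I"
    and gi: "Comp D (ob_map F X) (ob_map F Y) I g (hom_map F X Y i) = ?f"
    using I mono[OF *(1-3)] * unfolding injective_def by (meson F.ob_in)
  let ?g = "Comp C Y (ob_map G (ob_map F Y)) (ob_map G I) (hom_map G (ob_map F Y) I g) (\<eta> Y)"
  have "Comp C X Y (ob_map G I) ?g i =
      Comp C X (ob_map G (ob_map F X)) (ob_map G I)
        (hom_map G (ob_map F X) I (Comp D (ob_map F X) (ob_map F Y) I g (hom_map F X Y i))) (\<eta> X)"
    using * i g I' by (simp add: G.map_comp C.comp_assoc unit_natural)
  also have "\<dots> = f" unfolding gi using * I' by (simp add: transpose_forth)
  finally show "\<exists>g\<in>arr C Y (ob_map G I). Comp C X Y (ob_map G I) g i = f"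
    using * g I' by (intro bexI[of _ ?g]) simp_all
qed

end

section \<open>The canonical morphism between the adjoints of a localization\<close>

locale adjoint_triple =
  L: adjoint_functors K B A KL r \<eta>L \<epsilon>L + R: adjoint_functors K A B r KR \<eta>R \<epsilon>R
  for K :: "'k ring" and A :: "('k, 'p, 'n) kcat" and B :: "('k, 'o, 'm) kcat"
    and r KL KR \<eta>L \<epsilon>L \<eta>R \<epsilon>R +
  assumes counit_invertible:
    "M \<in> Ob B \<Longrightarrow> invertible B (ob_map r (ob_map KR M)) M (\<epsilon>R M)"
begin

text \<open>
  In an adjoint triple one outer functor is fully faithful as soon as the other one is: for every \<open>X\<close>,
  both \<open>Hom(r (KL M), X)\<close> and \<open>Hom(M, X)\<close> are identified with \<open>Hom(KL M, KR X)\<close> by the adjunctions and the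
  invertible counit, and the resulting bijection is composition with the unit.
\<close>

lemma unit_invertible:
  assumes M: "M \<in> Ob B"
  shows "invertible B M (ob_map r (ob_map KL M)) (\<eta>L M)"
proof -
  note [simp] = M
  let ?LM = "ob_map KL M" let ?N = "ob_map r ?LM"
  let ?t = "\<lambda>g X. Comp B (ob_map r ?LM) (ob_map r (ob_map KR X)) X (\<epsilon>R X) (hom_map r ?LM (ob_map KR X) g)"
  let ?u = "\<lambda>g X. Comp B M ?N (ob_map r (ob_map KR X)) (hom_map r ?LM (ob_map KR X) g) (\<eta>L M)"
  have fact: "\<exists>\<gamma>. \<gamma> \<in> arr B ?N X \<and> Comp B M ?N X \<gamma> (\<eta>L M) = \<beta>" if X: "X \<in> Ob B" "\<beta> \<in> arr B M X" for X \<beta>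
  proof -
    note [simp] = X
    obtain e where e: "e \<in> arr B X (ob_map r (ob_map KR X))"
      "\<epsilon>R X \<in> arr B (ob_map r (ob_map KR X)) X"
      "Comp B X (ob_map r (ob_map KR X)) X (\<epsilon>R X) e = Ident B X"
      using counit_invertible[OF X(1)] by (elim L.C.invertibleE)
    let ?b = "Comp B M X (ob_map r (ob_map KR X)) e \<beta>"
    have b: "?b \<in> arr B M (ob_map r (ob_map KR X))" using e by simp
    let ?g = "Comp A ?LM (ob_map KL (ob_map r (ob_map KR X))) (ob_map KR X)
      (\<epsilon>L (ob_map KR X)) (hom_map KL M (ob_map r (ob_map KR X)) ?b)"
    have g: "?g \<in> arr A ?LM (ob_map KR X)" using b by simp
    have "?u ?g X = ?b" by (rule L.transpose_forth) (use b in simp_all)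
    moreover have "Comp B M ?N X (?t ?g X) (\<eta>L M) =
        Comp B M (ob_map r (ob_map KR X)) X (\<epsilon>R X) (?u ?g X)"
      using g by (simp add: L.C.comp_assoc)
    ultimately have "Comp B M ?N X (?t ?g X) (\<eta>L M) = \<beta>"
      using e by (simp add: L.C.comp_assoc[symmetric])
    then show ?thesis using g by (intro exI[of _ "?t ?g X"]) simp
  qed
  have uniq: "\<gamma> = \<gamma>'"
    if X: "X \<in> Ob B" "\<gamma> \<in> arr B ?N X" "\<gamma>' \<in> arr B ?N X"
      and eq: "Comp B M ?N X \<gamma> (\<eta>L M) = Comp B M ?N X \<gamma>' (\<eta>L M)" for X \<gamma> \<gamma>'
  proof -
    note [simp] = X
    obtain e where e: "e \<in> arr B X (ob_map r (ob_map KR X))"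
      "Comp B (ob_map r (ob_map KR X)) X (ob_map r (ob_map KR X)) e (\<epsilon>R X) = Ident B (ob_map r (ob_map KR X))"
      using counit_invertible[OF X(1)] by (elim L.C.invertibleE)
    let ?s = "\<lambda>\<gamma>. Comp A ?LM (ob_map KR ?N) (ob_map KR X) (hom_map KR ?N X \<gamma>) (\<eta>R ?LM)"
    have ts: "?t (?s \<gamma>) X = \<gamma>" if "\<gamma> \<in> arr B ?N X" for \<gamma>
      by (rule R.transpose_back) (use that in simp_all)
    have u: "?u (?s \<gamma>) X = Comp B M X (ob_map r (ob_map KR X)) e (Comp B M ?N X \<gamma> (\<eta>L M))"
      if g: "\<gamma> \<in> arr B ?N X" for \<gamma>
    proof -
      have "?u (?s \<gamma>) X = Comp B M (ob_map r (ob_map KR X)) (ob_map r (ob_map KR X))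
          (Comp B (ob_map r (ob_map KR X)) X (ob_map r (ob_map KR X)) e (\<epsilon>R X)) (?u (?s \<gamma>) X)"
        using e g by simp
      also have "\<dots> = Comp B M X (ob_map r (ob_map KR X)) e (Comp B M ?N X (?t (?s \<gamma>) X) (\<eta>L M))"
        using e(1) g by (simp add: L.C.comp_assoc)
      finally show ?thesis by (simp add: ts g)
    qed
    have "?u (?s \<gamma>) X = ?u (?s \<gamma>') X" using eq by (simp add: u)
    then have s: "?s \<gamma> = ?s \<gamma>'"
      using L.transpose_left_unique[of M "ob_map KR X" "?s \<gamma>" "?s \<gamma>'"] by simp
    show ?thesis
      by (rule trans[OF ts[symmetric, OF X(2)]]) (simp only: s ts[OF X(3)])
  qed
  obtain v where v: "v \<in> arr B ?N M" "Comp B M ?N M v (\<eta>L M) = Ident B M"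
    using fact[of M "Ident B M"] by auto
  have "Comp B ?N M ?N (\<eta>L M) v = Ident B ?N"
    by (rule uniq[of ?N]) (use v in \<open>simp_all add: L.C.comp_assoc\<close>)
  then show ?thesis using v by (auto simp: invertible_def inverse_arr_def)
qed

abbreviation can :: "'o \<Rightarrow> 'n" where
  "can \<equiv> canonical_arr A B r KL KR \<eta>L \<eta>R"

lemma can_in [simp]:
  "M \<in> Ob B \<Longrightarrow> can M \<in> arr A (ob_map KL M) (ob_map KR M)"
  and can_transpose:
  "M \<in> Ob B \<Longrightarrow>
   Comp B M (ob_map r (ob_map KR M)) M (\<epsilon>R M)
     (Comp B M (ob_map r (ob_map KL M)) (ob_map r (ob_map KR M))
       (hom_map r (ob_map KL M) (ob_map KR M) (can M)) (\<eta>L M)) = Ident B M"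
proof -
  assume M [simp]: "M \<in> Ob B"
  let ?LM = "ob_map KL M" let ?N = "ob_map r ?LM"
  obtain v where v: "inverse_arr B M ?N (\<eta>L M) v"
    using unit_invertible[OF M] by (auto simp: invertible_def)
  then have the: "(THE v. inverse_arr B M ?N (\<eta>L M) v) = v"
    using L.C.inverse_arr_unique[of M ?N] by (intro the_equality) simp_all
  have vin [simp]: "v \<in> arr B ?N M" and v\<eta>: "Comp B M ?N M v (\<eta>L M) = Ident B M"
    using v by (auto simp: inverse_arr_def)
  have can: "can M = Comp A ?LM (ob_map KR ?N) (ob_map KR M) (hom_map KR ?N M v) (\<eta>R ?LM)"
    by (simp add: canonical_arr_def the Let_def)
  show in': "can M \<in> arr A ?LM (ob_map KR M)" by (simp add: can)
  have "Comp B ?N (ob_map r (ob_map KR M)) M (\<epsilon>R M) (hom_map r ?LM (ob_map KR M) (can M)) = v"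
    unfolding can by (rule R.transpose_back) simp_all
  then show "Comp B M (ob_map r (ob_map KR M)) M (\<epsilon>R M)
     (Comp B M ?N (ob_map r (ob_map KR M))
       (hom_map r ?LM (ob_map KR M) (can M)) (\<eta>L M)) = Ident B M"
    using in' v\<eta> by (simp add: L.C.comp_assoc[symmetric])
qed

text \<open>
  A morphism \<open>c : KL M \<rightarrow> KR N\<close> is determined by the composite of the unit of \<open>M\<close>, \<open>r c\<close> and the counit of
  \<open>N\<close>, which is a morphism \<open>M \<rightarrow> N\<close>. By the previous fact \<open>can M\<close> is the morphism that corresponds to the
  identity of \<open>M\<close>; in this form the canonical morphism is easy to compare with others.
\<close>

lemma KL_KR_unique:
  assumes [simp]: "M \<in> Ob B" "N \<in> Ob B" "c \<in> arr A (ob_map KL M) (ob_map KR N)" "c' \<in> arr A (ob_map KL M) (ob_map KR N)"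
    and eq: "Comp B M (ob_map r (ob_map KR N)) N (\<epsilon>R N)
       (Comp B M (ob_map r (ob_map KL M)) (ob_map r (ob_map KR N))
         (hom_map r (ob_map KL M) (ob_map KR N) c) (\<eta>L M)) =
      Comp B M (ob_map r (ob_map KR N)) N (\<epsilon>R N)
       (Comp B M (ob_map r (ob_map KL M)) (ob_map r (ob_map KR N))
         (hom_map r (ob_map KL M) (ob_map KR N) c') (\<eta>L M))"
  shows "c = c'"
proof (rule L.transpose_left_unique[of M "ob_map KR N"])
  let ?R = "ob_map r (ob_map KR N)"
  obtain e where e: "e \<in> arr B N ?R" "Comp B ?R N ?R e (\<epsilon>R N) = Ident B ?R"
    using counit_invertible[OF assms(2)] by (elim L.C.invertibleE)
  let ?x = "\<lambda>c. Comp B M (ob_map r (ob_map KL M)) ?R (hom_map r (ob_map KL M) (ob_map KR N) c) (\<eta>L M)"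
  have "Comp B M N ?R e (Comp B M ?R N (\<epsilon>R N) (?x c)) = Comp B M N ?R e (Comp B M ?R N (\<epsilon>R N) (?x c'))"
    by (simp only: eq)
  then show "?x c = ?x c'"
    using e by (simp add: L.C.comp_assoc[symmetric])
qed simp_all

text \<open>
  Both composites \<open>KL M \<rightarrow> KR N\<close> correspond to the morphism \<open>f : M \<rightarrow> N\<close>.
\<close>

lemma can_natural:
  assumes [simp]: "M \<in> Ob B" "N \<in> Ob B" "f \<in> arr B M N"
  shows "Comp A (ob_map KL M) (ob_map KL N) (ob_map KR N) (can N) (hom_map KL M N f) =
         Comp A (ob_map KL M) (ob_map KR M) (ob_map KR N) (hom_map KR M N f) (can M)"
proof (rule KL_KR_unique[of M N])
  let ?r = "ob_map r" and ?L = "ob_map KL" and ?R = "ob_map KR"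
  have "Comp B M (?r (?R N)) N (\<epsilon>R N) (Comp B M (?r (?L M)) (?r (?R N))
       (hom_map r (?L M) (?R N) (Comp A (?L M) (?L N) (?R N) (can N) (hom_map KL M N f))) (\<eta>L M))
    = Comp B M (?r (?R N)) N (\<epsilon>R N) (Comp B M (?r (?L N)) (?r (?R N)) (hom_map r (?L N) (?R N) (can N))
       (Comp B M (?r (?L M)) (?r (?L N)) (hom_map r (?L M) (?L N) (hom_map KL M N f)) (\<eta>L M)))"
    by (simp add: L.G.map_comp L.C.comp_assoc)
  also have "\<dots> = Comp B M N N (Comp B N (?r (?R N)) N (\<epsilon>R N) (Comp B N (?r (?L N)) (?r (?R N))
       (hom_map r (?L N) (?R N) (can N)) (\<eta>L N))) f"
    by (simp add: L.unit_natural L.C.comp_assoc)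
  also have "\<dots> = f" by (simp add: can_transpose)
  finally have 1: "Comp B M (?r (?R N)) N (\<epsilon>R N) (Comp B M (?r (?L M)) (?r (?R N))
       (hom_map r (?L M) (?R N) (Comp A (?L M) (?L N) (?R N) (can N) (hom_map KL M N f))) (\<eta>L M)) = f" .
  have "Comp B M (?r (?R N)) N (\<epsilon>R N) (Comp B M (?r (?L M)) (?r (?R N))
       (hom_map r (?L M) (?R N) (Comp A (?L M) (?R M) (?R N) (hom_map KR M N f) (can M))) (\<eta>L M))
    = Comp B M (?r (?R M)) N (Comp B (?r (?R M)) (?r (?R N)) N (\<epsilon>R N) (hom_map r (?R M) (?R N) (hom_map KR M N f)))
       (Comp B M (?r (?L M)) (?r (?R M)) (hom_map r (?L M) (?R M) (can M)) (\<eta>L M))"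
    by (simp add: L.G.map_comp L.C.comp_assoc)
  also have "\<dots> = f"
    by (simp add: R.counit_natural L.C.comp_assoc can_transpose)
  finally show "Comp B M (?r (?R N)) N (\<epsilon>R N) (Comp B M (?r (?L M)) (?r (?R N))
       (hom_map r (?L M) (?R N) (Comp A (?L M) (?L N) (?R N) (can N) (hom_map KL M N f))) (\<eta>L M))
    = Comp B M (?r (?R N)) N (\<epsilon>R N) (Comp B M (?r (?L M)) (?r (?R N))
       (hom_map r (?L M) (?R N) (Comp A (?L M) (?R M) (?R N) (hom_map KR M N f) (can M))) (\<eta>L M))"
    using 1 by simp
qed simp_all

text \<open>
  The hypothesis on \<open>d\<close> says that, up to the isomorphism \<open>\<phi>\<close>, it corresponds to the unit of \<open>M\<close>, just as
  \<open>can M\<close> corresponds to the inverse of the unit. Hence \<open>can M\<close> after \<open>d\<close> is \<open>\<phi>\<close>, and \<open>d\<close> after \<open>\<phi>\<close>'s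
  inverse is inverse to \<open>can M\<close>.
\<close>

lemma can_invertibleI:
  assumes [simp]: "M \<in> Ob B" "N \<in> Ob A"
    and \<phi>: "invertible A N (ob_map KR M) \<phi>"
    and d [simp]: "d \<in> arr A N (ob_map KL M)"
    and eq: "hom_map r N (ob_map KL M) d = Comp B (ob_map r N) M (ob_map r (ob_map KL M)) (\<eta>L M)
       (Comp B (ob_map r N) (ob_map r (ob_map KR M)) M (\<epsilon>R M) (hom_map r N (ob_map KR M) \<phi>))"
  shows "invertible A (ob_map KL M) (ob_map KR M) (can M)"
proof -
  let ?r = "ob_map r" and ?L = "ob_map KL" and ?R = "ob_map KR"
  obtain \<psi> where \<phi>' [simp]: "\<phi> \<in> arr A N (?R M)" "\<psi> \<in> arr A (?R M) N"
    and \<phi>\<psi>: "Comp A N (?R M) N \<psi> \<phi> = Ident A N" "Comp A (?R M) N (?R M) \<phi> \<psi> = Ident A (?R M)"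
    using \<phi> by (elim L.D.invertibleE)
  have "Comp A N (?L M) (?R M) (can M) d = \<phi>"
  proof (rule R.transpose_right_unique[of N M])
    let ?e = "Comp B (?r N) (?r (?R M)) M (\<epsilon>R M) (hom_map r N (?R M) \<phi>)"
    have "Comp B (?r N) (?r (?R M)) M (\<epsilon>R M) (hom_map r N (?R M) (Comp A N (?L M) (?R M) (can M) d))
      = Comp B (?r N) M M (Comp B M (?r (?R M)) M (\<epsilon>R M) (Comp B M (?r (?L M)) (?r (?R M))
          (hom_map r (?L M) (?R M) (can M)) (\<eta>L M))) ?e"
      by (simp add: L.G.map_comp eq L.C.comp_assoc)
    also have "\<dots> = ?e" by (simp add: can_transpose)
    finally show "Comp B (?r N) (?r (?R M)) M (\<epsilon>R M) (hom_map r N (?R M) (Comp A N (?L M) (?R M) (can M) d)) = ?e" .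
  qed simp_all
  then have 1: "Comp A (?R M) (?L M) (?R M) (can M) (Comp A (?R M) N (?L M) d \<psi>) = Ident A (?R M)"
    using \<phi>\<psi> by (simp add: L.D.comp_assoc[symmetric])
  have r\<phi>\<psi>: "Comp B (?r (?R M)) (?r N) (?r (?R M)) (hom_map r N (?R M) \<phi>) (hom_map r (?R M) N \<psi>) = Ident B (?r (?R M))"
    by (simp add: L.G.map_comp[symmetric] \<phi>\<psi>)
  have "Comp A (?L M) (?R M) (?L M) (Comp A (?R M) N (?L M) d \<psi>) (can M) = Ident A (?L M)"
  proof (rule L.transpose_left_unique[of M])
    let ?c = "Comp B M (?r (?L M)) (?r (?R M)) (hom_map r (?L M) (?R M) (can M)) (\<eta>L M)"
    have "Comp B M (?r (?L M)) (?r (?L M)) (hom_map r (?L M) (?L M)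
         (Comp A (?L M) (?R M) (?L M) (Comp A (?R M) N (?L M) d \<psi>) (can M))) (\<eta>L M)
      = Comp B M M (?r (?L M)) (\<eta>L M) (Comp B M (?r (?R M)) M (\<epsilon>R M)
         (Comp B M (?r (?R M)) (?r (?R M))
           (Comp B (?r (?R M)) (?r N) (?r (?R M)) (hom_map r N (?R M) \<phi>) (hom_map r (?R M) N \<psi>)) ?c))"
      by (simp add: L.G.map_comp eq L.C.comp_assoc)
    also have "\<dots> = \<eta>L M"
      unfolding r\<phi>\<psi> by (simp add: can_transpose)
    finally show "Comp B M (?r (?L M)) (?r (?L M)) (hom_map r (?L M) (?L M)
         (Comp A (?L M) (?R M) (?L M) (Comp A (?R M) N (?L M) d \<psi>) (can M))) (\<eta>L M) =
       Comp B M (?r (?L M)) (?r (?L M)) (hom_map r (?L M) (?L M) (Ident A (?L M))) (\<eta>L M)"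
      by simp
  qed simp_all
  with 1 have "inverse_arr A (?L M) (?R M) (can M) (Comp A (?R M) N (?L M) d \<psi>)"
    by (simp add: inverse_arr_def)
  then show ?thesis by (auto simp: invertible_def)
qed

text \<open>
  A natural transformation of additive functors that is invertible on the \<open>X i\<close> is invertible on any
  direct factor of their sum: the inverse is glued from the inverses on the \<open>X i\<close>.
\<close>

lemma can_invertible_sum:
  assumes [simp]: "M \<in> Ob B"
    and X [simp]: "\<And>i. i < n \<Longrightarrow> X i \<in> Ob B" "\<And>i. i < n \<Longrightarrow> a i \<in> arr B (X i) M"
      "\<And>i. i < n \<Longrightarrow> b i \<in> arr B M (X i)"
    and sum: "finsum (Hom B M M) (\<lambda>i. Comp B M (X i) M (a i) (b i)) {..<n::nat} = Ident B M"
    and inv: "\<And>i. i < n \<Longrightarrow> invertible A (ob_map KL (X i)) (ob_map KR (X i)) (can (X i))"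
  shows "invertible A (ob_map KL M) (ob_map KR M) (can M)"
proof -
  let ?L = "ob_map KL" and ?R = "ob_map KR"
  have "\<forall>i<n. \<exists>d. inverse_arr A (?L (X i)) (?R (X i)) (can (X i)) d"
    using inv by (auto simp: invertible_def)
  then obtain d where d: "\<And>i. i < n \<Longrightarrow> inverse_arr A (?L (X i)) (?R (X i)) (can (X i)) (d i)"
    by metis
  have [simp]: "d i \<in> arr A (?R (X i)) (?L (X i))"
    "Comp A (?L (X i)) (?R (X i)) (?L (X i)) (d i) (can (X i)) = Ident A (?L (X i))"
    "Comp A (?R (X i)) (?L (X i)) (?R (X i)) (can (X i)) (d i) = Ident A (?R (X i))"
    if "i < n" for i using d[OF that] by (auto simp: inverse_arr_def)
  let ?t = "\<lambda>i. Comp A (?R M) (?R (X i)) (?L M)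
      (Comp A (?R (X i)) (?L (X i)) (?L M) (hom_map KL (X i) M (a i)) (d i)) (hom_map KR M (X i) (b i))"
  define D where "D = finsum (Hom A (?R M) (?L M)) ?t {..<n}"
  have D: "D \<in> arr A (?R M) (?L M)" unfolding D_def by (rule L.D.finsum_in) simp_all
  have "Comp A (?R M) (?L M) (?R M) (can M) D =
      finsum (Hom A (?R M) (?R M)) (\<lambda>i. Comp A (?R M) (?L M) (?R M) (can M) (?t i)) {..<n}"
    unfolding D_def by (rule L.D.comp_finsum_right) simp_all
  also have "\<dots> = finsum (Hom A (?R M) (?R M)) (\<lambda>i. hom_map KR M M (Comp B M (X i) M (a i) (b i))) {..<n}"
  proof (rule L.D.finsum_Hom_cong)
    fix i assume [simp]: "i < n"
    have "Comp A (?R M) (?L M) (?R M) (can M) (?t i) =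
        Comp A (?R M) (?R (X i)) (?R M) (Comp A (?R (X i)) (?L (X i)) (?R M)
          (Comp A (?L (X i)) (?L M) (?R M) (can M) (hom_map KL (X i) M (a i))) (d i)) (hom_map KR M (X i) (b i))"
      by (simp add: L.D.comp_assoc)
    also have "\<dots> = hom_map KR M M (Comp B M (X i) M (a i) (b i))"
      by (simp add: can_natural L.D.comp_assoc R.G.map_comp)
    finally show "Comp A (?R M) (?L M) (?R M) (can M) (?t i) =
        hom_map KR M M (Comp B M (X i) M (a i) (b i))" .
  qed simp_all
  also have "\<dots> = hom_map KR M M (Ident B M)"
    unfolding sum[symmetric] by (rule R.G.map_finsum[symmetric]) simp_all
  finally have 1: "Comp A (?R M) (?L M) (?R M) (can M) D = Ident A (?R M)" by simp
  have "Comp A (?L M) (?R M) (?L M) D (can M) =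
      finsum (Hom A (?L M) (?L M)) (\<lambda>i. Comp A (?L M) (?R M) (?L M) (?t i) (can M)) {..<n}"
    unfolding D_def by (rule L.D.comp_finsum_left) simp_all
  also have "\<dots> = finsum (Hom A (?L M) (?L M)) (\<lambda>i. hom_map KL M M (Comp B M (X i) M (a i) (b i))) {..<n}"
  proof (rule L.D.finsum_Hom_cong)
    fix i assume [simp]: "i < n"
    have "Comp A (?L M) (?R M) (?L M) (?t i) (can M) =
        Comp A (?L M) (?L (X i)) (?L M) (hom_map KL (X i) M (a i))
          (Comp A (?L M) (?R (X i)) (?L (X i)) (d i)
            (Comp A (?L M) (?L (X i)) (?R (X i)) (can (X i)) (hom_map KL M (X i) (b i))))"
      by (simp add: L.D.comp_assoc can_natural)
    also have "\<dots> = Comp A (?L M) (?L (X i)) (?L M) (hom_map KL (X i) M (a i))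
          (Comp A (?L M) (?L (X i)) (?L (X i))
            (Comp A (?L (X i)) (?R (X i)) (?L (X i)) (d i) (can (X i))) (hom_map KL M (X i) (b i)))"
      by (subst L.D.comp_assoc) simp_all
    also have "\<dots> = hom_map KL M M (Comp B M (X i) M (a i) (b i))"
      by (simp add: L.F.map_comp)
    finally show "Comp A (?L M) (?R M) (?L M) (?t i) (can M) =
        hom_map KL M M (Comp B M (X i) M (a i) (b i))" .
  qed simp_all
  also have "\<dots> = hom_map KL M M (Ident B M)"
    unfolding sum[symmetric] by (rule L.F.map_finsum[symmetric]) simp_all
  finally have "Comp A (?L M) (?R M) (?L M) D (can M) = Ident A (?L M)" by simp
  with 1 D have "inverse_arr A (?L M) (?R M) (can M) D" by (simp add: inverse_arr_def)
  then show ?thesis by (auto simp: invertible_def)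
qed

text \<open>
  The left adjoint preserves epimorphisms. Hence an epimorphism \<open>f\<close> from an object on which the
  canonical morphism is invertible onto \<open>M\<close> reduces the cokernel, and with it the image, of \<open>can M\<close> to
  that of \<open>KR f\<close>: by naturality a morphism kills one of them if and only if it kills the other one.
\<close>

lemma cokernel_can_imp_cokernel_KR:
  assumes [simp]: "M \<in> Ob B" "N \<in> Ob B" and f: "epic B N M f"
    and inv: "invertible A (ob_map KL N) (ob_map KR N) (can N)"
    and cok: "is_cokernel A (ob_map KL M) (ob_map KR M) (can M) Q p"
  shows "is_cokernel A (ob_map KR N) (ob_map KR M) (hom_map KR N M f) Q p"
proof -
  let ?L = "ob_map KL" and ?R = "ob_map KR"
  have [simp]: "f \<in> arr B N M" using f by (simp add: epic_def)
  have [simp]: "Q \<in> Ob A" "p \<in> arr A (?R M) Q" using cok by (auto simp: is_cokernel_def)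
  obtain d where [simp]: "d \<in> arr A (?R N) (?L N)"
    and d: "Comp A (?R N) (?L N) (?R N) (can N) d = Ident A (?R N)"
    using inv by (elim L.D.invertibleE)
  have Lf: "epic A (?L N) (?L M) (hom_map KL N M f)"
    using f by (simp add: L.left_adjoint_epic)
  have kill: "Comp A (?R N) (?R M) T t (hom_map KR N M f) = \<zero>\<^bsub>Hom A (?R N) T\<^esub> \<longleftrightarrow>
      Comp A (?L M) (?R M) T t (can M) = \<zero>\<^bsub>Hom A (?L M) T\<^esub>"
    if [simp]: "T \<in> Ob A" "t \<in> arr A (?R M) T" for T t
  proof
    assume 0: "Comp A (?R N) (?R M) T t (hom_map KR N M f) = \<zero>\<^bsub>Hom A (?R N) T\<^esub>"
    have "Comp A (?L N) (?L M) T (Comp A (?L M) (?R M) T t (can M)) (hom_map KL N M f) =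
        Comp A (?L N) (?R N) T (Comp A (?R N) (?R M) T t (hom_map KR N M f)) (can N)"
      by (simp add: L.D.comp_assoc can_natural)
    also have "\<dots> = Comp A (?L N) (?L M) T \<zero>\<^bsub>Hom A (?L M) T\<^esub> (hom_map KL N M f)"
      unfolding 0 by simp
    finally show "Comp A (?L M) (?R M) T t (can M) = \<zero>\<^bsub>Hom A (?L M) T\<^esub>"
      using L.D.epic_cancel[OF Lf, of T "Comp A (?L M) (?R M) T t (can M)" "\<zero>\<^bsub>Hom A (?L M) T\<^esub>"] by simp
  next
    assume 0: "Comp A (?L M) (?R M) T t (can M) = \<zero>\<^bsub>Hom A (?L M) T\<^esub>"
    have "Comp A (?R N) (?R M) T t (hom_map KR N M f) =
        Comp A (?R N) (?R M) T t (Comp A (?R N) (?R N) (?R M) (hom_map KR N M f) (Comp A (?R N) (?L N) (?R N) (can N) d))"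
      unfolding d by simp
    also have "\<dots> = Comp A (?R N) (?L N) T (Comp A (?L N) (?R M) T t (Comp A (?L N) (?R N) (?R M) (hom_map KR N M f) (can N))) d"
      by (simp add: L.D.comp_assoc)
    also have "\<dots> = Comp A (?R N) (?L N) T (Comp A (?L N) (?L M) T (Comp A (?L M) (?R M) T t (can M)) (hom_map KL N M f)) d"
      by (simp add: can_natural L.D.comp_assoc)
    also have "\<dots> = \<zero>\<^bsub>Hom A (?R N) T\<^esub>" unfolding 0 by simp
    finally show "Comp A (?R N) (?R M) T t (hom_map KR N M f) = \<zero>\<^bsub>Hom A (?R N) T\<^esub>" .
  qed
  show ?thesis
    using cok unfolding is_cokernel_def by (simp add: kill)
qed

end

section \<open>Modules over a linear category, elementwise\<close>

abbreviation elts :: "('o, 'm, ('k, 'v) module, 'x) kfun \<Rightarrow> 'o \<Rightarrow> 'v set" where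
  "elts F X \<equiv> carrier (ob_map F X)"

text \<open>
  Morphisms of modules are extensional both in the object and in the element. Every operation on them
  restricts some family of maps to these domains, and \<open>nt\<close> is this restriction.
\<close>

definition nt :: "('k, 'o, 'm) kcat \<Rightarrow> ('k, 'o, 'm, 'v) cmodule \<Rightarrow> ('o \<Rightarrow> 'v \<Rightarrow> 'v) \<Rightarrow> 'o \<Rightarrow> 'v \<Rightarrow> 'v" where
  "nt C F u = (\<lambda>X\<in>Ob C. \<lambda>x\<in>elts F X. u X x)"

lemma nt_apply [simp]: "X \<in> Ob C \<Longrightarrow> x \<in> elts F X \<Longrightarrow> nt C F u X x = u X x"
  by (simp add: nt_def)

lemma nt_cong:
  "(\<And>X x. X \<in> Ob C \<Longrightarrow> x \<in> elts F X \<Longrightarrow> u X x = v X x) \<Longrightarrow> nt C F u = nt C F v"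
  by (auto simp: nt_def fun_eq_iff)

lemma op_cat_simps [simp]:
  "Ob (op_cat C) = Ob C" "Hom (op_cat C) X Y = Hom C Y X"
  "Comp (op_cat C) X Y Z g f = Comp C Z Y X f g" "Ident (op_cat C) = Ident C"
  by (simp_all add: op_cat_def)

lemma Mod_k_simps:
  "Ob (Mod_k K) = {V. module K V}" "Hom (Mod_k K) = Hom_space K"
  "Comp (Mod_k K) U V W g f = compose (carrier U) g f" "Ident (Mod_k K) V = (\<lambda>x\<in>carrier V. x)"
  by (simp_all add: Mod_k_def)

lemma Mod_Ident: "Ident (Mod K C) F = nt C F (\<lambda>X x. x)"
  by (simp add: Mod_def functor_cat_def Mod_k_simps nt_def)

lemma Mod_Comp: "Comp (Mod K C) F G H \<theta> \<eta> = nt C F (\<lambda>X x. \<theta> X (\<eta> X x))"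
  by (simp add: Mod_def functor_cat_def Mod_k_simps nt_def compose_def)

lemma Mod_add: "\<eta> \<oplus>\<^bsub>Hom (Mod K C) F G\<^esub> \<theta> = nt C F (\<lambda>X x. \<eta> X x \<oplus>\<^bsub>ob_map G X\<^esub> \<theta> X x)"
  by (simp add: Mod_def functor_cat_def Mod_k_simps nt_def Hom_space_def)

lemma Mod_smult: "a \<odot>\<^bsub>Hom (Mod K C) F G\<^esub> \<eta> = nt C F (\<lambda>X x. a \<odot>\<^bsub>ob_map G X\<^esub> \<eta> X x)"
  by (simp add: Mod_def functor_cat_def Mod_k_simps nt_def Hom_space_def)

lemma Mod_zero: "\<zero>\<^bsub>Hom (Mod K C) F G\<^esub> = nt C F (\<lambda>X x. \<zero>\<^bsub>ob_map G X\<^esub>)"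
  by (simp add: Mod_def functor_cat_def Mod_k_simps nt_def Hom_space_def)

lemma Mod_Ob: "Ob (Mod K C) = {F. kfunctor K (op_cat C) (Mod_k K) F}"
  by (simp add: Mod_def functor_cat_def)

lemma Mod_arr: "arr (Mod K C) F G = {\<eta>. nat_trans K (op_cat C) (Mod_k K) F G \<eta>}"
  by (simp add: Mod_def functor_cat_def)

context linear_category
begin

lemma Mod_ObI:
  assumes "\<And>X. X \<in> Ob C \<Longrightarrow> module K (ob_map F X)"
    and ext: "\<And>X Y f. X \<in> Ob C \<Longrightarrow> Y \<in> Ob C \<Longrightarrow> f \<in> arr C X Y \<Longrightarrow> hom_map F Y X f \<in> extensional (elts F Y)"
    and lin: "\<And>X Y f. X \<in> Ob C \<Longrightarrow> Y \<in> Ob C \<Longrightarrow> f \<in> arr C X Y \<Longrightarrow>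
      linear_map K (ob_map F Y) (ob_map F X) (hom_map F Y X f)"
    and "\<And>X Y f f' y. X \<in> Ob C \<Longrightarrow> Y \<in> Ob C \<Longrightarrow> f \<in> arr C X Y \<Longrightarrow> f' \<in> arr C X Y \<Longrightarrow> y \<in> elts F Y \<Longrightarrow>
      hom_map F Y X (f \<oplus>\<^bsub>Hom C X Y\<^esub> f') y = hom_map F Y X f y \<oplus>\<^bsub>ob_map F X\<^esub> hom_map F Y X f' y"
    and "\<And>X Y a f y. X \<in> Ob C \<Longrightarrow> Y \<in> Ob C \<Longrightarrow> a \<in> carrier K \<Longrightarrow> f \<in> arr C X Y \<Longrightarrow> y \<in> elts F Y \<Longrightarrow>
      hom_map F Y X (a \<odot>\<^bsub>Hom C X Y\<^esub> f) y = a \<odot>\<^bsub>ob_map F X\<^esub> hom_map F Y X f y"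
    and "\<And>X x. X \<in> Ob C \<Longrightarrow> x \<in> elts F X \<Longrightarrow> hom_map F X X (Ident C X) x = x"
    and "\<And>X Y Z f g z. X \<in> Ob C \<Longrightarrow> Y \<in> Ob C \<Longrightarrow> Z \<in> Ob C \<Longrightarrow> f \<in> arr C X Y \<Longrightarrow> g \<in> arr C Y Z \<Longrightarrow>
      z \<in> elts F Z \<Longrightarrow> hom_map F Z X (Comp C X Y Z g f) z = hom_map F Y X f (hom_map F Z Y g z)"
  shows "F \<in> Ob (Mod K C)"
proof -
  have eqI: "f = g" if "f \<in> extensional A" "g \<in> extensional A" "\<And>x. x \<in> A \<Longrightarrow> f x = g x" for f g :: "'x \<Rightarrow> 'x" and A
    using that by (rule extensionalityI)
  have add_smult: "f \<oplus>\<^bsub>Hom C X Y\<^esub> f' \<in> arr C X Y" "a \<in> carrier K \<Longrightarrow> a \<odot>\<^bsub>Hom C X Y\<^esub> f \<in> arr C X Y"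
    if "X \<in> Ob C" "Y \<in> Ob C" "f \<in> arr C X Y" "f' \<in> arr C X Y" for X Y f f' a
    using that by (simp_all add: module.smult_closed[OF Hom_module])
  show ?thesis
    unfolding Mod_Ob mem_Collect_eq kfunctor_def
  proof (intro conjI ballI)
    fix X Y assume XY: "X \<in> Ob (op_cat C)" "Y \<in> Ob (op_cat C)"
    show "linear_map K (Hom (op_cat C) X Y) (Hom (Mod_k K) (ob_map F X) (ob_map F Y)) (hom_map F X Y)"
      using XY
      by (intro linear_mapI)
        (auto simp: Mod_k_simps Hom_space_def assms add_smult
          intro!: extensionalityI[where A = "elts F X"])
  qed (auto simp: Mod_k_simps assms compose_def linear_in[OF lin] intro!: extensionalityI[OF ext] )
qed

lemma
  assumes "F \<in> Ob (Mod K C)"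
  shows Mod_module: "X \<in> Ob C \<Longrightarrow> module K (ob_map F X)"
    and Mod_hom_linear:
      "X \<in> Ob C \<Longrightarrow> Y \<in> Ob C \<Longrightarrow> f \<in> arr C X Y \<Longrightarrow>
        linear_map K (ob_map F Y) (ob_map F X) (hom_map F Y X f)"
    and Mod_hom_in:
      "X \<in> Ob C \<Longrightarrow> Y \<in> Ob C \<Longrightarrow> f \<in> arr C X Y \<Longrightarrow> y \<in> elts F Y \<Longrightarrow> hom_map F Y X f y \<in> elts F X"
    and Mod_hom_add:
      "X \<in> Ob C \<Longrightarrow> Y \<in> Ob C \<Longrightarrow> f \<in> arr C X Y \<Longrightarrow> f' \<in> arr C X Y \<Longrightarrow> y \<in> elts F Y \<Longrightarrow>
      hom_map F Y X (f \<oplus>\<^bsub>Hom C X Y\<^esub> f') y = hom_map F Y X f y \<oplus>\<^bsub>ob_map F X\<^esub> hom_map F Y X f' y"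
    and Mod_hom_smult:
      "X \<in> Ob C \<Longrightarrow> Y \<in> Ob C \<Longrightarrow> a \<in> carrier K \<Longrightarrow> f \<in> arr C X Y \<Longrightarrow> y \<in> elts F Y \<Longrightarrow>
      hom_map F Y X (a \<odot>\<^bsub>Hom C X Y\<^esub> f) y = a \<odot>\<^bsub>ob_map F X\<^esub> hom_map F Y X f y"
    and Mod_hom_ident: "X \<in> Ob C \<Longrightarrow> x \<in> elts F X \<Longrightarrow> hom_map F X X (Ident C X) x = x"
    and Mod_hom_comp:
      "X \<in> Ob C \<Longrightarrow> Y \<in> Ob C \<Longrightarrow> Z \<in> Ob C \<Longrightarrow> f \<in> arr C X Y \<Longrightarrow> g \<in> arr C Y Z \<Longrightarrow>
      z \<in> elts F Z \<Longrightarrow> hom_map F Z X (Comp C X Y Z g f) z = hom_map F Y X f (hom_map F Z Y g z)"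
proof -
  have F: "kfunctor K (op_cat C) (Mod_k K) F" using assms by (simp add: Mod_Ob)
  show "X \<in> Ob C \<Longrightarrow> module K (ob_map F X)"
    using F by (auto simp: kfunctor_def Mod_k_simps)
  have lin: "linear_map K (Hom C X Y) (Hom_space K (ob_map F Y) (ob_map F X)) (hom_map F Y X)"
    if "X \<in> Ob C" "Y \<in> Ob C" for X Y
    using F that by (auto simp: kfunctor_def Mod_k_simps)
  show 2: "linear_map K (ob_map F Y) (ob_map F X) (hom_map F Y X f)"
    if "X \<in> Ob C" "Y \<in> Ob C" "f \<in> arr C X Y"
    using linear_in[OF lin that(3)] that by (auto simp: Hom_space_def)
  show "hom_map F Y X f y \<in> elts F X"
    if "X \<in> Ob C" "Y \<in> Ob C" "f \<in> arr C X Y" "y \<in> elts F Y"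
    using linear_in[OF 2] that by simp
  show "hom_map F Y X (f \<oplus>\<^bsub>Hom C X Y\<^esub> f') y = hom_map F Y X f y \<oplus>\<^bsub>ob_map F X\<^esub> hom_map F Y X f' y"
    if "X \<in> Ob C" "Y \<in> Ob C" "f \<in> arr C X Y" "f' \<in> arr C X Y" "y \<in> elts F Y"
    using linear_add[OF lin that(3,4)] that by (simp add: Hom_space_def)
  show "hom_map F Y X (a \<odot>\<^bsub>Hom C X Y\<^esub> f) y = a \<odot>\<^bsub>ob_map F X\<^esub> hom_map F Y X f y"
    if "X \<in> Ob C" "Y \<in> Ob C" "a \<in> carrier K" "f \<in> arr C X Y" "y \<in> elts F Y"
    using linear_smult[OF lin that(3,4)] that by (simp add: Hom_space_def)
  show "hom_map F X X (Ident C X) x = x" if "X \<in> Ob C" "x \<in> elts F X"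
    using F that by (simp add: kfunctor_def Mod_k_simps)
  show "hom_map F Z X (Comp C X Y Z g f) z = hom_map F Y X f (hom_map F Z Y g z)"
    if "X \<in> Ob C" "Y \<in> Ob C" "Z \<in> Ob C" "f \<in> arr C X Y" "g \<in> arr C Y Z" "z \<in> elts F Z"
    using F that by (simp add: kfunctor_def Mod_k_simps compose_def)
qed

lemma Mod_arrI:
  fixes F G :: "('k, 'o, 'm, 'v) cmodule"
  assumes F: "F \<in> Ob (Mod K C)" and G: "G \<in> Ob (Mod K C)"
    and lin: "\<And>X. X \<in> Ob C \<Longrightarrow> linear_map K (ob_map F X) (ob_map G X) (u X)"
    and nat: "\<And>X Y f y. X \<in> Ob C \<Longrightarrow> Y \<in> Ob C \<Longrightarrow> f \<in> arr C X Y \<Longrightarrow> y \<in> elts F Y \<Longrightarrow>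
      u X (hom_map F Y X f y) = hom_map G Y X f (u Y y)"
  shows "nt C F u \<in> arr (Mod K C) F G"
  unfolding Mod_arr mem_Collect_eq nat_trans_def
  using F G
  by (auto simp: Mod_Ob Mod_k_simps nt_def Hom_space_def linear_map_restrict[OF Mod_module[OF F]] lin
      nat compose_def Mod_hom_in[OF F] linear_in[OF lin] fun_eq_iff)

lemma
  assumes \<eta>: "\<eta> \<in> arr (Mod K C) F G"
  shows Mod_arr_source: "F \<in> Ob (Mod K C)"
    and Mod_arr_target: "G \<in> Ob (Mod K C)"
    and Mod_arr_linear: "X \<in> Ob C \<Longrightarrow> linear_map K (ob_map F X) (ob_map G X) (\<eta> X)"
    and Mod_arr_in: "X \<in> Ob C \<Longrightarrow> x \<in> elts F X \<Longrightarrow> \<eta> X x \<in> elts G X"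
    and Mod_arr_natural:
      "X \<in> Ob C \<Longrightarrow> Y \<in> Ob C \<Longrightarrow> f \<in> arr C X Y \<Longrightarrow> y \<in> elts F Y \<Longrightarrow>
       \<eta> X (hom_map F Y X f y) = hom_map G Y X f (\<eta> Y y)"
    and Mod_arr_nt: "nt C F \<eta> = \<eta>"
proof -
  have nt: "nat_trans K (op_cat C) (Mod_k K) F G \<eta>" using \<eta> by (simp add: Mod_arr)
  show "F \<in> Ob (Mod K C)" "G \<in> Ob (Mod K C)" using nt by (auto simp: nat_trans_def Mod_Ob)
  show 1: "linear_map K (ob_map F X) (ob_map G X) (\<eta> X)" if "X \<in> Ob C"
    using nt that by (auto simp: nat_trans_def Mod_k_simps Hom_space_def)
  show "\<eta> X x \<in> elts G X" if "X \<in> Ob C" "x \<in> elts F X"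
    using linear_in[OF 1] that by simp
  show "\<eta> X (hom_map F Y X f y) = hom_map G Y X f (\<eta> Y y)"
    if "X \<in> Ob C" "Y \<in> Ob C" "f \<in> arr C X Y" "y \<in> elts F Y"
  proof -
    have "compose (elts F Y) (hom_map G Y X f) (\<eta> Y) = compose (elts F Y) (\<eta> X) (hom_map F Y X f)"
      using nt that by (simp add: nat_trans_def Mod_k_simps)
    from fun_cong[OF this, of y] show ?thesis using that by (simp add: compose_def)
  qed
  show "nt C F \<eta> = \<eta>"
    using nt by (auto simp: nat_trans_def Mod_k_simps Hom_space_def nt_def fun_eq_iff extensional_def restrict_def)
qed

lemma Mod_arr_eqI:
  assumes "\<eta> \<in> arr (Mod K C) F G" "\<theta> \<in> arr (Mod K C) F G'"
    and "\<And>X x. X \<in> Ob C \<Longrightarrow> x \<in> elts F X \<Longrightarrow> \<eta> X x = \<theta> X x"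
  shows "\<eta> = \<theta>"
  using nt_cong[of C F \<eta> \<theta>] Mod_arr_nt[OF assms(1)] Mod_arr_nt[OF assms(2)] assms(3) by simp

lemma Mod_Comp_in:
  assumes "\<eta> \<in> arr (Mod K C) F G" "\<theta> \<in> arr (Mod K C) G H"
  shows "Comp (Mod K C) F G H \<theta> \<eta> \<in> arr (Mod K C) F H"
  unfolding Mod_Comp
  by (rule Mod_arrI[OF Mod_arr_source[OF assms(1)] Mod_arr_target[OF assms(2)]])
     (auto intro!: linear_mapI simp: Mod_arr_in[OF assms(1)] Mod_arr_in[OF assms(2)]
       linear_add[OF Mod_arr_linear[OF assms(1)]] linear_add[OF Mod_arr_linear[OF assms(2)]]
       linear_smult[OF Mod_arr_linear[OF assms(1)]] linear_smult[OF Mod_arr_linear[OF assms(2)]]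
       Mod_arr_natural[OF assms(1)] Mod_arr_natural[OF assms(2)])

lemma Mod_zero_in:
  fixes F G :: "('k, 'o, 'm, 'v) cmodule"
  assumes F: "F \<in> Ob (Mod K C)" and G: "G \<in> Ob (Mod K C)"
  shows "nt C F (\<lambda>X x. \<zero>\<^bsub>ob_map G X\<^esub>) \<in> arr (Mod K C) F G"
proof (rule Mod_arrI[OF F G])
  fix X assume X: "X \<in> Ob C"
  interpret G: module K "ob_map G X" by (rule Mod_module[OF G X])
  show "linear_map K (ob_map F X) (ob_map G X) (\<lambda>x. \<zero>\<^bsub>ob_map G X\<^esub>)"
    by (auto intro!: linear_mapI)
next
  fix X Y f y assume *: "X \<in> Ob C" "Y \<in> Ob C" "f \<in> arr C X Y" "y \<in> elts F Y"
  show "\<zero>\<^bsub>ob_map G X\<^esub> = hom_map G Y X f \<zero>\<^bsub>ob_map G Y\<^esub>"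
    using * by (simp add: linear_zero[OF Mod_hom_linear[OF G]] Mod_module[OF G])
qed

lemma Mod_Hom_module:
  fixes F G :: "('k, 'o, 'm, 'v) cmodule"
  assumes F: "F \<in> Ob (Mod K C)" and G: "G \<in> Ob (Mod K C)" and K: "cring K"
  shows "module K (Hom (Mod K C) F G)"
proof -
  note Gm = Mod_module[OF G]
  note Gg = module_abelian_group[OF Gm]
  note lin = Mod_arr_linear[where F = F and G = G]
  note Gh = Mod_hom_linear[OF G]
  have add: "\<eta> \<oplus>\<^bsub>Hom (Mod K C) F G\<^esub> \<theta> \<in> arr (Mod K C) F G"
    if \<eta>: "\<eta> \<in> arr (Mod K C) F G" and \<theta>: "\<theta> \<in> arr (Mod K C) F G" for \<eta> \<theta>
    unfolding Mod_add
  proof (rule Mod_arrI[OF F G])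
    fix X assume X: "X \<in> Ob C"
    interpret G: module K "ob_map G X" by (rule Gm[OF X])
    show "linear_map K (ob_map F X) (ob_map G X) (\<lambda>x. \<eta> X x \<oplus>\<^bsub>ob_map G X\<^esub> \<theta> X x)"
      using X by (auto intro!: linear_mapI simp: Mod_arr_in[OF \<eta>] Mod_arr_in[OF \<theta>]
         linear_add[OF lin[OF \<eta>]] linear_add[OF lin[OF \<theta>]]
         linear_smult[OF lin[OF \<eta>]] linear_smult[OF lin[OF \<theta>]] G.a_ac G.smult_r_distr)
  next
    fix X Y f y assume "X \<in> Ob C" "Y \<in> Ob C" "f \<in> arr C X Y" "y \<in> elts F Y"
    then show "\<eta> X (hom_map F Y X f y) \<oplus>\<^bsub>ob_map G X\<^esub> \<theta> X (hom_map F Y X f y) =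
        hom_map G Y X f (\<eta> Y y \<oplus>\<^bsub>ob_map G Y\<^esub> \<theta> Y y)"
      by (simp add: Mod_arr_in[OF \<eta>] Mod_arr_in[OF \<theta>] linear_add[OF Gh] Mod_arr_natural[OF \<eta>] Mod_arr_natural[OF \<theta>])
  qed
  have smult: "a \<odot>\<^bsub>Hom (Mod K C) F G\<^esub> \<eta> \<in> arr (Mod K C) F G"
    if a: "a \<in> carrier K" and \<eta>: "\<eta> \<in> arr (Mod K C) F G" for a \<eta>
    unfolding Mod_smult
  proof (rule Mod_arrI[OF F G])
    fix X assume X: "X \<in> Ob C"
    interpret G: module K "ob_map G X" by (rule Gm[OF X])
    show "linear_map K (ob_map F X) (ob_map G X) (\<lambda>x. a \<odot>\<^bsub>ob_map G X\<^esub> \<eta> X x)"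
      using X a by (auto intro!: linear_mapI simp: Mod_arr_in[OF \<eta>]
         linear_add[OF lin[OF \<eta>]] linear_smult[OF lin[OF \<eta>]] G.smult_r_distr G.smult_assoc1[symmetric] G.R.m_comm)
  next
    fix X Y f y assume "X \<in> Ob C" "Y \<in> Ob C" "f \<in> arr C X Y" "y \<in> elts F Y"
    then show "a \<odot>\<^bsub>ob_map G X\<^esub> \<eta> X (hom_map F Y X f y) =
        hom_map G Y X f (a \<odot>\<^bsub>ob_map G Y\<^esub> \<eta> Y y)"
      using a by (simp add: Mod_arr_in[OF \<eta>] linear_smult[OF Gh] Mod_arr_natural[OF \<eta>])
  qed
  have zero: "\<zero>\<^bsub>Hom (Mod K C) F G\<^esub> \<in> arr (Mod K C) F G"
    unfolding Mod_zero by (rule Mod_zero_in[OF F G])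
  note m = Mod_arr_in[where F = F and G = G]
  show ?thesis
  proof (rule moduleI[OF K])
    show "abelian_group (Hom (Mod K C) F G)"
    proof (rule abelian_groupI)
      fix \<eta> assume \<eta>: "\<eta> \<in> arr (Mod K C) F G"
      have 0: "\<zero>\<^bsub>Hom (Mod K C) F G\<^esub> \<oplus>\<^bsub>Hom (Mod K C) F G\<^esub> \<eta> \<in> arr (Mod K C) F G"
        by (rule add[OF zero \<eta>])
      show "\<zero>\<^bsub>Hom (Mod K C) F G\<^esub> \<oplus>\<^bsub>Hom (Mod K C) F G\<^esub> \<eta> = \<eta>"
        by (rule Mod_arr_eqI[OF 0 \<eta>])
           (simp add: Mod_add Mod_zero m[OF \<eta>] abelian_monoid.l_zero[OF abelian_group.axioms(1)[OF Gg]])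
      let ?m = "(\<ominus>\<^bsub>K\<^esub> \<one>\<^bsub>K\<^esub>) \<odot>\<^bsub>Hom (Mod K C) F G\<^esub> \<eta>"
      have mi: "?m \<in> arr (Mod K C) F G"
        by (rule smult[OF _ \<eta>]) (simp add: K cring.axioms(1) abelian_group.a_inv_closed ring.is_abelian_group ring.ring_simprules(6))
      have "?m \<oplus>\<^bsub>Hom (Mod K C) F G\<^esub> \<eta> = \<zero>\<^bsub>Hom (Mod K C) F G\<^esub>"
      proof (rule Mod_arr_eqI[OF add[OF mi \<eta>] zero])
        fix X x assume X: "X \<in> Ob C" and x: "x \<in> elts F X"
        interpret G: module K "ob_map G X" by (rule Gm[OF X])
        show "(?m \<oplus>\<^bsub>Hom (Mod K C) F G\<^esub> \<eta>) X x = \<zero>\<^bsub>Hom (Mod K C) F G\<^esub> X x"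
          using X x by (simp add: Mod_add Mod_zero Mod_smult m[OF \<eta>] G.smult_l_minus G.l_neg)
      qed
      with mi show "\<exists>\<theta>\<in>arr (Mod K C) F G. \<theta> \<oplus>\<^bsub>Hom (Mod K C) F G\<^esub> \<eta> = \<zero>\<^bsub>Hom (Mod K C) F G\<^esub>"
        by blast
    next
      fix \<eta> \<theta> assume "\<eta> \<in> arr (Mod K C) F G" "\<theta> \<in> arr (Mod K C) F G"
      then show "\<eta> \<oplus>\<^bsub>Hom (Mod K C) F G\<^esub> \<theta> = \<theta> \<oplus>\<^bsub>Hom (Mod K C) F G\<^esub> \<eta>"
        unfolding Mod_add
        by (intro nt_cong) (simp add: m abelian_monoid.a_comm[OF abelian_group.axioms(1)[OF Gg]])
    next
      fix \<eta> \<theta> \<zeta> assume "\<eta> \<in> arr (Mod K C) F G" "\<theta> \<in> arr (Mod K C) F G" "\<zeta> \<in> arr (Mod K C) F G"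
      then show "\<eta> \<oplus>\<^bsub>Hom (Mod K C) F G\<^esub> \<theta> \<oplus>\<^bsub>Hom (Mod K C) F G\<^esub> \<zeta> = \<eta> \<oplus>\<^bsub>Hom (Mod K C) F G\<^esub> (\<theta> \<oplus>\<^bsub>Hom (Mod K C) F G\<^esub> \<zeta>)"
        unfolding Mod_add
        by (intro nt_cong) (simp add: m abelian_monoid.a_assoc[OF abelian_group.axioms(1)[OF Gg]])
    qed (use add zero in auto)
  next
    fix a b \<eta> assume "a \<in> carrier K" "b \<in> carrier K" "\<eta> \<in> arr (Mod K C) F G"
    then show "(a \<oplus>\<^bsub>K\<^esub> b) \<odot>\<^bsub>Hom (Mod K C) F G\<^esub> \<eta> = a \<odot>\<^bsub>Hom (Mod K C) F G\<^esub> \<eta> \<oplus>\<^bsub>Hom (Mod K C) F G\<^esub> b \<odot>\<^bsub>Hom (Mod K C) F G\<^esub> \<eta>"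
      "(a \<otimes>\<^bsub>K\<^esub> b) \<odot>\<^bsub>Hom (Mod K C) F G\<^esub> \<eta> = a \<odot>\<^bsub>Hom (Mod K C) F G\<^esub> (b \<odot>\<^bsub>Hom (Mod K C) F G\<^esub> \<eta>)"
      unfolding Mod_add Mod_smult
      by (auto intro!: nt_cong simp: m module.smult_l_distr[OF Gm] module.smult_assoc1[OF Gm])
  next
    fix a \<eta> \<theta> assume "a \<in> carrier K" "\<eta> \<in> arr (Mod K C) F G" "\<theta> \<in> arr (Mod K C) F G"
    then show "a \<odot>\<^bsub>Hom (Mod K C) F G\<^esub> (\<eta> \<oplus>\<^bsub>Hom (Mod K C) F G\<^esub> \<theta>) = a \<odot>\<^bsub>Hom (Mod K C) F G\<^esub> \<eta> \<oplus>\<^bsub>Hom (Mod K C) F G\<^esub> a \<odot>\<^bsub>Hom (Mod K C) F G\<^esub> \<theta>"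
      unfolding Mod_add Mod_smult
      by (intro nt_cong) (simp add: m module.smult_r_distr[OF Gm])
  next
    fix \<eta> assume \<eta>: "\<eta> \<in> arr (Mod K C) F G"
    have "\<one>\<^bsub>K\<^esub> \<odot>\<^bsub>Hom (Mod K C) F G\<^esub> \<eta> = nt C F \<eta>"
      unfolding Mod_smult by (intro nt_cong) (simp add: m[OF \<eta>] module.smult_one[OF Gm])
    then show "\<one>\<^bsub>K\<^esub> \<odot>\<^bsub>Hom (Mod K C) F G\<^esub> \<eta> = \<eta>" by (simp add: Mod_arr_nt[OF \<eta>])
  qed (use smult in auto)
qed

lemma Mod_kcategory:
  assumes K: "cring K"
  shows "kcategory K (Mod K C :: ('k, ('k, 'o, 'm, 'v) cmodule, 'o \<Rightarrow> 'v \<Rightarrow> 'v) kcat)"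
proof -
  have id: "Ident (Mod K C) F \<in> arr (Mod K C) F F" if "F \<in> Ob (Mod K C)" for F :: "('k, 'o, 'm, 'v) cmodule"
    unfolding Mod_Ident by (rule Mod_arrI[OF that that]) (auto intro!: linear_mapI)
  show ?thesis
    unfolding kcategory_def
  proof (intro conjI ballI)
    fix F G H :: "('k, 'o, 'm, 'v) cmodule" and g assume "F \<in> Ob (Mod K C)" "G \<in> Ob (Mod K C)" "H \<in> Ob (Mod K C)" and g: "g \<in> arr (Mod K C) G H"
    show "linear_map K (Hom (Mod K C) F G) (Hom (Mod K C) F H) (Comp (Mod K C) F G H g)"
      by (rule linear_mapI)
         (auto simp: Mod_Comp_in[OF _ g],
          auto intro!: nt_cong simp: Mod_Comp Mod_add Mod_smult Mod_arr_in
            linear_add[OF Mod_arr_linear[OF g]] linear_smult[OF Mod_arr_linear[OF g]])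
  next
    fix F G H :: "('k, 'o, 'm, 'v) cmodule" and f assume "F \<in> Ob (Mod K C)" "G \<in> Ob (Mod K C)" "H \<in> Ob (Mod K C)" and f: "f \<in> arr (Mod K C) F G"
    show "linear_map K (Hom (Mod K C) G H) (Hom (Mod K C) F H) (\<lambda>g. Comp (Mod K C) F G H g f)"
      by (rule linear_mapI)
         (auto simp: Mod_Comp_in[OF f],
          auto intro!: nt_cong simp: Mod_Comp Mod_add Mod_smult Mod_arr_in[OF f])
  next
    fix F G :: "('k, 'o, 'm, 'v) cmodule" and f assume "F \<in> Ob (Mod K C)" "G \<in> Ob (Mod K C)" and f: "f \<in> arr (Mod K C) F G"
    show "Comp (Mod K C) F F G f (Ident (Mod K C) F) = f"
      unfolding Mod_Comp Mod_Ident
      by (rule trans[OF _ Mod_arr_nt[OF f]]) (auto intro!: nt_cong)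
    show "Comp (Mod K C) F G G (Ident (Mod K C) G) f = f"
      unfolding Mod_Comp Mod_Ident
      by (rule trans[OF _ Mod_arr_nt[OF f]]) (auto intro!: nt_cong simp: Mod_arr_in[OF f])
  next
    fix E F G H :: "('k, 'o, 'm, 'v) cmodule" and f g h assume f: "f \<in> arr (Mod K C) E F" and g: "g \<in> arr (Mod K C) F G"
    show "Comp (Mod K C) E G H h (Comp (Mod K C) E F G g f) = Comp (Mod K C) E F H (Comp (Mod K C) F G H h g) f"
      unfolding Mod_Comp by (auto intro!: nt_cong simp: Mod_arr_in[OF f])
  qed (auto simp: Mod_Hom_module[OF _ _ K] id)
qed

end

lemma full_subcategory:
  "kcategory K C \<Longrightarrow> S \<subseteq> Ob C \<Longrightarrow> kcategory K (C\<lparr>Ob := S\<rparr>)"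
  unfolding kcategory_def by (simp add: subset_iff)

section \<open>Pointwise exactness\<close>

text \<open>
  A universal property tested against all objects holds a fortiori against those of a full
  subcategory.
\<close>

lemma full_subcategory_kernel:
  "is_kernel C X Y f N i \<Longrightarrow> S \<subseteq> Ob C \<Longrightarrow> N \<in> S \<Longrightarrow> is_kernel (C\<lparr>Ob := S\<rparr>) X Y f N i"
  unfolding is_kernel_def by (simp add: subset_iff)

lemma full_subcategory_cokernel:
  "is_cokernel C X Y f Q p \<Longrightarrow> S \<subseteq> Ob C \<Longrightarrow> Q \<in> S \<Longrightarrow> is_cokernel (C\<lparr>Ob := S\<rparr>) X Y f Q p"
  unfolding is_cokernel_def by (simp add: subset_iff)

text \<open>
  Quotients live in the same type as the given space: the elements of the quotient are
  chosen representatives.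
\<close>

lemma quotient_space:
  fixes V :: "('k, 'v) module"
  assumes u: "linear_map K U V u" and U: "module K U" and V: "module K V"
  shows "\<exists>(W :: ('k, 'v) module) p. module K W \<and> linear_map K V W p \<and> p ` carrier V = carrier W \<and>
    (\<forall>v\<in>carrier V. p v = \<zero>\<^bsub>W\<^esub> \<longleftrightarrow> v \<in> u ` carrier U)"
proof -
  interpret U: module K U by fact
  interpret V: module K V by fact
  define S where "S = u ` carrier U"
  have SV: "S \<subseteq> carrier V" using linear_in[OF u] by (auto simp: S_def)
  have S0: "\<zero>\<^bsub>V\<^esub> \<in> S" unfolding S_def
    using linear_zero[OF u U V] by (intro image_eqI[of _ _ "\<zero>\<^bsub>U\<^esub>"]) auto
  have Sadd: "x \<oplus>\<^bsub>V\<^esub> y \<in> S" if xy: "x \<in> S" "y \<in> S" for x y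
  proof -
    obtain a b where "x = u a" "y = u b" "a \<in> carrier U" "b \<in> carrier U" using xy by (auto simp: S_def)
    then show ?thesis unfolding S_def
      by (intro image_eqI[of _ _ "a \<oplus>\<^bsub>U\<^esub> b"]) (auto simp: linear_add[OF u])
  qed
  have Sneg: "\<ominus>\<^bsub>V\<^esub> x \<in> S" if x: "x \<in> S" for x
  proof -
    obtain a where "x = u a" "a \<in> carrier U" using x by (auto simp: S_def)
    then show ?thesis unfolding S_def
      by (intro image_eqI[of _ _ "\<ominus>\<^bsub>U\<^esub> a"]) (auto simp: linear_minus[OF u U V])
  qed
  have Ssm: "c \<odot>\<^bsub>V\<^esub> x \<in> S" if c: "c \<in> carrier K" and x: "x \<in> S" for c x
  proof -
    obtain a where "x = u a" "a \<in> carrier U" using x by (auto simp: S_def)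
    then show ?thesis unfolding S_def
      using c by (intro image_eqI[of _ _ "c \<odot>\<^bsub>U\<^esub> a"]) (auto simp: linear_smult[OF u])
  qed
  define eq where "eq v w \<longleftrightarrow> (\<exists>s\<in>S. w = v \<oplus>\<^bsub>V\<^esub> s)" for v w
  have refl: "eq v v" if "v \<in> carrier V" for v
    using that S0 by (auto simp: eq_def intro!: bexI[of _ "\<zero>\<^bsub>V\<^esub>"])
  have sym: "eq w v" if *: "eq v w" "v \<in> carrier V" for v w
  proof -
    obtain s where s: "s \<in> S" "w = v \<oplus>\<^bsub>V\<^esub> s" using * by (auto simp: eq_def)
    have "s \<in> carrier V" using s SV by auto
    then have "v = w \<oplus>\<^bsub>V\<^esub> (\<ominus>\<^bsub>V\<^esub> s)" using s that by (simp add: V.a_assoc V.r_neg)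
    then show ?thesis using s Sneg by (auto simp: eq_def)
  qed
  have trans: "eq v x" if *: "eq v w" "eq w x" "v \<in> carrier V" for v w x
  proof -
    obtain s t where s: "s \<in> S" "w = v \<oplus>\<^bsub>V\<^esub> s" "t \<in> S" "x = w \<oplus>\<^bsub>V\<^esub> t" using * by (auto simp: eq_def)
    then have "x = v \<oplus>\<^bsub>V\<^esub> (s \<oplus>\<^bsub>V\<^esub> t)" using that SV by (simp add: V.a_assoc subset_iff)
    then show ?thesis using s Sadd by (auto simp: eq_def)
  qed
  have eqV: "w \<in> carrier V" if "eq v w" "v \<in> carrier V" for v w
    using that SV by (auto simp: eq_def)
  have eqadd: "eq (v \<oplus>\<^bsub>V\<^esub> w) (v' \<oplus>\<^bsub>V\<^esub> w')"
    if *: "eq v v'" "eq w w'" and V: "v \<in> carrier V" "w \<in> carrier V" for v v' w w'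
  proof -
    obtain s t where s: "s \<in> S" "v' = v \<oplus>\<^bsub>V\<^esub> s" "t \<in> S" "w' = w \<oplus>\<^bsub>V\<^esub> t" using * by (auto simp: eq_def)
    have "s \<in> carrier V" "t \<in> carrier V" using s SV by auto
    then have "v' \<oplus>\<^bsub>V\<^esub> w' = (v \<oplus>\<^bsub>V\<^esub> w) \<oplus>\<^bsub>V\<^esub> (s \<oplus>\<^bsub>V\<^esub> t)" using s V by (simp add: V.a_ac)
    then show ?thesis using s Sadd by (auto simp: eq_def)
  qed
  have eqsm: "eq (c \<odot>\<^bsub>V\<^esub> v) (c \<odot>\<^bsub>V\<^esub> v')"
    if *: "eq v v'" and c: "c \<in> carrier K" and V: "v \<in> carrier V" for c v v'
  proof -
    obtain s where s: "s \<in> S" "v' = v \<oplus>\<^bsub>V\<^esub> s" using * by (auto simp: eq_def)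
    then have "c \<odot>\<^bsub>V\<^esub> v' = c \<odot>\<^bsub>V\<^esub> v \<oplus>\<^bsub>V\<^esub> c \<odot>\<^bsub>V\<^esub> s" using c V SV by (simp add: V.smult_r_distr subset_iff)
    then show ?thesis using s c Ssm by (auto simp: eq_def)
  qed
  define p where "p v = (SOME w. eq v w)" for v
  have p: "eq v (p v)" if "v \<in> carrier V" for v
    unfolding p_def by (rule someI[of "eq v" v]) (rule refl[OF that])
  have p_eq: "p v = p w" if "eq v w" "v \<in> carrier V" for v w
  proof -
    have "eq v x \<longleftrightarrow> eq w x" for x
      using trans[of w v x] trans[of v w x] sym[of v w] eqV[of v w] that by blast
    then show ?thesis by (simp add: p_def)
  qed
  have pV: "p v \<in> carrier V" if "v \<in> carrier V" for v using eqV[OF p[OF that] that] .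
  have p_iff: "p v = p w \<longleftrightarrow> eq v w" if "v \<in> carrier V" "w \<in> carrier V" for v w
  proof
    assume "p v = p w"
    then have "eq v (p w)" using p[of v] that by simp
    then show "eq v w" using sym[OF p[OF that(2)] that(2)] trans that by blast
  qed (use that p_eq in blast)
  define W :: "('k, 'v) module" where
    "W = \<lparr>carrier = p ` carrier V, mult = undefined, one = undefined, zero = p \<zero>\<^bsub>V\<^esub>,
       add = (\<lambda>v w. p (v \<oplus>\<^bsub>V\<^esub> w)), smult = (\<lambda>c v. p (c \<odot>\<^bsub>V\<^esub> v))\<rparr>"
  have Wadd: "p v \<oplus>\<^bsub>W\<^esub> p w = p (v \<oplus>\<^bsub>V\<^esub> w)" if "v \<in> carrier V" "w \<in> carrier V" for v w
    using p_eq[OF eqadd[OF p[OF that(1)] p[OF that(2)] that]] that by (simp add: W_def)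
  have Wsm: "c \<odot>\<^bsub>W\<^esub> p v = p (c \<odot>\<^bsub>V\<^esub> v)" if "c \<in> carrier K" "v \<in> carrier V" for c v
    using p_eq[OF eqsm[OF p[OF that(2)] that]] that by (simp add: W_def)
  have Wc: "carrier W = p ` carrier V" "\<zero>\<^bsub>W\<^esub> = p \<zero>\<^bsub>V\<^esub>" by (simp_all add: W_def)
  have "module K W" by (rule image_module[OF V Wc(1) Wadd Wsm Wc(2)])
  moreover have "linear_map K V W p" by (rule linear_mapI) (auto simp: Wc Wadd Wsm)
  moreover have "p v = \<zero>\<^bsub>W\<^esub> \<longleftrightarrow> v \<in> u ` carrier U" if "v \<in> carrier V" for v
  proof -
    have "p v = \<zero>\<^bsub>W\<^esub> \<longleftrightarrow> eq \<zero>\<^bsub>V\<^esub> v" using that by (metis Wc(2) V.zero_closed p_iff)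
    also have "\<dots> \<longleftrightarrow> v \<in> S" using that SV by (auto simp: eq_def subset_iff intro!: bexI[of _ v])
    finally show ?thesis by (simp add: S_def)
  qed
  ultimately show ?thesis using Wc by metis
qed

lemma linear_eq_iff_diff:
  assumes "linear_map K V W f" "module K V" "module K W" "x \<in> carrier V" "y \<in> carrier V"
  shows "f x = f y \<longleftrightarrow> f (x \<ominus>\<^bsub>V\<^esub> y) = \<zero>\<^bsub>W\<^esub>"
proof -
  interpret W: module K W by fact
  show ?thesis
    using linear_diff[OF assms] linear_in[OF assms(1)] assms(4,5)
    by (metis W.add.inv_solve_right W.l_zero W.zero_closed a_minus_def)
qed

context linear_category
begin

text \<open>
  The values of the lift are the unique preimages under \<open>j\<close>, so its linearity and naturality follow from
  those of \<open>t\<close> and \<open>j\<close>.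
\<close>

lemma Mod_lift:
  assumes t: "t \<in> arr (Mod K C) T F" and j: "j \<in> arr (Mod K C) N F"
    and inj: "\<And>X. X \<in> Ob C \<Longrightarrow> inj_on (j X) (elts N X)"
    and im: "\<And>X x. X \<in> Ob C \<Longrightarrow> x \<in> elts T X \<Longrightarrow> t X x \<in> j X ` elts N X"
  obtains s where "s \<in> arr (Mod K C) T N" "\<And>X x. X \<in> Ob C \<Longrightarrow> x \<in> elts T X \<Longrightarrow> j X (s X x) = t X x"
    "Comp (Mod K C) T N F j s = t"
proof -
  note T = Mod_arr_source[OF t] and N = Mod_arr_source[OF j] and F = Mod_arr_target[OF t]
  define u where "u = (\<lambda>X x. the_inv_into (elts N X) (j X) (t X x))"
  have u: "u X x \<in> elts N X" "j X (u X x) = t X x" if "X \<in> Ob C" "x \<in> elts T X" for X x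
    using the_inv_into_into[OF inj im] f_the_inv_into_f[OF inj im] that unfolding u_def by blast+
  have uI: "u X x = n" if "X \<in> Ob C" "x \<in> elts T X" "n \<in> elts N X" "j X n = t X x" for X x n
    by (rule inj_onD[OF inj[OF that(1)]]) (use u[of X x] that in simp_all)
  have s: "nt C T u \<in> arr (Mod K C) T N"
  proof (rule Mod_arrI[OF T N])
    fix X assume X: "X \<in> Ob C"
    interpret N: module K "ob_map N X" by (rule Mod_module[OF N X])
    interpret T: module K "ob_map T X" by (rule Mod_module[OF T X])
    show "linear_map K (ob_map T X) (ob_map N X) (u X)"
      using X by (auto intro!: linear_mapI uI simp: u linear_add[OF Mod_arr_linear[OF j]] linear_add[OF Mod_arr_linear[OF t]]
         linear_smult[OF Mod_arr_linear[OF j]] linear_smult[OF Mod_arr_linear[OF t]])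
  next
    fix X Y f y assume "X \<in> Ob C" "Y \<in> Ob C" "f \<in> arr C X Y" "y \<in> elts T Y"
    then show "u X (hom_map T Y X f y) = hom_map N Y X f (u Y y)"
      by (intro uI) (auto simp: u Mod_hom_in[OF T] Mod_hom_in[OF N] Mod_arr_natural[OF j] Mod_arr_natural[OF t])
  qed
  have "j X (nt C T u X x) = t X x" if "X \<in> Ob C" "x \<in> elts T X" for X x
    using that by (simp add: u)
  moreover have "Comp (Mod K C) T N F j (nt C T u) = t"
    unfolding Mod_Comp by (rule trans[OF _ Mod_arr_nt[OF t]]) (auto intro!: nt_cong simp: u)
  ultimately show ?thesis using that s by blast
qed

text \<open>
  Dually, the factor is well defined on arbitrary preimages under \<open>p\<close>, because two of them differ by an
  element that \<open>t\<close> kills.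
\<close>

lemma Mod_factor:
  assumes t: "t \<in> arr (Mod K C) G T" and p: "p \<in> arr (Mod K C) G Q"
    and surj: "\<And>X. X \<in> Ob C \<Longrightarrow> p X ` elts G X = elts Q X"
    and ker: "\<And>X y. X \<in> Ob C \<Longrightarrow> y \<in> elts G X \<Longrightarrow> p X y = \<zero>\<^bsub>ob_map Q X\<^esub> \<Longrightarrow> t X y = \<zero>\<^bsub>ob_map T X\<^esub>"
  obtains s where "s \<in> arr (Mod K C) Q T" "\<And>X y. X \<in> Ob C \<Longrightarrow> y \<in> elts G X \<Longrightarrow> s X (p X y) = t X y"
    "Comp (Mod K C) G Q T s p = t"
proof -
  note T = Mod_arr_target[OF t] and G = Mod_arr_source[OF t] and Q = Mod_arr_target[OF p]
  define u where "u = (\<lambda>X q. t X (SOME y. y \<in> elts G X \<and> p X y = q))"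
  have u: "u X (p X y) = t X y" if X: "X \<in> Ob C" and y: "y \<in> elts G X" for X y
  proof -
    let ?y = "SOME y'. y' \<in> elts G X \<and> p X y' = p X y"
    have y': "?y \<in> elts G X \<and> p X ?y = p X y" by (rule someI[of _ y]) (use y in simp)
    interpret G: module K "ob_map G X" by (rule Mod_module[OF G X])
    have "p X (?y \<ominus>\<^bsub>ob_map G X\<^esub> y) = \<zero>\<^bsub>ob_map Q X\<^esub>"
      using y' y linear_eq_iff_diff[OF Mod_arr_linear[OF p X] Mod_module[OF G X] Mod_module[OF Q X]] by blast
    then have "t X (?y \<ominus>\<^bsub>ob_map G X\<^esub> y) = \<zero>\<^bsub>ob_map T X\<^esub>"
      using ker X y y' by simp
    then show ?thesis
      using y' y linear_eq_iff_diff[OF Mod_arr_linear[OF t X] Mod_module[OF G X] Mod_module[OF T X]]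
      unfolding u_def by blast
  qed
  have pre: "\<exists>y\<in>elts G X. p X y = q" if "X \<in> Ob C" "q \<in> elts Q X" for X q
    using surj[OF that(1)] that(2) by (metis imageE)
  have s: "nt C Q u \<in> arr (Mod K C) Q T"
  proof (rule Mod_arrI[OF Q T])
    fix X assume X: "X \<in> Ob C"
    interpret G: module K "ob_map G X" by (rule Mod_module[OF G X])
    show "linear_map K (ob_map Q X) (ob_map T X) (u X)"
    proof (rule linear_mapI)
      fix x assume "x \<in> elts Q X"
      then obtain y where "y \<in> elts G X" "x = p X y" using pre[OF X] by blast
      then show "u X x \<in> elts T X" using X by (simp add: u Mod_arr_in[OF t])
    next
      fix x x' assume "x \<in> elts Q X" "x' \<in> elts Q X"
      then obtain y y' where "y \<in> elts G X" "x = p X y" "y' \<in> elts G X" "x' = p X y'" using pre[OF X] by metis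
      then show "u X (x \<oplus>\<^bsub>ob_map Q X\<^esub> x') = u X x \<oplus>\<^bsub>ob_map T X\<^esub> u X x'"
        using X by (simp add: u linear_add[OF Mod_arr_linear[OF p], symmetric] linear_add[OF Mod_arr_linear[OF t]])
    next
      fix a x assume "a \<in> carrier K" "x \<in> elts Q X"
      moreover then obtain y where "y \<in> elts G X" "x = p X y" using pre[OF X] by metis
      ultimately show "u X (a \<odot>\<^bsub>ob_map Q X\<^esub> x) = a \<odot>\<^bsub>ob_map T X\<^esub> u X x"
        using X by (simp add: u linear_smult[OF Mod_arr_linear[OF p], symmetric] linear_smult[OF Mod_arr_linear[OF t]])
    qed
  next
    fix X Y f y assume *: "X \<in> Ob C" "Y \<in> Ob C" "f \<in> arr C X Y" "y \<in> elts Q Y"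
    moreover then obtain z where "z \<in> elts G Y" "y = p Y z" using pre by metis
    ultimately show "u X (hom_map Q Y X f y) = hom_map T Y X f (u Y y)"
      by (simp add: u Mod_arr_natural[OF p, symmetric] Mod_arr_natural[OF t] Mod_hom_in[OF G])
  qed
  have pin: "p X y \<in> elts Q X" if "X \<in> Ob C" "y \<in> elts G X" for X y by (rule Mod_arr_in[OF p that])
  have "nt C Q u X (p X y) = t X y" if "X \<in> Ob C" "y \<in> elts G X" for X y
    using that by (simp add: u pin)
  moreover have "Comp (Mod K C) G Q T (nt C Q u) p = t"
    unfolding Mod_Comp by (rule trans[OF _ Mod_arr_nt[OF t]]) (auto intro!: nt_cong simp: u pin)
  ultimately show ?thesis using that s by blast
qed

lemma Mod_kernelI:
  assumes f: "f \<in> arr (Mod K C) F G" and j: "j \<in> arr (Mod K C) N F"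
    and inj: "\<And>X. X \<in> Ob C \<Longrightarrow> inj_on (j X) (elts N X)"
    and im: "\<And>X. X \<in> Ob C \<Longrightarrow> j X ` elts N X = {x \<in> elts F X. f X x = \<zero>\<^bsub>ob_map G X\<^esub>}"
  shows "is_kernel (Mod K C) F G f N j"
  unfolding is_kernel_def
proof (intro conjI ballI impI)
  have fj: "f X (j X n) = \<zero>\<^bsub>ob_map G X\<^esub>" if "X \<in> Ob C" "n \<in> elts N X" for X n
    using im[OF that(1)] that(2) by blast
  show "N \<in> Ob (Mod K C)" "j \<in> arr (Mod K C) N F" by (rule Mod_arr_source[OF j], rule j)
  show "Comp (Mod K C) N F G f j = \<zero>\<^bsub>Hom (Mod K C) N G\<^esub>"
    unfolding Mod_Comp Mod_zero by (intro nt_cong fj)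
  fix T t assume t: "t \<in> arr (Mod K C) T F" and 0: "Comp (Mod K C) T F G f t = \<zero>\<^bsub>Hom (Mod K C) T G\<^esub>"
  have "t X x \<in> j X ` elts N X" if "X \<in> Ob C" "x \<in> elts T X" for X x
  proof -
    have "nt C T (\<lambda>X x. f X (t X x)) X x = nt C T (\<lambda>X x. \<zero>\<^bsub>ob_map G X\<^esub>) X x"
      using 0 by (simp add: Mod_Comp Mod_zero)
    then show ?thesis using that by (simp add: im Mod_arr_in[OF t])
  qed
  then obtain s where s: "s \<in> arr (Mod K C) T N" "Comp (Mod K C) T N F j s = t"
    using Mod_lift[OF t j inj] by blast
  show "\<exists>!s. s \<in> arr (Mod K C) T N \<and> Comp (Mod K C) T N F j s = t"
  proof (rule ex1I[of _ s])
    fix s' assume s': "s' \<in> arr (Mod K C) T N \<and> Comp (Mod K C) T N F j s' = t"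
    show "s' = s"
    proof (rule Mod_arr_eqI)
      show "s' \<in> arr (Mod K C) T N" "s \<in> arr (Mod K C) T N" using s s' by auto
      fix X x assume *: "X \<in> Ob C" "x \<in> elts T X"
      have "Comp (Mod K C) T N F j s' X x = Comp (Mod K C) T N F j s X x" using s s' by simp
      then have "j X (s' X x) = j X (s X x)" using * by (simp add: Mod_Comp)
      then show "s' X x = s X x"
        by (rule inj_onD[OF inj[OF *(1)]]) (use * s s' in \<open>auto simp: Mod_arr_in\<close>)
    qed
  qed (use s in simp)
qed

lemma Mod_cokernelI:
  assumes f: "f \<in> arr (Mod K C) F G" and p: "p \<in> arr (Mod K C) G Q"
    and surj: "\<And>X. X \<in> Ob C \<Longrightarrow> p X ` elts G X = elts Q X"
    and ker: "\<And>X. X \<in> Ob C \<Longrightarrow> {y \<in> elts G X. p X y = \<zero>\<^bsub>ob_map Q X\<^esub>} = f X ` elts F X"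
  shows "is_cokernel (Mod K C) F G f Q p"
  unfolding is_cokernel_def
proof (intro conjI ballI impI)
  have pf: "p X (f X x) = \<zero>\<^bsub>ob_map Q X\<^esub>" if "X \<in> Ob C" "x \<in> elts F X" for X x
    using ker[OF that(1)] that(2) by blast
  show "Q \<in> Ob (Mod K C)" "p \<in> arr (Mod K C) G Q" by (rule Mod_arr_target[OF p], rule p)
  show "Comp (Mod K C) F G Q p f = \<zero>\<^bsub>Hom (Mod K C) F Q\<^esub>"
    unfolding Mod_Comp Mod_zero by (intro nt_cong pf)
  fix T t assume t: "t \<in> arr (Mod K C) G T" and 0: "Comp (Mod K C) F G T t f = \<zero>\<^bsub>Hom (Mod K C) F T\<^esub>"
  have "t X y = \<zero>\<^bsub>ob_map T X\<^esub>" if *: "X \<in> Ob C" "y \<in> elts G X" "p X y = \<zero>\<^bsub>ob_map Q X\<^esub>" for X y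
  proof -
    obtain x where x: "x \<in> elts F X" "y = f X x" using ker[OF *(1)] * by blast
    have "nt C F (\<lambda>X x. t X (f X x)) X x = nt C F (\<lambda>X x. \<zero>\<^bsub>ob_map T X\<^esub>) X x"
      using 0 by (simp add: Mod_Comp Mod_zero)
    then show ?thesis using that x by simp
  qed
  then obtain s where s: "s \<in> arr (Mod K C) Q T" "Comp (Mod K C) G Q T s p = t"
    using Mod_factor[OF t p surj] by blast
  show "\<exists>!s. s \<in> arr (Mod K C) Q T \<and> Comp (Mod K C) G Q T s p = t"
  proof (rule ex1I[of _ s])
    fix s' assume s': "s' \<in> arr (Mod K C) Q T \<and> Comp (Mod K C) G Q T s' p = t"
    show "s' = s"
    proof (rule Mod_arr_eqI)
      show "s' \<in> arr (Mod K C) Q T" "s \<in> arr (Mod K C) Q T" using s s' by auto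
      fix X q assume *: "X \<in> Ob C" "q \<in> elts Q X"
      then obtain y where y: "y \<in> elts G X" "q = p X y" using surj by (metis imageE)
      have "Comp (Mod K C) G Q T s' p X y = Comp (Mod K C) G Q T s p X y" using s s' by simp
      then show "s' X q = s X q" using * y by (simp add: Mod_Comp)
    qed
  qed (use s in simp)
qed

lemma Mod_invertibleI:
  assumes f: "f \<in> arr (Mod K C) F G" and bij: "\<And>X. X \<in> Ob C \<Longrightarrow> bij_betw (f X) (elts F X) (elts G X)"
  shows "invertible (Mod K C) F G f"
proof -
  note F = Mod_arr_source[OF f] and G = Mod_arr_target[OF f]
  have id: "nt C H (\<lambda>X x. x) \<in> arr (Mod K C) H H" if "H \<in> Ob (Mod K C)" for H
    by (rule Mod_arrI[OF that that]) (auto intro!: linear_mapI)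
  obtain g where g: "g \<in> arr (Mod K C) G F" "\<And>X x. X \<in> Ob C \<Longrightarrow> x \<in> elts G X \<Longrightarrow> f X (g X x) = nt C G (\<lambda>X x. x) X x"
    "Comp (Mod K C) G F G f g = nt C G (\<lambda>X x. x)"
    by (rule Mod_lift[OF id[OF G] f]) (use bij in \<open>auto simp: bij_betw_def\<close>)
  have "Comp (Mod K C) F G F g f = nt C F (\<lambda>X x. x)"
    unfolding Mod_Comp
  proof (rule nt_cong)
    fix X x assume *: "X \<in> Ob C" "x \<in> elts F X"
    have "f X (g X (f X x)) = f X x" using * by (simp add: g Mod_arr_in[OF f])
    then show "g X (f X x) = x"
      by (rule inj_onD[OF bij_betw_imp_inj_on[OF bij[OF *(1)]]])
         (use * in \<open>simp_all add: Mod_arr_in[OF f] Mod_arr_in[OF g(1)]\<close>)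
  qed
  then show ?thesis
    using f g unfolding invertible_def inverse_arr_def by (intro exI[of _ g]) (simp add: Mod_Ident)
qed

text \<open>
  The quotient spaces are chosen independently at each object. Naturality of \<open>\<alpha>\<close> makes the action of
  the morphisms of \<open>C\<close> on \<open>G\<close> pass to them.
\<close>

lemma Mod_quotient:
  fixes F G :: "('k, 'o, 'm, 'v) cmodule"
  assumes \<alpha>: "\<alpha> \<in> arr (Mod K C) F G"
  obtains Q :: "('k, 'o, 'm, 'v) cmodule" and p where "p \<in> arr (Mod K C) G Q"
    "\<And>X. X \<in> Ob C \<Longrightarrow> p X ` elts G X = elts Q X"
    "\<And>X. X \<in> Ob C \<Longrightarrow> {y \<in> elts G X. p X y = \<zero>\<^bsub>ob_map Q X\<^esub>} = \<alpha> X ` elts F X"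
proof -
  note F = Mod_arr_source[OF \<alpha>] and G = Mod_arr_target[OF \<alpha>]
  have "\<forall>X\<in>Ob C. \<exists>(W :: ('k, 'v) module) p. module K W \<and> linear_map K (ob_map G X) W p \<and> p ` elts G X = carrier W \<and>
    (\<forall>v\<in>elts G X. p v = \<zero>\<^bsub>W\<^esub> \<longleftrightarrow> v \<in> \<alpha> X ` elts F X)"
    using quotient_space[OF Mod_arr_linear[OF \<alpha>] Mod_module[OF F] Mod_module[OF G]] by blast
  from bchoice[OF this] obtain W :: "'o \<Rightarrow> ('k, 'v) module" where "\<forall>X\<in>Ob C. \<exists>p. module K (W X) \<and> linear_map K (ob_map G X) (W X) p \<and> p ` elts G X = carrier (W X) \<and>
    (\<forall>v\<in>elts G X. p v = \<zero>\<^bsub>W X\<^esub> \<longleftrightarrow> v \<in> \<alpha> X ` elts F X)" by blast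
  from bchoice[OF this] obtain p where p': "\<forall>X\<in>Ob C. module K (W X) \<and> linear_map K (ob_map G X) (W X) (p X) \<and> p X ` elts G X = carrier (W X) \<and>
    (\<forall>v\<in>elts G X. p X v = \<zero>\<^bsub>W X\<^esub> \<longleftrightarrow> v \<in> \<alpha> X ` elts F X)" by blast
  have p: "\<And>X. X \<in> Ob C \<Longrightarrow> module K (W X)"
    "\<And>X. X \<in> Ob C \<Longrightarrow> linear_map K (ob_map G X) (W X) (p X)"
    "\<And>X. X \<in> Ob C \<Longrightarrow> p X ` elts G X = carrier (W X)"
    "\<And>X v. X \<in> Ob C \<Longrightarrow> v \<in> elts G X \<Longrightarrow> p X v = \<zero>\<^bsub>W X\<^esub> \<longleftrightarrow> v \<in> \<alpha> X ` elts F X"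
    using p' by simp_all
  define Q :: "('k, 'o, 'm, 'v) cmodule" where
    "Q = \<lparr>ob_map = W, hom_map = (\<lambda>Y X f. \<lambda>w\<in>carrier (W Y). p X (hom_map G Y X f (SOME y. y \<in> elts G Y \<and> p Y y = w)))\<rparr>"
  have [simp]: "ob_map Q = W" by (simp add: Q_def)
  have pin: "p X y \<in> carrier (W X)" if "X \<in> Ob C" "y \<in> elts G X" for X y by (rule linear_in[OF p(2) that(2)]) fact
  have Qp: "hom_map Q Y X f (p Y y) = p X (hom_map G Y X f y)"
    if *: "X \<in> Ob C" "Y \<in> Ob C" "f \<in> arr C X Y" "y \<in> elts G Y" for X Y f y
  proof -
    let ?y = "SOME y'. y' \<in> elts G Y \<and> p Y y' = p Y y"
    have y': "?y \<in> elts G Y" "p Y ?y = p Y y" using someI[of "\<lambda>y'. y' \<in> elts G Y \<and> p Y y' = p Y y" y] * by auto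
    interpret GY: module K "ob_map G Y" using Mod_module[OF G] * by blast
    have "p Y (?y \<ominus>\<^bsub>ob_map G Y\<^esub> y) = \<zero>\<^bsub>W Y\<^esub>"
      using y' * linear_eq_iff_diff[OF p(2) Mod_module[OF G] p(1)] by blast
    then obtain x where x: "x \<in> elts F Y" "?y \<ominus>\<^bsub>ob_map G Y\<^esub> y = \<alpha> Y x"
      using p(4)[OF *(2), of "?y \<ominus>\<^bsub>ob_map G Y\<^esub> y"] y' * by auto
    have "p X (hom_map G Y X f (?y \<ominus>\<^bsub>ob_map G Y\<^esub> y)) = \<zero>\<^bsub>W X\<^esub>"
      using * x by (subst p(4)) (auto simp: Mod_arr_natural[OF \<alpha>, symmetric] Mod_hom_in[OF F] Mod_hom_in[OF G] Mod_arr_in[OF \<alpha>])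
    then have "p X (hom_map G Y X f ?y \<ominus>\<^bsub>ob_map G X\<^esub> hom_map G Y X f y) = \<zero>\<^bsub>W X\<^esub>"
      using * y' by (simp add: linear_diff[OF Mod_hom_linear[OF G]] Mod_module[OF G])
    then have "p X (hom_map G Y X f ?y) = p X (hom_map G Y X f y)"
      using * y' linear_eq_iff_diff[OF p(2) Mod_module[OF G] p(1)] Mod_hom_in[OF G] by blast
    then show ?thesis using * by (simp add: Q_def pin)
  qed
  have cases: "\<exists>y\<in>elts G X. w = p X y" if "X \<in> Ob C" "w \<in> carrier (W X)" for X w
    using p(3)[OF that(1)] that(2) by auto
  have Q: "Q \<in> Ob (Mod K C)"
  proof (rule Mod_ObI)
    fix X Y f assume *: "X \<in> Ob C" "Y \<in> Ob C" "f \<in> arr C X Y"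
    show "hom_map Q Y X f \<in> extensional (elts Q Y)" by (simp add: Q_def)
    interpret GY: module K "ob_map G Y" using Mod_module[OF G] * by blast
    show "linear_map K (ob_map Q Y) (ob_map Q X) (hom_map Q Y X f)"
    proof (rule linear_mapI; simp)
      fix w assume "w \<in> carrier (W Y)"
      then obtain y where "y \<in> elts G Y" "w = p Y y" using cases * by blast
      then show "hom_map Q Y X f w \<in> carrier (W X)" using * by (simp add: Qp pin Mod_hom_in[OF G])
    next
      fix w w' assume "w \<in> carrier (W Y)" "w' \<in> carrier (W Y)"
      then obtain y y' where "y \<in> elts G Y" "w = p Y y" "y' \<in> elts G Y" "w' = p Y y'" using cases * by metis
      then show "hom_map Q Y X f (w \<oplus>\<^bsub>W Y\<^esub> w') = hom_map Q Y X f w \<oplus>\<^bsub>W X\<^esub> hom_map Q Y X f w'"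
        using * by (simp add: Qp linear_add[OF p(2), symmetric] linear_add[OF Mod_hom_linear[OF G]] Mod_hom_in[OF G])
    next
      fix a w assume "a \<in> carrier K" "w \<in> carrier (W Y)"
      moreover then obtain y where "y \<in> elts G Y" "w = p Y y" using cases * by metis
      ultimately show "hom_map Q Y X f (a \<odot>\<^bsub>W Y\<^esub> w) = a \<odot>\<^bsub>W X\<^esub> hom_map Q Y X f w"
        using * by (simp add: Qp linear_smult[OF p(2), symmetric] linear_smult[OF Mod_hom_linear[OF G]] Mod_hom_in[OF G])
    qed
  next
    fix X Y f f' w assume *: "X \<in> Ob C" "Y \<in> Ob C" "f \<in> arr C X Y" "f' \<in> arr C X Y" "w \<in> elts Q Y"
    moreover then obtain y where "y \<in> elts G Y" "w = p Y y" using cases by force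
    ultimately show "hom_map Q Y X (f \<oplus>\<^bsub>Hom C X Y\<^esub> f') w = hom_map Q Y X f w \<oplus>\<^bsub>ob_map Q X\<^esub> hom_map Q Y X f' w"
      by (simp add: Qp linear_add[OF p(2), symmetric] Mod_hom_add[OF G] Mod_hom_in[OF G])
  next
    fix X Y a f w assume *: "X \<in> Ob C" "Y \<in> Ob C" "a \<in> carrier K" "f \<in> arr C X Y" "w \<in> elts Q Y"
    moreover then obtain y where "y \<in> elts G Y" "w = p Y y" using cases by force
    ultimately show "hom_map Q Y X (a \<odot>\<^bsub>Hom C X Y\<^esub> f) w = a \<odot>\<^bsub>ob_map Q X\<^esub> hom_map Q Y X f w"
      by (simp add: Qp linear_smult[OF p(2), symmetric] Mod_hom_smult[OF G] Mod_hom_in[OF G] module.smult_closed[OF Hom_module])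
  next
    fix X w assume *: "X \<in> Ob C" "w \<in> elts Q X"
    moreover then obtain y where "y \<in> elts G X" "w = p X y" using cases by force
    ultimately show "hom_map Q X X (Ident C X) w = w"
      by (simp add: Qp Mod_hom_ident[OF G])
  next
    fix X Y Z f g w assume *: "X \<in> Ob C" "Y \<in> Ob C" "Z \<in> Ob C" "f \<in> arr C X Y" "g \<in> arr C Y Z" "w \<in> elts Q Z"
    moreover then obtain z where "z \<in> elts G Z" "w = p Z z" using cases by force
    ultimately show "hom_map Q Z X (Comp C X Y Z g f) w = hom_map Q Y X f (hom_map Q Z Y g w)"
      by (simp add: Qp Mod_hom_comp[OF G] Mod_hom_in[OF G])
  qed (simp add: p)
  have "nt C G p \<in> arr (Mod K C) G Q"
    by (rule Mod_arrI[OF G Q]) (simp_all add: p Qp)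
  moreover have "nt C G p X ` elts G X = elts Q X" if "X \<in> Ob C" for X
    using that p(3)[OF that] by (auto simp: image_iff cases pin)
  moreover have "{y \<in> elts G X. nt C G p X y = \<zero>\<^bsub>ob_map Q X\<^esub>} = \<alpha> X ` elts F X" if "X \<in> Ob C" for X
    using that p(4)[OF that] Mod_arr_in[OF \<alpha> that] by auto
  ultimately show ?thesis using that by blast
qed

end

section \<open>Representable modules\<close>

locale small_linear_category = linear_category K C
  for K :: "'k ring" and C :: "('k, 'o, 'm) kcat" +
  fixes V :: "'v itself"
  assumes cring: "cring K" and small: "locally_small V C"
begin

sublocale Mod: linear_category K "Mod K C :: ('k, ('k, 'o, 'm, 'v) cmodule, 'o \<Rightarrow> 'v \<Rightarrow> 'v) kcat"
  by unfold_locales (rule Mod_kcategory[OF cring])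

text \<open>
  Elements of \<open>rep X\<close> at \<open>Y\<close> are handled exclusively in the form \<open>cd Y X f\<close> with \<open>f : Y \<rightarrow> X\<close>, in terms of
  which all operations have the expected form.
\<close>

abbreviation cd :: "'o \<Rightarrow> 'o \<Rightarrow> 'm \<Rightarrow> 'v" where "cd Y X \<equiv> code (arr C Y X)"
abbreviation dc :: "'o \<Rightarrow> 'o \<Rightarrow> 'v \<Rightarrow> 'm" where "dc Y X \<equiv> decode (arr C Y X)"
abbreviation rep :: "'o \<Rightarrow> ('k, 'o, 'm, 'v) cmodule" where "rep \<equiv> representable C"
abbreviation yo :: "('o, 'm, ('k, 'o, 'm, 'v) cmodule, 'o \<Rightarrow> 'v \<Rightarrow> 'v) kfun" where "yo \<equiv> yoneda C"

lemma cd_inj: "X \<in> Ob C \<Longrightarrow> Y \<in> Ob C \<Longrightarrow> inj_on (cd Y X) (arr C Y X)"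
  using small someI_ex[of "\<lambda>i :: 'm \<Rightarrow> 'v. inj_on i (arr C Y X)"]
  unfolding locally_small_def code_def by blast

lemma dc_cd [simp]: "X \<in> Ob C \<Longrightarrow> Y \<in> Ob C \<Longrightarrow> f \<in> arr C Y X \<Longrightarrow> dc Y X (cd Y X f) = f"
  unfolding decode_def by (rule the_inv_into_f_f[OF cd_inj])

lemma cd_eq_iff: "X \<in> Ob C \<Longrightarrow> Y \<in> Ob C \<Longrightarrow> f \<in> arr C Y X \<Longrightarrow> g \<in> arr C Y X \<Longrightarrow> cd Y X f = cd Y X g \<longleftrightarrow> f = g"
  using inj_on_eq_iff[OF cd_inj] by blast

lemma rep_elts: "elts (rep X) Y = cd Y X ` arr C Y X"
  by (simp add: representable_def copy_space_def)

lemma rep_cases: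
  assumes "c \<in> elts (rep X) Y"
  obtains f where "f \<in> arr C Y X" "c = cd Y X f"
  using assms by (auto simp: rep_elts)

lemma cd_in [simp]: "f \<in> arr C Y X \<Longrightarrow> cd Y X f \<in> elts (rep X) Y"
  by (simp add: rep_elts)

lemma rep_add: "X \<in> Ob C \<Longrightarrow> Y \<in> Ob C \<Longrightarrow> f \<in> arr C Y X \<Longrightarrow> g \<in> arr C Y X \<Longrightarrow>
    cd Y X f \<oplus>\<^bsub>ob_map (rep X) Y\<^esub> cd Y X g = cd Y X (f \<oplus>\<^bsub>Hom C Y X\<^esub> g)"
  by (simp add: representable_def copy_space_def)

lemma rep_smult: "X \<in> Ob C \<Longrightarrow> Y \<in> Ob C \<Longrightarrow> f \<in> arr C Y X \<Longrightarrow>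
    a \<odot>\<^bsub>ob_map (rep X) Y\<^esub> cd Y X f = cd Y X (a \<odot>\<^bsub>Hom C Y X\<^esub> f)"
  by (simp add: representable_def copy_space_def)

lemma rep_zero: "\<zero>\<^bsub>ob_map (rep X) Y\<^esub> = cd Y X \<zero>\<^bsub>Hom C Y X\<^esub>"
  by (simp add: representable_def copy_space_def)

lemma rep_map: "X \<in> Ob C \<Longrightarrow> Y \<in> Ob C \<Longrightarrow> g \<in> arr C Y X \<Longrightarrow>
    hom_map (rep X) Y Y' f (cd Y X g) = cd Y' X (Comp C Y' Y X g f)"
  using cd_in[of g Y X] by (simp add: representable_def)

lemma rep_module: "X \<in> Ob C \<Longrightarrow> Y \<in> Ob C \<Longrightarrow> module K (ob_map (rep X) Y)"
  by (rule image_module[OF Hom_module[of Y X] rep_elts]) (simp_all add: rep_add rep_smult rep_zero)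

lemma smult_in [simp]: "X \<in> Ob C \<Longrightarrow> Y \<in> Ob C \<Longrightarrow> a \<in> carrier K \<Longrightarrow> f \<in> arr C X Y \<Longrightarrow> a \<odot>\<^bsub>Hom C X Y\<^esub> f \<in> arr C X Y"
  by (rule module.smult_closed[OF Hom_module])

lemma rep_Ob [simp]:
  assumes X: "X \<in> Ob C"
  shows "rep X \<in> Ob (Mod K C)"
proof (rule Mod_ObI)
  fix Y Z f assume *: "Y \<in> Ob C" "Z \<in> Ob C" "f \<in> arr C Y Z"
  show "hom_map (rep X) Z Y f \<in> extensional (elts (rep X) Z)" by (simp add: representable_def)
  show "linear_map K (ob_map (rep X) Z) (ob_map (rep X) Y) (hom_map (rep X) Z Y f)"
    by (rule linear_mapI)
       (auto elim!: rep_cases simp: * X rep_map rep_add rep_smult comp_add linear_smult[OF comp_linear_left])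
qed (auto elim!: rep_cases simp: X rep_module rep_map rep_add rep_smult comp_add linear_smult[OF comp_linear_right] comp_assoc)

text \<open>
  The morphism \<open>rep X \<rightarrow> F\<close> that corresponds to \<open>x \<in> F(X)\<close> under the Yoneda lemma.
\<close>

definition yon :: "('k, 'o, 'm, 'v) cmodule \<Rightarrow> 'o \<Rightarrow> 'v \<Rightarrow> 'o \<Rightarrow> 'v \<Rightarrow> 'v" where
  "yon F X x = nt C (rep X) (\<lambda>Y c. hom_map F X Y (dc Y X c) x)"

lemma yon_apply: "X \<in> Ob C \<Longrightarrow> Y \<in> Ob C \<Longrightarrow> f \<in> arr C Y X \<Longrightarrow> yon F X x Y (cd Y X f) = hom_map F X Y f x"
  by (simp add: yon_def)

lemma yon_in [simp]:
  assumes F: "F \<in> Ob (Mod K C)" and X: "X \<in> Ob C" and x: "x \<in> elts F X"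
  shows "yon F X x \<in> arr (Mod K C) (rep X) F"
  unfolding yon_def
proof (rule Mod_arrI[OF rep_Ob[OF X] F])
  fix Y assume Y: "Y \<in> Ob C"
  show "linear_map K (ob_map (rep X) Y) (ob_map F Y) (\<lambda>c. hom_map F X Y (dc Y X c) x)"
    by (rule linear_mapI)
       (auto elim!: rep_cases simp: X Y x rep_add rep_smult Mod_hom_in[OF F] Mod_hom_add[OF F] Mod_hom_smult[OF F])
next
  fix Y Z f c assume "Y \<in> Ob C" "Z \<in> Ob C" "f \<in> arr C Y Z" "c \<in> elts (rep X) Z"
  then show "hom_map F X Y (dc Y X (hom_map (rep X) Z Y f c)) x = hom_map F Z Y f (hom_map F X Z (dc Z X c) x)"
    by (auto elim!: rep_cases simp: X x rep_map Mod_hom_comp[OF F])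
qed

text \<open>
  The Yoneda lemma: by naturality a morphism on \<open>rep X\<close> is determined by its value at the identity.
\<close>

lemma arr_rep_apply:
  assumes \<alpha>: "\<alpha> \<in> arr (Mod K C) (rep X) F" and X: "X \<in> Ob C" and Y: "Y \<in> Ob C" and f: "f \<in> arr C Y X"
  shows "\<alpha> Y (cd Y X f) = hom_map F X Y f (\<alpha> X (cd X X (Ident C X)))"
  using Mod_arr_natural[OF \<alpha> Y X f, of "cd X X (Ident C X)"] X Y f by (simp add: rep_map)

lemma yon_ident [simp]: "F \<in> Ob (Mod K C) \<Longrightarrow> X \<in> Ob C \<Longrightarrow> x \<in> elts F X \<Longrightarrow> yon F X x X (cd X X (Ident C X)) = x"
  by (simp add: yon_apply Mod_hom_ident)

lemma arr_rep_eqI: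
  assumes \<alpha>: "\<alpha> \<in> arr (Mod K C) (rep X) F" and \<beta>: "\<beta> \<in> arr (Mod K C) (rep X) F" and X: "X \<in> Ob C"
    and eq: "\<alpha> X (cd X X (Ident C X)) = \<beta> X (cd X X (Ident C X))"
  shows "\<alpha> = \<beta>"
proof (rule Mod_arr_eqI[OF \<alpha> \<beta>])
  fix Y c assume "Y \<in> Ob C" "c \<in> elts (rep X) Y"
  then show "\<alpha> Y c = \<beta> Y c"
    by (auto elim!: rep_cases simp: arr_rep_apply[OF \<alpha> X] arr_rep_apply[OF \<beta> X] eq)
qed

lemma yon_unique:
  assumes \<alpha>: "\<alpha> \<in> arr (Mod K C) (rep X) F" and X: "X \<in> Ob C"
  shows "\<alpha> = yon F X (\<alpha> X (cd X X (Ident C X)))"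
  using assms Mod_arr_target[OF \<alpha>]
  by (intro arr_rep_eqI[OF \<alpha> _ X]) (simp_all add: Mod_arr_in[OF \<alpha>])

lemma yo_ob [simp]: "ob_map yo X = rep X"
  by (simp add: yoneda_def)

lemma yo_nt: "hom_map yo X X' g = nt C (rep X) (\<lambda>Y c. cd Y X' (Comp C Y X X' g (dc Y X c)))"
  by (simp add: yoneda_def nt_def representable_def)

lemma yo_apply:
  "X \<in> Ob C \<Longrightarrow> Y \<in> Ob C \<Longrightarrow> f \<in> arr C Y X \<Longrightarrow> hom_map yo X X' g Y (cd Y X f) = cd Y X' (Comp C Y X X' g f)"
  by (simp add: yo_nt)

lemma yo_in [simp]:
  assumes "X \<in> Ob C" "X' \<in> Ob C" "g \<in> arr C X X'"
  shows "hom_map yo X X' g \<in> arr (Mod K C) (rep X) (rep X')"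
  unfolding yo_nt
proof (rule Mod_arrI)
  fix Y assume Y: "Y \<in> Ob C"
  show "linear_map K (ob_map (rep X) Y) (ob_map (rep X') Y) (\<lambda>c. cd Y X' (Comp C Y X X' g (dc Y X c)))"
    by (rule linear_mapI)
       (auto elim!: rep_cases simp: assms Y rep_add rep_smult comp_add linear_smult[OF comp_linear_right])
next
  fix Y Z f c assume "Y \<in> Ob C" "Z \<in> Ob C" "f \<in> arr C Y Z" "c \<in> elts (rep X) Z"
  then show "cd Y X' (Comp C Y X X' g (dc Y X (hom_map (rep X) Z Y f c))) =
       hom_map (rep X') Z Y f (cd Z X' (Comp C Z X X' g (dc Z X c)))"
    by (auto elim!: rep_cases simp: assms rep_map comp_assoc)
qed (use assms in simp_all)

lemma yo_functor: "kfunctor K C (Mod K C) yo"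
proof -
  have "linear_map K (Hom C X X') (Hom (Mod K C) (rep X) (rep X')) (hom_map yo X X')"
    if [simp]: "X \<in> Ob C" "X' \<in> Ob C" for X X'
  proof (rule linear_mapI)
    fix g g' assume "g \<in> arr C X X'" "g' \<in> arr C X X'"
    then show "hom_map yo X X' (g \<oplus>\<^bsub>Hom C X X'\<^esub> g') =
        hom_map yo X X' g \<oplus>\<^bsub>Hom (Mod K C) (rep X) (rep X')\<^esub> hom_map yo X X' g'"
      by (intro arr_rep_eqI[of _ X "rep X'"]) (simp, simp, simp, simp add: Mod_add yo_apply rep_add)
  next
    fix a g assume "a \<in> carrier K" "g \<in> arr C X X'"
    then show "hom_map yo X X' (a \<odot>\<^bsub>Hom C X X'\<^esub> g) =
        a \<odot>\<^bsub>Hom (Mod K C) (rep X) (rep X')\<^esub> hom_map yo X X' g"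
      by (intro arr_rep_eqI[of _ X "rep X'"])
         (simp, simp add: module.smult_closed[OF Mod.Hom_module], simp, simp add: Mod_smult yo_apply rep_smult)
  qed simp
  moreover have "hom_map yo X X (Ident C X) = Ident (Mod K C) (rep X)" if "X \<in> Ob C" for X
    using that by (intro arr_rep_eqI[of _ X "rep X"]) (simp, simp, simp, simp add: Mod_Ident yo_apply)
  moreover have "hom_map yo X Z (Comp C X Y Z g f) = Comp (Mod K C) (rep X) (rep Y) (rep Z) (hom_map yo Y Z g) (hom_map yo X Y f)"
    if "X \<in> Ob C" "Y \<in> Ob C" "Z \<in> Ob C" "f \<in> arr C X Y" "g \<in> arr C Y Z" for X Y Z f g
    using that by (intro arr_rep_eqI[of _ X "rep Z"]) (simp, simp, simp, simp add: Mod_Comp yo_apply)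
  ultimately show ?thesis unfolding kfunctor_def by simp
qed

sublocale yo: linear_functor K C "Mod K C" yo
  by unfold_locales (rule yo_functor)

lemma yo_full:
  assumes \<alpha>: "\<alpha> \<in> arr (Mod K C) (rep X) (rep X')" and X: "X \<in> Ob C" "X' \<in> Ob C"
  obtains g where "g \<in> arr C X X'" "\<alpha> = hom_map yo X X' g"
proof -
  have "\<alpha> X (cd X X (Ident C X)) \<in> elts (rep X') X" using X by (simp add: Mod_arr_in[OF \<alpha>])
  then obtain g where g: "g \<in> arr C X X'" "\<alpha> X (cd X X (Ident C X)) = cd X X' g" by (rule rep_cases)
  have "\<alpha> = hom_map yo X X' g"
    using g X by (intro arr_rep_eqI[OF \<alpha> _ X(1)]) (simp_all add: yo_apply)
  with g(1) show ?thesis by (rule that)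
qed

lemma comp_yon:
  assumes "F \<in> Ob (Mod K C)" "X \<in> Ob C" "x \<in> elts F X" and \<alpha>: "\<alpha> \<in> arr (Mod K C) F G"
  shows "Comp (Mod K C) (rep X) F G \<alpha> (yon F X x) = yon G X (\<alpha> X x)"
  using assms Mod_arr_target[OF \<alpha>]
  by (intro arr_rep_eqI[of _ X G]) (simp, simp add: Mod_arr_in[OF \<alpha>], simp, simp add: Mod_arr_in[OF \<alpha>] Mod_Comp)

lemma yon_comp_yo:
  assumes "F \<in> Ob (Mod K C)" "X \<in> Ob C" "X' \<in> Ob C" "x \<in> elts F X" "g \<in> arr C X' X"
  shows "Comp (Mod K C) (rep X') (rep X) F (yon F X x) (hom_map yo X' X g) = yon F X' (hom_map F X X' g x)"
  using assms
  by (intro arr_rep_eqI[of _ X' F]) (simp, simp add: Mod_hom_in, simp, simp add: Mod_hom_in Mod_hom_ident Mod_Comp yo_apply yon_apply)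

end

section \<open>Finitely presented modules\<close>

lemma fp_mod_full_subcategory: "fp_mod K C = (Mod K C)\<lparr>Ob := Ob (fp_mod K C)\<rparr>"
  by (simp add: fp_mod_def)

lemma fp_mod_simps [simp]:
  "Hom (fp_mod K C) = Hom (Mod K C)" "Comp (fp_mod K C) = Comp (Mod K C)" "Ident (fp_mod K C) = Ident (Mod K C)"
  by (simp_all add: fp_mod_def)

lemma fp_mod_Ob_iff: "M \<in> Ob (fp_mod K C) \<longleftrightarrow> finitely_presented K C M"
  by (simp add: fp_mod_def)

lemma fp_mod_Ob_subset: "Ob (fp_mod K C) \<subseteq> Ob (Mod K C)"
  by (auto simp: fp_mod_def finitely_presented_def)

text \<open>By induction on the length, since an infinite set has the cardinality of its square.\<close>

lemma infinite_tuples: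
  assumes "infinite (UNIV :: 'v set)"
  shows "\<exists>f :: 'v list \<Rightarrow> 'v. inj_on f {xs. length xs = n}"
proof -
  obtain p :: "'v \<times> 'v \<Rightarrow> 'v" where p: "inj p"
    using ordIso_imp_ordLeq[OF card_of_Times_same_infinite[OF assms]]
    unfolding card_of_ordLeq[symmetric] by auto
  show ?thesis
  proof (induction n)
    case 0
    show ?case by (intro exI[of _ "\<lambda>_. undefined"]) (auto simp: inj_on_def)
  next
    case (Suc n)
    then obtain f :: "'v list \<Rightarrow> 'v" where f: "inj_on f {xs. length xs = n}" by blast
    have "inj_on (\<lambda>xs. p (hd xs, f (tl xs))) {xs. length xs = Suc n}"
    proof (rule inj_onI)
      fix xs ys :: "'v list" assume *: "xs \<in> {xs. length xs = Suc n}" "ys \<in> {xs. length xs = Suc n}"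
        and eq: "p (hd xs, f (tl xs)) = p (hd ys, f (tl ys))"
      have "hd xs = hd ys" "f (tl xs) = f (tl ys)" using injD[OF p eq] by auto
      then have "tl xs = tl ys" using inj_onD[OF f, of "tl xs" "tl ys"] * by simp
      then show "xs = ys" using \<open>hd xs = hd ys\<close> * by (cases xs; cases ys) auto
    qed
    then show ?case by blast
  qed
qed

context small_linear_category
begin

abbreviation fp :: "('k, ('k, 'o, 'm, 'v) cmodule, 'o \<Rightarrow> 'v \<Rightarrow> 'v) kcat" where "fp \<equiv> fp_mod K C"

lemma fp_Ob_Mod [simp]: "M \<in> Ob fp \<Longrightarrow> M \<in> Ob (Mod K C)"
  using fp_mod_Ob_subset by blast

sublocale fp: linear_category K fp
proof unfold_locales
  have "kcategory K ((Mod K C)\<lparr>Ob := Ob fp\<rparr>)"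
    by (rule full_subcategory[OF Mod_kcategory[OF cring] fp_mod_Ob_subset])
  then show "kcategory K fp" using fp_mod_full_subcategory by metis
qed

lemma fp_kernel: "is_kernel (Mod K C) F G f N i \<Longrightarrow> N \<in> Ob fp \<Longrightarrow> is_kernel fp F G f N i"
  using full_subcategory_kernel[OF _ fp_mod_Ob_subset] fp_mod_full_subcategory by metis

lemma fp_cokernel: "is_cokernel (Mod K C) F G f Q p \<Longrightarrow> Q \<in> Ob fp \<Longrightarrow> is_cokernel fp F G f Q p"
  using full_subcategory_cokernel[OF _ fp_mod_Ob_subset] fp_mod_full_subcategory by metis

text \<open>
  Direct factors are defined through direct sums of two modules. To see that a module is a direct
  factor of itself takes a zero module as the complement.
\<close>

definition zero_mod :: "('k, 'o, 'm, 'v) cmodule" where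
  "zero_mod = \<lparr>ob_map = (\<lambda>X. \<lparr>carrier = {undefined}, mult = undefined, one = undefined,
      zero = undefined, add = (\<lambda>x y. undefined), smult = (\<lambda>c x. undefined)\<rparr>),
    hom_map = (\<lambda>Y X f. \<lambda>x\<in>{undefined}. undefined)\<rparr>"

lemma zero_mod_simps [simp]:
  "elts zero_mod X = {undefined}" "x \<oplus>\<^bsub>ob_map zero_mod X\<^esub> y = undefined"
  "c \<odot>\<^bsub>ob_map zero_mod X\<^esub> x = undefined" "\<zero>\<^bsub>ob_map zero_mod X\<^esub> = undefined"
  "hom_map zero_mod Y X f = (\<lambda>x\<in>{undefined}. undefined)"
  by (simp_all add: zero_mod_def)

lemma zero_mod_Ob [simp]: "zero_mod \<in> Ob (Mod K C)"
proof (rule Mod_ObI)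
  fix X
  show "module K (ob_map zero_mod X)"
    by (rule moduleI[OF cring]) (auto intro!: abelian_groupI)
qed (auto intro!: linear_mapI)

lemma Mod_direct_sum_zero:
  assumes M [simp]: "M \<in> Ob (Mod K C)"
  shows "is_direct_sum (Mod K C) 2 (\<lambda>i. if i = 0 then M else zero_mod) M
    (\<lambda>i. if i = 0 then Ident (Mod K C) M else \<zero>\<^bsub>Hom (Mod K C) zero_mod M\<^esub>)
    (\<lambda>i. if i = 0 then Ident (Mod K C) M else \<zero>\<^bsub>Hom (Mod K C) M zero_mod\<^esub>)"
proof -
  have "Ident (Mod K C) zero_mod = \<zero>\<^bsub>Hom (Mod K C) zero_mod zero_mod\<^esub>"
    unfolding Mod_Ident Mod_zero by (rule nt_cong) simp
  then show ?thesis by (simp add: Mod.is_direct_sum_2_iff)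
qed

lemma fg_projective_rep:
  assumes X: "X \<in> Ob C"
  shows "fg_projective K C (rep X)"
proof -
  let ?id = "\<lambda>i :: nat. Ident (Mod K C) (rep X)"
  interpret H: abelian_group "Hom (Mod K C) (rep X) (rep X)" using X by simp
  have "is_direct_sum (Mod K C) 1 (\<lambda>i. rep X) (rep X) ?id ?id"
    unfolding is_direct_sum_def using X by (auto simp: lessThan_Suc)
  moreover have "direct_factor (Mod K C) (rep X) (rep X)"
    unfolding direct_factor_def using Mod_direct_sum_zero[OF rep_Ob[OF X]] by fastforce
  ultimately show ?thesis
    unfolding fg_projective_def using X by (intro exI conjI) auto
qed

text \<open>
  What matters of a direct factor of a sum of representables is only that its identity is a sum of
  endomorphisms factoring through representables.
\<close>

lemma fg_projective_retract:
  assumes "fg_projective K C M"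
  obtains n :: nat and X and a b where "M \<in> Ob (Mod K C)" "\<And>i. i < n \<Longrightarrow> X i \<in> Ob C"
    "\<And>i. i < n \<Longrightarrow> a i \<in> arr (Mod K C) (rep (X i)) M"
    "\<And>i. i < n \<Longrightarrow> b i \<in> arr (Mod K C) M (rep (X i))"
    "finsum (Hom (Mod K C) M M) (\<lambda>i. Comp (Mod K C) M (rep (X i)) M (a i) (b i)) {..<n} = Ident (Mod K C) M"
proof -
  obtain n X S \<iota> \<pi> where X: "\<forall>i<n. X i \<in> Ob C"
    and S: "is_direct_sum (Mod K C) n (\<lambda>i. rep (X i)) S \<iota> \<pi>"
    and df: "direct_factor (Mod K C) M S"
    using assms unfolding fg_projective_def by blast
  obtain Y \<iota>' \<pi>' where Y: "is_direct_sum (Mod K C) 2 Y S \<iota>' \<pi>'" "Y 0 = M"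
    using df unfolding direct_factor_def by blast
  have [simp]: "M \<in> Ob (Mod K C)" "S \<in> Ob (Mod K C)" "\<iota>' 0 \<in> arr (Mod K C) M S" "\<pi>' 0 \<in> arr (Mod K C) S M"
    and id: "Comp (Mod K C) M S M (\<pi>' 0) (\<iota>' 0) = Ident (Mod K C) M"
    using Y unfolding Mod.is_direct_sum_2_iff by auto
  have [simp]: "\<And>i. i < n \<Longrightarrow> X i \<in> Ob C" "\<And>i. i < n \<Longrightarrow> \<iota> i \<in> arr (Mod K C) (rep (X i)) S"
     "\<And>i. i < n \<Longrightarrow> \<pi> i \<in> arr (Mod K C) S (rep (X i))"
    and sum: "finsum (Hom (Mod K C) S S) (\<lambda>i. Comp (Mod K C) S (rep (X i)) S (\<iota> i) (\<pi> i)) {..<n} = Ident (Mod K C) S"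
    using S X unfolding is_direct_sum_def by auto
  let ?a = "\<lambda>i. Comp (Mod K C) (rep (X i)) S M (\<pi>' 0) (\<iota> i)"
  let ?b = "\<lambda>i. Comp (Mod K C) M S (rep (X i)) (\<pi> i) (\<iota>' 0)"
  let ?s = "\<lambda>i. Comp (Mod K C) S (rep (X i)) S (\<iota> i) (\<pi> i)"
  have "finsum (Hom (Mod K C) M M) (\<lambda>i. Comp (Mod K C) M (rep (X i)) M (?a i) (?b i)) {..<n} =
      finsum (Hom (Mod K C) M M) (\<lambda>i. Comp (Mod K C) M S M (\<pi>' 0) (Comp (Mod K C) M S S (?s i) (\<iota>' 0))) {..<n}"
    by (rule Mod.finsum_Hom_cong) (simp_all add: Mod.comp_assoc)
  also have "\<dots> = Comp (Mod K C) M S M (\<pi>' 0) (finsum (Hom (Mod K C) M S) (\<lambda>i. Comp (Mod K C) M S S (?s i) (\<iota>' 0)) {..<n})"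
    by (rule Mod.comp_finsum_right[symmetric]) simp_all
  also have "\<dots> = Comp (Mod K C) M S M (\<pi>' 0) (Comp (Mod K C) M S S (finsum (Hom (Mod K C) S S) ?s {..<n}) (\<iota>' 0))"
    by (subst Mod.comp_finsum_left) simp_all
  also have "\<dots> = Ident (Mod K C) M" by (simp add: sum id)
  finally show ?thesis by (intro that[of n X ?a ?b]) simp_all
qed

lemma fg_projective_fp:
  assumes "fg_projective K C M"
  shows "M \<in> Ob fp"
proof -
  have M: "M \<in> Ob (Mod K C)" using fg_projective_retract[OF assms] by blast
  have "Ident (Mod K C) M \<in> arr (Mod K C) M M" "\<zero>\<^bsub>Hom (Mod K C) M M\<^esub> \<in> arr (Mod K C) M M"
    using M by simp_all
  moreover have "\<zero>\<^bsub>Hom (Mod K C) M M\<^esub> X ` elts M X = {x \<in> elts M X. Ident (Mod K C) M X x = \<zero>\<^bsub>ob_map M X\<^esub>} \<and>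
      Ident (Mod K C) M X ` elts M X = elts M X" if X: "X \<in> Ob C" for X
  proof -
    have "\<zero>\<^bsub>ob_map M X\<^esub> \<in> elts M X"
      using abelian_groupE(2)[OF module_abelian_group[OF Mod_module[OF M X]]] .
    then show ?thesis using X by (auto simp: Mod_zero Mod_Ident image_iff)
  qed
  ultimately show ?thesis
    unfolding fp_mod_Ob_iff finitely_presented_def using assms M by blast
qed

lemma rep_fp [simp]: "X \<in> Ob C \<Longrightarrow> rep X \<in> Ob fp"
  by (rule fg_projective_fp[OF fg_projective_rep])

text \<open>
  The images of the identities of the \<open>X i\<close> generate a direct factor of the sum of the \<open>rep (X i)\<close>, hence
  also any quotient of it.
\<close>

lemma fp_generators:
  assumes "M \<in> Ob fp"
  obtains n :: nat and X x where
    "\<forall>N. \<forall>\<eta>\<in>arr (Mod K C) M N. \<forall>\<theta>\<in>arr (Mod K C) M N.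
       (\<forall>i<n. \<eta> (X i) (x i) = \<theta> (X i) (x i)) \<longrightarrow> \<eta> = \<theta>"
proof -
  obtain P1 P0 u q where "u \<in> arr (Mod K C) P1 P0" and q: "q \<in> arr (Mod K C) P0 M" and P0: "fg_projective K C P0"
    and *: "\<forall>X\<in>Ob C. u X ` elts P1 X = {x \<in> elts P0 X. q X x = \<zero>\<^bsub>ob_map M X\<^esub>} \<and> q X ` elts P0 X = elts M X"
    using assms unfolding fp_mod_Ob_iff finitely_presented_def
    by (elim conjE exE bexE) (rule that)
  have surj: "q X ` elts P0 X = elts M X" if "X \<in> Ob C" for X using * that by simp
  obtain n :: nat and X a b where P0M [simp]: "P0 \<in> Ob (Mod K C)" and X [simp]: "\<And>i. i < n \<Longrightarrow> X i \<in> Ob C"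
    and a [simp]: "\<And>i. i < n \<Longrightarrow> a i \<in> arr (Mod K C) (rep (X i)) P0"
    and b [simp]: "\<And>i. i < n \<Longrightarrow> b i \<in> arr (Mod K C) P0 (rep (X i))"
    and sum: "finsum (Hom (Mod K C) P0 P0) (\<lambda>i. Comp (Mod K C) P0 (rep (X i)) P0 (a i) (b i)) {..<n} = Ident (Mod K C) P0"
    by (rule fg_projective_retract[OF P0]) (rule that; assumption?; blast)
  have [simp]: "M \<in> Ob (Mod K C)" "q \<in> arr (Mod K C) P0 M" using q assms by simp_all
  let ?c = "\<lambda>i. a i (X i) (cd (X i) (X i) (Ident C (X i)))"
  show ?thesis
  proof (rule that[of n X "\<lambda>i. q (X i) (?c i)"], intro allI ballI impI)
    fix N \<eta> \<theta> assume \<eta>: "\<eta> \<in> arr (Mod K C) M N" and \<theta>: "\<theta> \<in> arr (Mod K C) M N"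
      and eq: "\<forall>i<n. \<eta> (X i) (q (X i) (?c i)) = \<theta> (X i) (q (X i) (?c i))"
    have N [simp]: "N \<in> Ob (Mod K C)" by (rule Mod_arr_target[OF \<eta>])
    let ?e = "\<lambda>\<eta>. Comp (Mod K C) P0 M N \<eta> q"
    have \<eta>q: "?e \<eta> \<in> arr (Mod K C) P0 N" and \<theta>q: "?e \<theta> \<in> arr (Mod K C) P0 N" using \<eta> \<theta> by simp_all
    have ea: "Comp (Mod K C) (rep (X i)) P0 N (?e \<eta>) (a i) = Comp (Mod K C) (rep (X i)) P0 N (?e \<theta>) (a i)" if i: "i < n" for i
    proof (rule arr_rep_eqI[of _ "X i" N])
      have "?c i \<in> elts P0 (X i)" by (rule Mod_arr_in[OF a[OF i]]) (use i in simp_all)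
      then show "Comp (Mod K C) (rep (X i)) P0 N (?e \<eta>) (a i) (X i) (cd (X i) (X i) (Ident C (X i))) =
          Comp (Mod K C) (rep (X i)) P0 N (?e \<theta>) (a i) (X i) (cd (X i) (X i) (Ident C (X i)))"
        using i eq by (simp add: Mod_Comp)
    qed (use i \<eta>q \<theta>q in simp_all)
    have dec: "t = finsum (Hom (Mod K C) P0 N) (\<lambda>i. Comp (Mod K C) P0 (rep (X i)) N (Comp (Mod K C) (rep (X i)) P0 N t (a i)) (b i)) {..<n}"
      if t: "t \<in> arr (Mod K C) P0 N" for t
    proof -
      have "t = Comp (Mod K C) P0 P0 N t (finsum (Hom (Mod K C) P0 P0) (\<lambda>i. Comp (Mod K C) P0 (rep (X i)) P0 (a i) (b i)) {..<n})"
        unfolding sum using t by simp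
      also have "\<dots> = finsum (Hom (Mod K C) P0 N) (\<lambda>i. Comp (Mod K C) P0 P0 N t (Comp (Mod K C) P0 (rep (X i)) P0 (a i) (b i))) {..<n}"
        by (rule Mod.comp_finsum_right) (use t in simp_all)
      also have "\<dots> = finsum (Hom (Mod K C) P0 N) (\<lambda>i. Comp (Mod K C) P0 (rep (X i)) N (Comp (Mod K C) (rep (X i)) P0 N t (a i)) (b i)) {..<n}"
        by (rule Mod.finsum_Hom_cong) (use t in \<open>simp_all add: Mod.comp_assoc\<close>)
      finally show ?thesis .
    qed
    let ?S = "\<lambda>t. finsum (Hom (Mod K C) P0 N) (\<lambda>i. Comp (Mod K C) P0 (rep (X i)) N (Comp (Mod K C) (rep (X i)) P0 N t (a i)) (b i)) {..<n}"
    have "?e \<eta> = ?S (?e \<eta>)" by (rule dec[OF \<eta>q])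
    also have "\<dots> = ?S (?e \<theta>)"
      by (rule Mod.finsum_Hom_cong) (use ea \<theta>q in simp_all)
    also have "\<dots> = ?e \<theta>" by (rule dec[OF \<theta>q, symmetric])
    finally have "?e \<eta> = ?e \<theta>" .
    then show "\<eta> = \<theta>"
    proof (intro Mod_arr_eqI[OF \<eta> \<theta>])
      fix Y y assume eq: "?e \<eta> = ?e \<theta>" and Y: "Y \<in> Ob C" "y \<in> elts M Y"
      then obtain p where p: "p \<in> elts P0 Y" "y = q Y p" using surj by (metis imageE)
      have "?e \<eta> Y p = ?e \<theta> Y p" by (simp add: eq)
      then show "\<eta> Y y = \<theta> Y y" using p Y by (simp add: Mod_Comp)
    qed
  qed
qed

text \<open>
  A morphism between finitely presented modules is encoded by the tuple of its values at finitely many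
  generators. Thus the Yoneda embedding makes sense for finitely presented modules, with values in
  the same universe.
\<close>

lemma fp_locally_small:
  assumes "infinite (UNIV :: 'v set)"
  shows "locally_small V fp"
  unfolding locally_small_def
proof (intro ballI)
  fix M N :: "('k, 'o, 'm, 'v) cmodule" assume M: "M \<in> Ob fp"
  obtain n :: nat and X x where
    det: "\<forall>N. \<forall>\<eta>\<in>arr (Mod K C) M N. \<forall>\<theta>\<in>arr (Mod K C) M N.
       (\<forall>i<n. \<eta> (X i) (x i) = \<theta> (X i) (x i)) \<longrightarrow> \<eta> = \<theta>"
    by (rule fp_generators[OF M])
  obtain f :: "'v list \<Rightarrow> 'v" where f: "inj_on f {xs. length xs = n}"
    using infinite_tuples[OF assms] by blast
  have "inj_on (\<lambda>\<eta>. f (map (\<lambda>i. \<eta> (X i) (x i)) [0..<n])) (arr fp M N)"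
  proof (rule inj_onI)
    fix \<eta> \<theta> assume *: "\<eta> \<in> arr fp M N" "\<theta> \<in> arr fp M N"
      and "f (map (\<lambda>i. \<eta> (X i) (x i)) [0..<n]) = f (map (\<lambda>i. \<theta> (X i) (x i)) [0..<n])"
    then have "map (\<lambda>i. \<eta> (X i) (x i)) [0..<n] = map (\<lambda>i. \<theta> (X i) (x i)) [0..<n]"
      by (intro inj_onD[OF f]) simp_all
    then have "\<forall>i<n. \<eta> (X i) (x i) = \<theta> (X i) (x i)" by simp
    then show "\<eta> = \<theta>" using det * by simp
  qed
  then show "\<exists>i :: ('o \<Rightarrow> 'v \<Rightarrow> 'v) \<Rightarrow> 'v. inj_on i (arr fp M N)" by blast
qed

end

section \<open>Modules over a category with direct sums\<close>

locale small_additive_category = small_linear_category K C V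
  for K :: "'k ring" and C :: "('k, 'o, 'm) kcat" and V :: "'v itself" +
  assumes nonempty: "Ob C \<noteq> {}"
    and direct_sums: "X \<in> Ob C \<Longrightarrow> Y \<in> Ob C \<Longrightarrow>
      \<exists>S \<iota> \<pi>. is_direct_sum C 2 (\<lambda>i. if i = 0 then X else Y) S \<iota> \<pi>"
begin

lemma direct_sum:
  assumes "X \<in> Ob C" "Y \<in> Ob C"
  obtains S i0 i1 p0 p1 where "S \<in> Ob C" "i0 \<in> arr C X S" "i1 \<in> arr C Y S" "p0 \<in> arr C S X" "p1 \<in> arr C S Y"
    "Comp C X S X p0 i0 = Ident C X" "Comp C Y S Y p1 i1 = Ident C Y"
    "Comp C X S Y p1 i0 = \<zero>\<^bsub>Hom C X Y\<^esub>" "Comp C Y S X p0 i1 = \<zero>\<^bsub>Hom C Y X\<^esub>"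
    "Comp C S X S i0 p0 \<oplus>\<^bsub>Hom C S S\<^esub> Comp C S Y S i1 p1 = Ident C S"
proof -
  obtain S \<iota> \<pi> where "is_direct_sum C 2 (\<lambda>i. if i = 0 then X else Y) S \<iota> \<pi>"
    using direct_sums[OF assms] by blast
  then show ?thesis
    unfolding is_direct_sum_2_iff by (intro that[of S "\<iota> 0" "\<iota> 1" "\<pi> 0" "\<pi> 1"]) simp_all
qed

text \<open>
  With direct sums at hand, a finitely generated projective module is a retract of a single
  representable.
\<close>

lemma finsum_factors_through_rep:
  assumes M [simp]: "M \<in> Ob (Mod K C)"
  shows "(\<forall>i<n::nat. X i \<in> Ob C \<and> a i \<in> arr (Mod K C) (rep (X i)) M \<and> b i \<in> arr (Mod K C) M (rep (X i))) \<Longrightarrow>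
    \<exists>Y\<in>Ob C. \<exists>c\<in>arr (Mod K C) (rep Y) M. \<exists>d\<in>arr (Mod K C) M (rep Y).
      Comp (Mod K C) M (rep Y) M c d =
      finsum (Hom (Mod K C) M M) (\<lambda>i. Comp (Mod K C) M (rep (X i)) M (a i) (b i)) {..<n}"
proof (induction n)
  case 0
  obtain Y where Y [simp]: "Y \<in> Ob C" using nonempty by blast
  interpret H: abelian_group "Hom (Mod K C) M M" by simp
  show ?case
    by (rule bexI[of _ Y], rule bexI[of _ "\<zero>\<^bsub>Hom (Mod K C) (rep Y) M\<^esub>"],
        rule bexI[of _ "\<zero>\<^bsub>Hom (Mod K C) M (rep Y)\<^esub>"]) simp_all
next
  case (Suc n)
  then obtain Y c d where Y [simp]: "Y \<in> Ob C" "c \<in> arr (Mod K C) (rep Y) M" "d \<in> arr (Mod K C) M (rep Y)"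
    and cd: "Comp (Mod K C) M (rep Y) M c d =
      finsum (Hom (Mod K C) M M) (\<lambda>i. Comp (Mod K C) M (rep (X i)) M (a i) (b i)) {..<n}"
    by (auto simp: less_Suc_eq)
  have [simp]: "X n \<in> Ob C" "a n \<in> arr (Mod K C) (rep (X n)) M" "b n \<in> arr (Mod K C) M (rep (X n))"
    using Suc.prems by auto
  obtain S i0 i1 p0 p1 where S [simp]: "S \<in> Ob C" "i0 \<in> arr C Y S" "i1 \<in> arr C (X n) S" "p0 \<in> arr C S Y" "p1 \<in> arr C S (X n)"
    and pi: "Comp C Y S Y p0 i0 = Ident C Y" "Comp C (X n) S (X n) p1 i1 = Ident C (X n)"
    "Comp C Y S (X n) p1 i0 = \<zero>\<^bsub>Hom C Y (X n)\<^esub>" "Comp C (X n) S Y p0 i1 = \<zero>\<^bsub>Hom C (X n) Y\<^esub>"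
    by (rule direct_sum[OF Y(1) \<open>X n \<in> Ob C\<close>])
  let ?I0 = "hom_map yo Y S i0" and ?I1 = "hom_map yo (X n) S i1"
    and ?P0 = "hom_map yo S Y p0" and ?P1 = "hom_map yo S (X n) p1"
  let ?h = "Comp (Mod K C)"
  have PI: "?h (rep Y) (rep S) (rep Y) ?P0 ?I0 = Ident (Mod K C) (rep Y)"
    "?h (rep (X n)) (rep S) (rep (X n)) ?P1 ?I1 = Ident (Mod K C) (rep (X n))"
    "?h (rep Y) (rep S) (rep (X n)) ?P1 ?I0 = \<zero>\<^bsub>Hom (Mod K C) (rep Y) (rep (X n))\<^esub>"
    "?h (rep (X n)) (rep S) (rep Y) ?P0 ?I1 = \<zero>\<^bsub>Hom (Mod K C) (rep (X n)) (rep Y)\<^esub>"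
    using yo.map_comp[of Y S Y i0 p0] yo.map_comp[of "X n" S "X n" i1 p1]
      yo.map_comp[of Y S "X n" i0 p1] yo.map_comp[of "X n" S Y i1 p0]
      yo.map_ident yo.map_zero by (simp_all add: pi)
  let ?c = "?h (rep S) (rep Y) M c ?P0 \<oplus>\<^bsub>Hom (Mod K C) (rep S) M\<^esub> ?h (rep S) (rep (X n)) M (a n) ?P1"
  let ?d = "?h M (rep Y) (rep S) ?I0 d \<oplus>\<^bsub>Hom (Mod K C) M (rep S)\<^esub> ?h M (rep (X n)) (rep S) ?I1 (b n)"
  have c0: "?h (rep Y) (rep S) M ?c ?I0 = c" and c1: "?h (rep (X n)) (rep S) M ?c ?I1 = a n"
    by (simp_all add: Mod.comp_add Mod.comp_assoc PI)
  have "?h M (rep S) M ?c ?d = ?h M (rep Y) M (?h (rep Y) (rep S) M ?c ?I0) d \<oplus>\<^bsub>Hom (Mod K C) M M\<^esub>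
      ?h M (rep (X n)) M (?h (rep (X n)) (rep S) M ?c ?I1) (b n)"
    by (simp add: Mod.comp_add(1) Mod.comp_assoc[of M _ "rep S" M])
  also have "\<dots> = finsum (Hom (Mod K C) M M) (\<lambda>i. ?h M (rep (X i)) M (a i) (b i)) {..<Suc n}"
  proof -
    interpret H: abelian_group "Hom (Mod K C) M M" by simp
    have fin: "(\<lambda>i. ?h M (rep (X i)) M (a i) (b i)) \<in> {..<n} \<rightarrow> arr (Mod K C) M M"
      using Suc.prems by auto
    show ?thesis
      unfolding c0 c1 cd lessThan_Suc using fin
      by (subst H.finsum_insert) (simp_all add: H.a_comm H.finsum_closed)
  qed
  finally have "?h M (rep S) M ?c ?d = \<dots>" .
  moreover have "?c \<in> arr (Mod K C) (rep S) M" "?d \<in> arr (Mod K C) M (rep S)" by simp_all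
  ultimately show ?case using S(1) by blast
qed

lemma fg_projective_rep_retract:
  assumes "fg_projective K C M"
  obtains Y c d where "Y \<in> Ob C" "c \<in> arr (Mod K C) (rep Y) M" "d \<in> arr (Mod K C) M (rep Y)"
    "Comp (Mod K C) M (rep Y) M c d = Ident (Mod K C) M"
proof -
  obtain n :: nat and X a b where M: "M \<in> Ob (Mod K C)" and X: "\<And>i. i < n \<Longrightarrow> X i \<in> Ob C"
    and a: "\<And>i. i < n \<Longrightarrow> a i \<in> arr (Mod K C) (rep (X i)) M"
    and b: "\<And>i. i < n \<Longrightarrow> b i \<in> arr (Mod K C) M (rep (X i))"
    and sum: "finsum (Hom (Mod K C) M M) (\<lambda>i. Comp (Mod K C) M (rep (X i)) M (a i) (b i)) {..<n} = Ident (Mod K C) M"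
    by (rule fg_projective_retract[OF assms]) (rule that; assumption?; blast)
  have "\<forall>i<n. X i \<in> Ob C \<and> a i \<in> arr (Mod K C) (rep (X i)) M \<and> b i \<in> arr (Mod K C) M (rep (X i))"
    using X a b by blast
  from finsum_factors_through_rep[OF M this] show ?thesis unfolding sum using that by blast
qed

text \<open>
  The module \<open>F\<close> is the cokernel of \<open>C(?, X) \<rightarrow> C(?, Y)\<close> induced by \<open>k\<close>, where \<open>e\<close> is
  the class of the identity of \<open>Y\<close>.
\<close>

definition presented :: "('k, 'o, 'm, 'v) cmodule \<Rightarrow> 'o \<Rightarrow> 'v \<Rightarrow> 'o \<Rightarrow> 'm \<Rightarrow> bool" where
  "presented F Y e X k \<longleftrightarrow>
     F \<in> Ob (Mod K C) \<and> Y \<in> Ob C \<and> e \<in> elts F Y \<and> X \<in> Ob C \<and> k \<in> arr C X Y \<and>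
     (\<forall>T\<in>Ob C. \<forall>x\<in>elts F T. \<exists>h\<in>arr C T Y. hom_map F Y T h e = x) \<and>
     (\<forall>T\<in>Ob C. \<forall>h\<in>arr C T Y. hom_map F Y T h e = \<zero>\<^bsub>ob_map F T\<^esub> \<longleftrightarrow> (\<exists>l\<in>arr C T X. Comp C T X Y k l = h))"

lemma presented_fp:
  assumes "presented F Y e X k"
  shows "F \<in> Ob fp"
proof -
  have F [simp]: "F \<in> Ob (Mod K C)" and [simp]: "Y \<in> Ob C" "e \<in> elts F Y" "X \<in> Ob C" "k \<in> arr C X Y"
    and gen: "\<And>T x. T \<in> Ob C \<Longrightarrow> x \<in> elts F T \<Longrightarrow> \<exists>h\<in>arr C T Y. hom_map F Y T h e = x"
    and rel: "\<And>T h. T \<in> Ob C \<Longrightarrow> h \<in> arr C T Y \<Longrightarrow> hom_map F Y T h e = \<zero>\<^bsub>ob_map F T\<^esub> \<longleftrightarrow> (\<exists>l\<in>arr C T X. Comp C T X Y k l = h)"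
    using assms unfolding presented_def by blast+
  have exact: "hom_map yo X Y k T ` elts (rep X) T = {x \<in> elts (rep Y) T. yon F Y e T x = \<zero>\<^bsub>ob_map F T\<^esub>} \<and>
     yon F Y e T ` elts (rep Y) T = elts F T" if T [simp]: "T \<in> Ob C" for T
  proof (intro conjI equalityI subsetI)
    fix x assume "x \<in> hom_map yo X Y k T ` elts (rep X) T"
    then obtain l where l: "l \<in> arr C T X" "x = cd T Y (Comp C T X Y k l)"
      by (auto elim!: rep_cases simp: yo_apply)
    then show "x \<in> {x \<in> elts (rep Y) T. yon F Y e T x = \<zero>\<^bsub>ob_map F T\<^esub>}"
      by (auto simp: yon_apply rel)
  next
    fix x assume "x \<in> {x \<in> elts (rep Y) T. yon F Y e T x = \<zero>\<^bsub>ob_map F T\<^esub>}"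
    then obtain h where h: "h \<in> arr C T Y" "x = cd T Y h" "hom_map F Y T h e = \<zero>\<^bsub>ob_map F T\<^esub>"
      by (auto elim!: rep_cases simp: yon_apply)
    then obtain l where "l \<in> arr C T X" "Comp C T X Y k l = h" using rel by auto
    then show "x \<in> hom_map yo X Y k T ` elts (rep X) T"
      using h by (intro image_eqI[of _ _ "cd T X l"]) (simp_all add: yo_apply)
  next
    fix x assume "x \<in> yon F Y e T ` elts (rep Y) T"
    then show "x \<in> elts F T" by (auto elim!: rep_cases simp: yon_apply Mod_hom_in)
  next
    fix x assume "x \<in> elts F T"
    then obtain h where "h \<in> arr C T Y" "hom_map F Y T h e = x" using gen[OF T] by blast
    then show "x \<in> yon F Y e T ` elts (rep Y) T"
      by (intro image_eqI[of _ _ "cd T Y h"]) (simp_all add: yon_apply)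
  qed
  show ?thesis
    unfolding fp_mod_Ob_iff finitely_presented_def
    by (intro conjI exI[of _ "rep X"] exI[of _ "rep Y"] bexI[of _ "hom_map yo X Y k"]
        bexI[of _ "yon F Y e"] ballI exact) (simp_all add: fg_projective_rep exact)
qed

text \<open>
  Let \<open>P1 \<rightarrow> P0 \<rightarrow> F \<rightarrow> 0\<close> be exact, with \<open>P1\<close> a retract of \<open>rep Y1\<close> and \<open>P0\<close> a retract of \<open>rep Y0\<close>. Then
  \<open>rep Y0 \<rightarrow> P0 \<rightarrow> F\<close> is surjective. Its kernel is generated by the image of \<open>rep Y1\<close> and by the complement
  of \<open>P0\<close> in \<open>rep Y0\<close>, that is by the image of \<open>1 - b0 a0\<close>. So \<open>Y1 \<oplus> Y0\<close> supplies the relations.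
\<close>

lemma fp_presented:
  assumes "F \<in> Ob fp"
  obtains Y e X k where "presented F Y e X k"
proof -
  obtain P1 P0 u q where u [simp]: "u \<in> arr (Mod K C) P1 P0" and q [simp]: "q \<in> arr (Mod K C) P0 F"
    and P: "fg_projective K C P1" "fg_projective K C P0"
    and *: "\<forall>X\<in>Ob C. u X ` elts P1 X = {x \<in> elts P0 X. q X x = \<zero>\<^bsub>ob_map F X\<^esub>} \<and> q X ` elts P0 X = elts F X"
    using assms unfolding fp_mod_Ob_iff finitely_presented_def
    by (elim conjE exE bexE) (rule that)
  have ker: "u T ` elts P1 T = {x \<in> elts P0 T. q T x = \<zero>\<^bsub>ob_map F T\<^esub>}"
    and surj: "q T ` elts P0 T = elts F T" if "T \<in> Ob C" for T using * that by simp_all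
  note F = Mod_arr_target[OF q] and P0 = Mod_arr_source[OF q] and P1 = Mod_arr_source[OF u]
  note [simp] = F P0 P1
  obtain Y1 a1 b1 where 1 [simp]: "Y1 \<in> Ob C" "a1 \<in> arr (Mod K C) (rep Y1) P1" "b1 \<in> arr (Mod K C) P1 (rep Y1)"
    and ab1: "Comp (Mod K C) P1 (rep Y1) P1 a1 b1 = Ident (Mod K C) P1"
    by (rule fg_projective_rep_retract[OF P(1)])
  obtain Y0 a0 b0 where 0 [simp]: "Y0 \<in> Ob C" "a0 \<in> arr (Mod K C) (rep Y0) P0" "b0 \<in> arr (Mod K C) P0 (rep Y0)"
    and ab0: "Comp (Mod K C) P0 (rep Y0) P0 a0 b0 = Ident (Mod K C) P0"
    by (rule fg_projective_rep_retract[OF P(2)])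
  have ab1': "a1 T (b1 T x) = x" if "T \<in> Ob C" "x \<in> elts P1 T" for T x
    using fun_cong[OF fun_cong[OF ab1, of T], of x] that by (simp add: Mod_Comp Mod_Ident)
  have ab0': "a0 T (b0 T x) = x" if "T \<in> Ob C" "x \<in> elts P0 T" for T x
    using fun_cong[OF fun_cong[OF ab0, of T], of x] that by (simp add: Mod_Comp Mod_Ident)
  note inn = Mod_arr_in[OF u] Mod_arr_in[OF q] Mod_arr_in[OF 1(2)] Mod_arr_in[OF 1(3)] Mod_arr_in[OF 0(2)] Mod_arr_in[OF 0(3)]
  let ?i0 = "cd Y0 Y0 (Ident C Y0)"
  define e where "e = q Y0 (a0 Y0 ?i0)"
  have e [simp]: "e \<in> elts F Y0" by (simp add: e_def inn)
  have act: "hom_map F Y0 T h e = q T (a0 T (cd T Y0 h))" if "T \<in> Ob C" "h \<in> arr C T Y0" for T h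
  proof -
    have "hom_map F Y0 T h e = q T (hom_map P0 Y0 T h (a0 Y0 ?i0))"
      unfolding e_def by (rule Mod_arr_natural[OF q, symmetric]) (use that in \<open>simp_all add: inn\<close>)
    then show ?thesis by (simp only: arr_rep_apply[OF 0(2,1) that])
  qed
  \<comment> \<open>the morphisms of \<open>C\<close> that represent \<open>b0 u a1\<close> and \<open>b0 a0\<close>\<close>
  obtain k1 where k1 [simp]: "k1 \<in> arr C Y1 Y0" and k1': "Comp (Mod K C) (rep Y1) P0 (rep Y0) b0 (Comp (Mod K C) (rep Y1) P1 P0 u a1) = hom_map yo Y1 Y0 k1"
    by (rule yo_full[of "Comp (Mod K C) (rep Y1) P0 (rep Y0) b0 (Comp (Mod K C) (rep Y1) P1 P0 u a1)" Y1 Y0]) simp_all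
  obtain c where c [simp]: "c \<in> arr C Y0 Y0" and c': "Comp (Mod K C) (rep Y0) P0 (rep Y0) b0 a0 = hom_map yo Y0 Y0 c"
    by (rule yo_full[of "Comp (Mod K C) (rep Y0) P0 (rep Y0) b0 a0" Y0 Y0]) simp_all
  have k1a: "b0 T (u T (a1 T (cd T Y1 m))) = cd T Y0 (Comp C T Y1 Y0 k1 m)" if "T \<in> Ob C" "m \<in> arr C T Y1" for T m
    using fun_cong[OF fun_cong[OF k1', of T], of "cd T Y1 m"] that by (simp add: Mod_Comp yo_apply)
  have ca: "b0 T (a0 T (cd T Y0 h)) = cd T Y0 (Comp C T Y0 Y0 c h)" if "T \<in> Ob C" "h \<in> arr C T Y0" for T h
    using fun_cong[OF fun_cong[OF c', of T], of "cd T Y0 h"] that by (simp add: Mod_Comp yo_apply)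
  define k0 where "k0 = Ident C Y0 \<ominus>\<^bsub>Hom C Y0 Y0\<^esub> c"
  have k0 [simp]: "k0 \<in> arr C Y0 Y0" by (simp add: k0_def)
  obtain S i1 i0 p1 p0 where S [simp]: "S \<in> Ob C" "i1 \<in> arr C Y1 S" "i0 \<in> arr C Y0 S" "p1 \<in> arr C S Y1" "p0 \<in> arr C S Y0"
    and pi: "Comp C Y1 S Y1 p1 i1 = Ident C Y1" "Comp C Y0 S Y0 p0 i0 = Ident C Y0"
    "Comp C Y1 S Y0 p0 i1 = \<zero>\<^bsub>Hom C Y1 Y0\<^esub>" "Comp C Y0 S Y1 p1 i0 = \<zero>\<^bsub>Hom C Y0 Y1\<^esub>"
    by (rule direct_sum[OF 1(1) 0(1)])
  define k where "k = Comp C S Y1 Y0 k1 p1 \<oplus>\<^bsub>Hom C S Y0\<^esub> Comp C S Y0 Y0 k0 p0"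
  have k [simp]: "k \<in> arr C S Y0" by (simp add: k_def)
  have ki: "Comp C Y1 S Y0 k i1 = k1" "Comp C Y0 S Y0 k i0 = k0"
    by (simp_all add: k_def comp_add comp_assoc pi)
  have zero: "hom_map F Y0 S k e = \<zero>\<^bsub>ob_map F S\<^esub>"
  proof -
    have "hom_map F Y0 Y1 k1 e = q Y1 (a0 Y1 (b0 Y1 (u Y1 (a1 Y1 (cd Y1 Y1 (Ident C Y1))))))"
      by (simp add: act k1a)
    also have "\<dots> = q Y1 (u Y1 (a1 Y1 (cd Y1 Y1 (Ident C Y1))))" by (simp add: ab0' inn)
    also have "\<dots> = \<zero>\<^bsub>ob_map F Y1\<^esub>"
    proof -
      have "u Y1 (a1 Y1 (cd Y1 Y1 (Ident C Y1))) \<in> u Y1 ` elts P1 Y1" by (simp add: inn)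
      then show ?thesis by (simp add: ker)
    qed
    finally have z1: "hom_map F Y0 Y1 k1 e = \<zero>\<^bsub>ob_map F Y1\<^esub>" .
    have "hom_map F Y0 Y0 c e = q Y0 (a0 Y0 (b0 Y0 (a0 Y0 ?i0)))" by (simp add: act ca)
    also have "\<dots> = e" by (simp add: ab0' inn e_def)
    finally have ce: "hom_map F Y0 Y0 c e = e" .
    have lin: "linear_map K (Hom C Y0 Y0) (ob_map F Y0) (\<lambda>g. hom_map F Y0 Y0 g e)"
      by (rule linear_mapI) (simp_all add: Mod_hom_in[OF F] Mod_hom_add[OF F] Mod_hom_smult[OF F])
    have "hom_map F Y0 Y0 k0 e = e \<ominus>\<^bsub>ob_map F Y0\<^esub> e"
      using linear_diff[OF lin _ _ ident_in c] Mod_module[OF F] by (simp add: k0_def ce Mod_hom_ident[OF F])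
    also have "\<dots> = \<zero>\<^bsub>ob_map F Y0\<^esub>"
      using module_abelian_group[OF Mod_module[OF F 0(1)]] by (simp add: a_minus_def abelian_group.r_neg)
    finally have z0: "hom_map F Y0 Y0 k0 e = \<zero>\<^bsub>ob_map F Y0\<^esub>" .
    have "hom_map F Y0 S k e = hom_map F Y1 S p1 (hom_map F Y0 Y1 k1 e) \<oplus>\<^bsub>ob_map F S\<^esub> hom_map F Y0 S p0 (hom_map F Y0 Y0 k0 e)"
      by (simp add: k_def Mod_hom_add[OF F] Mod_hom_comp[OF F])
    also have "\<dots> = \<zero>\<^bsub>ob_map F S\<^esub>"
      unfolding z0 z1
      using linear_zero[OF Mod_hom_linear[OF F]] Mod_module[OF F]
      by (simp add: abelian_monoid.r_zero[OF abelian_group.axioms(1)[OF module_abelian_group[OF Mod_module[OF F]]]]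
        abelian_groupE(2)[OF module_abelian_group[OF Mod_module[OF F]]])
    finally show ?thesis .
  qed
  have "presented F Y0 e S k"
    unfolding presented_def
  proof (intro conjI ballI)
    fix T x assume T: "T \<in> Ob C" "x \<in> elts F T"
    then obtain p where p: "p \<in> elts P0 T" "x = q T p" using surj by (metis imageE)
    have "b0 T p \<in> elts (rep Y0) T" using p T by (simp add: inn)
    then obtain h where h: "h \<in> arr C T Y0" "b0 T p = cd T Y0 h" by (rule rep_cases)
    have "hom_map F Y0 T h e = x" using act[OF T(1) h(1)] h(2)[symmetric] p T by (simp add: ab0')
    then show "\<exists>h\<in>arr C T Y0. hom_map F Y0 T h e = x" using h by blast
  next
    fix T h assume T [simp]: "T \<in> Ob C" and h [simp]: "h \<in> arr C T Y0"
    show "hom_map F Y0 T h e = \<zero>\<^bsub>ob_map F T\<^esub> \<longleftrightarrow> (\<exists>l\<in>arr C T S. Comp C T S Y0 k l = h)"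
    proof
      assume "\<exists>l\<in>arr C T S. Comp C T S Y0 k l = h"
      then obtain l where l: "l \<in> arr C T S" "h = Comp C T S Y0 k l" by auto
      then have "hom_map F Y0 T h e = hom_map F S T l (hom_map F Y0 S k e)" by (simp add: Mod_hom_comp[OF F])
      also have "\<dots> = \<zero>\<^bsub>ob_map F T\<^esub>"
        unfolding zero using l linear_zero[OF Mod_hom_linear[OF F]] Mod_module[OF F] by simp
      finally show "hom_map F Y0 T h e = \<zero>\<^bsub>ob_map F T\<^esub>" .
    next
      assume "hom_map F Y0 T h e = \<zero>\<^bsub>ob_map F T\<^esub>"
      then have "a0 T (cd T Y0 h) \<in> u T ` elts P1 T" by (simp add: act ker inn)
      then obtain p where p: "p \<in> elts P1 T" "a0 T (cd T Y0 h) = u T p" by blast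
      have "b1 T p \<in> elts (rep Y1) T" using p by (simp add: inn)
      then obtain m where m: "m \<in> arr C T Y1" "b1 T p = cd T Y1 m" by (rule rep_cases)
      have "cd T Y0 (Comp C T Y0 Y0 c h) = b0 T (u T (a1 T (b1 T p)))"
        using p ca[of T h] by (simp add: ab1')
      also have "\<dots> = cd T Y0 (Comp C T Y1 Y0 k1 m)" using m by (simp add: k1a)
      finally have ch: "Comp C T Y0 Y0 c h = Comp C T Y1 Y0 k1 m" using m by (simp add: cd_eq_iff)
      let ?l = "Comp C T Y0 S i0 h \<oplus>\<^bsub>Hom C T S\<^esub> Comp C T Y1 S i1 m"
      have "Comp C T S Y0 k ?l = Comp C T Y0 Y0 (Comp C Y0 S Y0 k i0) h \<oplus>\<^bsub>Hom C T Y0\<^esub> Comp C T Y1 Y0 (Comp C Y1 S Y0 k i1) m"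
        using m by (simp add: comp_add comp_assoc)
      also have "\<dots> = (h \<ominus>\<^bsub>Hom C T Y0\<^esub> Comp C T Y0 Y0 c h) \<oplus>\<^bsub>Hom C T Y0\<^esub> Comp C T Y0 Y0 c h"
        unfolding ki using m by (simp add: k0_def comp_diff ch)
      also have "\<dots> = h" by (simp add: diff_add_cancel)
      finally show "\<exists>l\<in>arr C T S. Comp C T S Y0 k l = h" using m by (intro bexI[of _ ?l]) simp_all
    qed
  qed simp_all
  then show ?thesis by (rule that)
qed

text \<open>
  If \<open>G\<close> is presented by \<open>k' : X' \<rightarrow> Y'\<close> and \<open>F\<close> is generated by an element at \<open>Y\<close>, then the cokernel of
  \<open>\<alpha> : F \<rightarrow> G\<close> has, in addition to the relations of \<open>G\<close>, the one that kills the image of the generator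
  of \<open>F\<close>. It is presented by the morphism \<open>X' \<oplus> Y \<rightarrow> Y'\<close> whose second component \<open>h\<close> represents this image.
\<close>

lemma fp_quotient:
  assumes F: "F \<in> Ob fp" and G: "G \<in> Ob fp" and \<alpha>: "\<alpha> \<in> arr (Mod K C) F G"
  obtains Q p where "Q \<in> Ob fp" "p \<in> arr (Mod K C) G Q"
    "\<And>X. X \<in> Ob C \<Longrightarrow> p X ` elts G X = elts Q X"
    "\<And>X. X \<in> Ob C \<Longrightarrow> {y \<in> elts G X. p X y = \<zero>\<^bsub>ob_map Q X\<^esub>} = \<alpha> X ` elts F X"
proof -
  obtain Q :: "('k, 'o, 'm, 'v) cmodule" and p where p: "p \<in> arr (Mod K C) G Q"
    and surj: "\<And>X. X \<in> Ob C \<Longrightarrow> p X ` elts G X = elts Q X"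
    and ker: "\<And>X. X \<in> Ob C \<Longrightarrow> {y \<in> elts G X. p X y = \<zero>\<^bsub>ob_map Q X\<^esub>} = \<alpha> X ` elts F X"
    by (rule Mod_quotient[OF \<alpha>]) (rule that; assumption?; blast)
  have Q: "Q \<in> Ob (Mod K C)" by (rule Mod_arr_target[OF p])
  obtain Y e X k where "presented F Y e X k" by (rule fp_presented[OF F])
  then have FM: "F \<in> Ob (Mod K C)" and [simp]: "Y \<in> Ob C" and e: "e \<in> elts F Y"
    and genF: "\<And>T x. T \<in> Ob C \<Longrightarrow> x \<in> elts F T \<Longrightarrow> \<exists>h\<in>arr C T Y. hom_map F Y T h e = x"
    unfolding presented_def by blast+
  obtain Y' e' X' k' where "presented G Y' e' X' k'" by (rule fp_presented[OF G])
  then have GM: "G \<in> Ob (Mod K C)" and [simp]: "Y' \<in> Ob C" "X' \<in> Ob C" "k' \<in> arr C X' Y'"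
    and e': "e' \<in> elts G Y'"
    and genG: "\<And>T x. T \<in> Ob C \<Longrightarrow> x \<in> elts G T \<Longrightarrow> \<exists>h\<in>arr C T Y'. hom_map G Y' T h e' = x"
    and relG: "\<And>T h. T \<in> Ob C \<Longrightarrow> h \<in> arr C T Y' \<Longrightarrow> hom_map G Y' T h e' = \<zero>\<^bsub>ob_map G T\<^esub> \<longleftrightarrow> (\<exists>l\<in>arr C T X'. Comp C T X' Y' k' l = h)"
    unfolding presented_def by blast+
  note [simp] = e e'
  obtain h where h [simp]: "h \<in> arr C Y Y'" and he: "hom_map G Y' Y h e' = \<alpha> Y e"
    using genG[of Y "\<alpha> Y e"] Mod_arr_in[OF \<alpha>] by auto
  obtain S i0 i1 p0 p1 where S [simp]: "S \<in> Ob C" "i0 \<in> arr C X' S" "i1 \<in> arr C Y S" "p0 \<in> arr C S X'" "p1 \<in> arr C S Y"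
    and pi: "Comp C X' S X' p0 i0 = Ident C X'" "Comp C Y S Y p1 i1 = Ident C Y"
    "Comp C X' S Y p1 i0 = \<zero>\<^bsub>Hom C X' Y\<^esub>" "Comp C Y S X' p0 i1 = \<zero>\<^bsub>Hom C Y X'\<^esub>"
    and ip: "Comp C S X' S i0 p0 \<oplus>\<^bsub>Hom C S S\<^esub> Comp C S Y S i1 p1 = Ident C S"
    by (rule direct_sum[OF \<open>X' \<in> Ob C\<close> \<open>Y \<in> Ob C\<close>])
  define k where "k = Comp C S X' Y' k' p0 \<oplus>\<^bsub>Hom C S Y'\<^esub> Comp C S Y Y' h p1"
  have k [simp]: "k \<in> arr C S Y'" by (simp add: k_def)
  have ki: "Comp C X' S Y' k i0 = k'" "Comp C Y S Y' k i1 = h"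
    by (simp_all add: k_def comp_add comp_assoc pi)
  have factor: "(\<exists>n\<in>arr C T S. Comp C T S Y' k n = t) \<longleftrightarrow>
      (\<exists>l\<in>arr C T X'. \<exists>m\<in>arr C T Y. Comp C T X' Y' k' l = t \<ominus>\<^bsub>Hom C T Y'\<^esub> Comp C T Y Y' h m)"
    if T [simp]: "T \<in> Ob C" and t [simp]: "t \<in> arr C T Y'" for T t
  proof
    assume "\<exists>n\<in>arr C T S. Comp C T S Y' k n = t"
    then obtain n where n: "n \<in> arr C T S" "Comp C T S Y' k n = t" by blast
    have "t = Comp C T X' Y' k' (Comp C T S X' p0 n) \<oplus>\<^bsub>Hom C T Y'\<^esub> Comp C T Y Y' h (Comp C T S Y p1 n)"
      using n by (simp add: k_def comp_add comp_assoc)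
    moreover have "(x \<oplus>\<^bsub>Hom C T Y'\<^esub> y) \<ominus>\<^bsub>Hom C T Y'\<^esub> y = x" if "x \<in> arr C T Y'" "y \<in> arr C T Y'" for x y
    proof -
      interpret H: abelian_group "Hom C T Y'" by simp
      show ?thesis using that by (simp add: a_minus_def H.a_assoc H.r_neg)
    qed
    ultimately have "Comp C T X' Y' k' (Comp C T S X' p0 n) = t \<ominus>\<^bsub>Hom C T Y'\<^esub> Comp C T Y Y' h (Comp C T S Y p1 n)"
      using n by simp
    then show "\<exists>l\<in>arr C T X'. \<exists>m\<in>arr C T Y. Comp C T X' Y' k' l = t \<ominus>\<^bsub>Hom C T Y'\<^esub> Comp C T Y Y' h m"
      using n by (intro bexI[of _ "Comp C T S X' p0 n"] bexI[of _ "Comp C T S Y p1 n"]) simp_all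
  next
    assume "\<exists>l\<in>arr C T X'. \<exists>m\<in>arr C T Y. Comp C T X' Y' k' l = t \<ominus>\<^bsub>Hom C T Y'\<^esub> Comp C T Y Y' h m"
    then obtain l m where lm: "l \<in> arr C T X'" "m \<in> arr C T Y" "Comp C T X' Y' k' l = t \<ominus>\<^bsub>Hom C T Y'\<^esub> Comp C T Y Y' h m" by blast
    let ?n = "Comp C T X' S i0 l \<oplus>\<^bsub>Hom C T S\<^esub> Comp C T Y S i1 m"
    have "Comp C T S Y' k ?n = Comp C T X' Y' (Comp C X' S Y' k i0) l \<oplus>\<^bsub>Hom C T Y'\<^esub> Comp C T Y Y' (Comp C Y S Y' k i1) m"
      using lm by (simp add: comp_add comp_assoc)
    also have "\<dots> = t" unfolding ki using lm by (simp add: diff_add_cancel)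
    finally show "\<exists>n\<in>arr C T S. Comp C T S Y' k n = t" using lm by (intro bexI[of _ ?n]) simp_all
  qed
  have pe: "hom_map Q Y' T t (p Y' e') = p T (hom_map G Y' T t e')" if "T \<in> Ob C" "t \<in> arr C T Y'" for T t
    using that by (simp add: Mod_arr_natural[OF p])
  have "presented Q Y' (p Y' e') S k"
    unfolding presented_def
  proof (intro conjI ballI)
    fix T x assume T: "T \<in> Ob C" "x \<in> elts Q T"
    then obtain y where y: "y \<in> elts G T" "x = p T y" using surj by (metis imageE)
    then obtain t where "t \<in> arr C T Y'" "hom_map G Y' T t e' = y" using genG T by blast
    then show "\<exists>h\<in>arr C T Y'. hom_map Q Y' T h (p Y' e') = x" using T y pe by auto
  next
    fix T t assume T [simp]: "T \<in> Ob C" and t [simp]: "t \<in> arr C T Y'"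
    have lin: "linear_map K (Hom C T Y') (ob_map G T) (\<lambda>g. hom_map G Y' T g e')"
      by (rule linear_mapI) (simp_all add: Mod_hom_in[OF GM] Mod_hom_add[OF GM] Mod_hom_smult[OF GM])
    have \<alpha>e: "\<alpha> T (hom_map F Y T m e) = hom_map G Y' T (Comp C T Y Y' h m) e'" if "m \<in> arr C T Y" for m
      using that by (simp add: Mod_arr_natural[OF \<alpha>] he[symmetric] Mod_hom_comp[OF GM])
    have "hom_map Q Y' T t (p Y' e') = \<zero>\<^bsub>ob_map Q T\<^esub> \<longleftrightarrow> hom_map G Y' T t e' \<in> \<alpha> T ` elts F T"
      using ker[OF T] pe[OF T t] Mod_hom_in[OF GM T _ t e'] by auto
    also have "\<dots> \<longleftrightarrow> (\<exists>m\<in>arr C T Y. hom_map G Y' T t e' = \<alpha> T (hom_map F Y T m e))"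
      using genF[OF T] Mod_hom_in[OF FM T _ _ e] by (auto simp: image_iff)
    also have "\<dots> \<longleftrightarrow> (\<exists>m\<in>arr C T Y. hom_map G Y' T t e' = hom_map G Y' T (Comp C T Y Y' h m) e')"
      using \<alpha>e by auto
    also have "\<dots> \<longleftrightarrow> (\<exists>m\<in>arr C T Y. hom_map G Y' T (t \<ominus>\<^bsub>Hom C T Y'\<^esub> Comp C T Y Y' h m) e' = \<zero>\<^bsub>ob_map G T\<^esub>)"
      using linear_eq_iff_diff[OF lin Hom_module[OF T \<open>Y' \<in> Ob C\<close>] Mod_module[OF GM T] t] by simp
    also have "\<dots> \<longleftrightarrow> (\<exists>m\<in>arr C T Y. \<exists>l\<in>arr C T X'. Comp C T X' Y' k' l = t \<ominus>\<^bsub>Hom C T Y'\<^esub> Comp C T Y Y' h m)"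
      by (simp add: relG)
    also have "\<dots> \<longleftrightarrow> (\<exists>n\<in>arr C T S. Comp C T S Y' k n = t)"
      unfolding factor[OF T t] by blast
    finally show "hom_map Q Y' T t (p Y' e') = \<zero>\<^bsub>ob_map Q T\<^esub> \<longleftrightarrow> (\<exists>n\<in>arr C T S. Comp C T S Y' k n = t)" .
  qed (simp_all add: Q Mod_arr_in[OF p])
  then have "Q \<in> Ob fp" by (rule presented_fp)
  then show ?thesis using p surj ker by (rule that)
qed

end

section \<open>Homological algebra of finitely presented modules\<close>

context small_linear_category
begin

text \<open>Kernels are pointwise, since representables detect the elements of a module.\<close>

lemma fp_kernel_pointwise:
  assumes k: "is_kernel fp F G f N i" and f: "f \<in> arr (Mod K C) F G" and X: "X \<in> Ob C"
  shows "inj_on (i X) (elts N X)" and "i X ` elts N X = {x \<in> elts F X. f X x = \<zero>\<^bsub>ob_map G X\<^esub>}"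
proof -
  have i: "i \<in> arr (Mod K C) N F" and N: "N \<in> Ob fp"
    and fi: "Comp (Mod K C) N F G f i = \<zero>\<^bsub>Hom (Mod K C) N G\<^esub>"
    and univ: "\<And>T t. T \<in> Ob fp \<Longrightarrow> t \<in> arr (Mod K C) T F \<Longrightarrow> Comp (Mod K C) T F G f t = \<zero>\<^bsub>Hom (Mod K C) T G\<^esub> \<Longrightarrow>
       \<exists>!s. s \<in> arr (Mod K C) T N \<and> Comp (Mod K C) T N F i s = t"
    using k unfolding is_kernel_def by auto
  note NM = Mod_arr_source[OF i] and FM = Mod_arr_target[OF i] and GM = Mod_arr_target[OF f]
  let ?id = "cd X X (Ident C X)"
  have rz: "\<zero>\<^bsub>Hom (Mod K C) (rep X) G\<^esub> X ?id = \<zero>\<^bsub>ob_map G X\<^esub>"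
    using X by (simp add: Mod_zero)
  have fy: "Comp (Mod K C) (rep X) F G f (yon F X x) = \<zero>\<^bsub>Hom (Mod K C) (rep X) G\<^esub>"
    if x: "x \<in> elts F X" "f X x = \<zero>\<^bsub>ob_map G X\<^esub>" for x
  proof (rule arr_rep_eqI[OF _ _ X])
    show "Comp (Mod K C) (rep X) F G f (yon F X x) \<in> arr (Mod K C) (rep X) G"
      "\<zero>\<^bsub>Hom (Mod K C) (rep X) G\<^esub> \<in> arr (Mod K C) (rep X) G"
      using FM GM X f x by simp_all
    show "Comp (Mod K C) (rep X) F G f (yon F X x) X ?id = \<zero>\<^bsub>Hom (Mod K C) (rep X) G\<^esub> X ?id"
      unfolding rz using FM X x by (simp add: Mod_Comp)
  qed
  have fi0: "f X (i X n) = \<zero>\<^bsub>ob_map G X\<^esub>" if n: "n \<in> elts N X" for n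
    using fun_cong[OF fun_cong[OF fi, of X], of n] X n by (simp add: Mod_Comp Mod_zero)
  show "inj_on (i X) (elts N X)"
  proof (rule inj_onI)
    fix n n' assume n: "n \<in> elts N X" "n' \<in> elts N X" and eq: "i X n = i X n'"
    have in0: "i X n \<in> elts F X" using Mod_arr_in[OF i X] n by simp
    have s: "Comp (Mod K C) (rep X) N F i (yon N X n) = yon F X (i X n)"
      "Comp (Mod K C) (rep X) N F i (yon N X n') = yon F X (i X n)"
      using comp_yon[OF NM X n(1) i] comp_yon[OF NM X n(2) i] eq by simp_all
    have "\<exists>!s. s \<in> arr (Mod K C) (rep X) N \<and> Comp (Mod K C) (rep X) N F i s = yon F X (i X n)"
      using in0 fi0[OF n(1)] FM X by (intro univ fy) simp_all
    then have eq': "yon N X n = yon N X n'" using s NM X n by (metis yon_in)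
    show "n = n'" using fun_cong[OF fun_cong[OF eq', of X], of ?id] NM X n by simp
  qed
  show "i X ` elts N X = {x \<in> elts F X. f X x = \<zero>\<^bsub>ob_map G X\<^esub>}"
  proof (intro equalityI subsetI)
    fix x assume "x \<in> {x \<in> elts F X. f X x = \<zero>\<^bsub>ob_map G X\<^esub>}"
    then have x: "x \<in> elts F X" "f X x = \<zero>\<^bsub>ob_map G X\<^esub>" by auto
    then obtain s where s: "s \<in> arr (Mod K C) (rep X) N" "Comp (Mod K C) (rep X) N F i s = yon F X x"
      using univ[of "rep X" "yon F X x"] fy[OF x] FM X by auto
    have "i X (s X ?id) = x"
      using fun_cong[OF fun_cong[OF s(2), of X], of ?id] X FM x by (simp add: Mod_Comp)
    then show "x \<in> i X ` elts N X" using Mod_arr_in[OF s(1) X, of ?id] X by force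
  qed (use fi0 Mod_arr_in[OF i X] in auto)
qed

lemma fp_cokernelI:
  assumes f: "f \<in> arr (Mod K C) F G" and p: "p \<in> arr (Mod K C) G Q" and Q: "Q \<in> Ob fp"
    and surj: "\<And>X. X \<in> Ob C \<Longrightarrow> p X ` elts G X = elts Q X"
    and ker: "\<And>X. X \<in> Ob C \<Longrightarrow> {y \<in> elts G X. p X y = \<zero>\<^bsub>ob_map Q X\<^esub>} = f X ` elts F X"
  shows "is_cokernel fp F G f Q p"
  by (rule fp_cokernel[OF Mod_cokernelI[OF f p] Q]) (use surj ker in simp_all)

end

context small_additive_category
begin

text \<open>
  An epimorphism has zero cokernel, and the cokernel in the category of finitely presented modules is
  the pointwise one.
\<close>

lemma fp_epic_surj:
  assumes e: "epic fp F G \<alpha>" and F: "F \<in> Ob fp" and G: "G \<in> Ob fp" and X: "X \<in> Ob C"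
  shows "\<alpha> X ` elts F X = elts G X"
proof -
  have \<alpha>: "\<alpha> \<in> arr (Mod K C) F G" using e by (simp add: epic_def)
  obtain Q p where Q: "Q \<in> Ob fp" and p: "p \<in> arr (Mod K C) G Q"
    and ker: "\<And>X. X \<in> Ob C \<Longrightarrow> {y \<in> elts G X. p X y = \<zero>\<^bsub>ob_map Q X\<^esub>} = \<alpha> X ` elts F X"
    by (rule fp_quotient[OF F G \<alpha>]) (rule that; assumption?; blast)
  have "Comp (Mod K C) F G Q p \<alpha> = Comp (Mod K C) F G Q \<zero>\<^bsub>Hom (Mod K C) G Q\<^esub> \<alpha>"
    unfolding Mod_Comp Mod_zero using ker by (intro nt_cong) (auto simp: Mod_arr_in[OF \<alpha>])
  then have "p = \<zero>\<^bsub>Hom (Mod K C) G Q\<^esub>"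
    using fp.epic_cancel[OF e Q, of p "\<zero>\<^bsub>Hom (Mod K C) G Q\<^esub>"] p F G Q by simp
  then have "{y \<in> elts G X. p X y = \<zero>\<^bsub>ob_map Q X\<^esub>} = elts G X"
    using X by (auto simp: Mod_zero)
  then show ?thesis using ker[OF X] by simp
qed

text \<open>
  To lift a morphism out of \<open>rep X\<close> is to lift an element at \<open>X\<close>.
\<close>

lemma rep_projective:
  assumes X: "X \<in> Ob C"
  shows "projective fp (rep X)"
  unfolding projective_def
proof (intro conjI ballI allI impI)
  show "rep X \<in> Ob fp" using X by simp
  fix F G p f assume F: "F \<in> Ob fp" and G: "G \<in> Ob fp" and e: "epic fp F G p" and f: "f \<in> arr fp (rep X) G"
  have f: "f \<in> arr (Mod K C) (rep X) G" and p: "p \<in> arr (Mod K C) F G" using f e by (simp_all add: epic_def)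
  let ?y = "f X (cd X X (Ident C X))"
  have "?y \<in> elts G X" using X by (simp add: Mod_arr_in[OF f])
  then have "?y \<in> p X ` elts F X" using fp_epic_surj[OF e F G X] by simp
  then obtain x where x: "x \<in> elts F X" "?y = p X x" by blast
  have "Comp (Mod K C) (rep X) F G p (yon F X x) = f"
    using comp_yon[OF fp_Ob_Mod[OF F] X x(1) p] yon_unique[OF f X] x(2) by simp
  then show "\<exists>g\<in>arr fp (rep X) F. Comp fp (rep X) F G p g = f"
    using F X x by (intro bexI[of _ "yon F X x"]) simp_all
qed

lemma fp_cokernel_of_rep:
  assumes "X \<in> Ob C" "Y \<in> Ob C" "f \<in> arr C X Y"
  obtains Q p where "Q \<in> Ob fp" "p \<in> arr (Mod K C) (rep Y) Q" "is_cokernel fp (rep X) (rep Y) (hom_map yo X Y f) Q p"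
    "\<forall>T\<in>Ob C. {y \<in> elts (rep Y) T. p T y = \<zero>\<^bsub>ob_map Q T\<^esub>} = hom_map yo X Y f T ` elts (rep X) T"
proof -
  have f: "hom_map yo X Y f \<in> arr (Mod K C) (rep X) (rep Y)" using assms by simp
  obtain Q p where Q: "Q \<in> Ob fp" and p: "p \<in> arr (Mod K C) (rep Y) Q"
    and surj: "\<And>T. T \<in> Ob C \<Longrightarrow> p T ` elts (rep Y) T = elts Q T"
    and ker: "\<And>T. T \<in> Ob C \<Longrightarrow> {y \<in> elts (rep Y) T. p T y = \<zero>\<^bsub>ob_map Q T\<^esub>} = hom_map yo X Y f T ` elts (rep X) T"
    by (rule fp_quotient[OF rep_fp[OF assms(1)] rep_fp[OF assms(2)] f]) (rule that; assumption?; blast)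
  show ?thesis
    by (rule that[OF Q p fp_cokernelI[OF f p Q surj ker]]) (use ker in simp_all)
qed

text \<open>
  The module \<open>Z\<close> is the image of \<open>f\<^sup>\<and>\<close>, formed in the category of finitely presented modules. Since
  kernels and cokernels there are pointwise, \<open>P\<^sup>\<and>\<close> maps onto \<open>Z\<close>, and the kernel of this map is the
  pointwise kernel of \<open>f\<^sup>\<and>\<close>, which is \<open>N\<^sup>\<and>\<close> because \<open>g\<close> is a kernel of \<open>f\<close>.
\<close>

lemma image_resolution:
  assumes [simp]: "N \<in> Ob C" "P \<in> Ob C" "M \<in> Ob C" "g \<in> arr C N P" "f \<in> arr C P M"
    and g: "is_kernel C P M f N g"
    and cok: "is_cokernel fp (rep P) (rep M) (hom_map yo P M f) Q p"
    and ker: "is_kernel fp (rep M) Q p Z i"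
  obtains q where "q \<in> arr (Mod K C) (rep P) Z" "Comp (Mod K C) (rep P) Z (rep M) i q = hom_map yo P M f"
    "short_exact fp (rep N) (rep P) Z (hom_map yo N P g) q"
proof -
  let ?f = "hom_map yo P M f" and ?g = "hom_map yo N P g"
  have f: "?f \<in> arr (Mod K C) (rep P) (rep M)" and gin: "?g \<in> arr (Mod K C) (rep N) (rep P)" by simp_all
  have Q: "Q \<in> Ob fp" and p: "p \<in> arr (Mod K C) (rep M) Q"
    and pf: "Comp (Mod K C) (rep P) (rep M) Q p ?f = \<zero>\<^bsub>Hom (Mod K C) (rep P) Q\<^esub>"
    using cok by (auto simp: is_cokernel_def)
  have Z: "Z \<in> Ob fp" and i: "i \<in> arr (Mod K C) Z (rep M)" using ker by (auto simp: is_kernel_def)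
  note inj = fp_kernel_pointwise(1)[OF ker p] and im = fp_kernel_pointwise(2)[OF ker p]
  \<comment> \<open>the kernel of \<open>p\<close> is the pointwise image of \<open>?f\<close>: compare \<open>p\<close> with a pointwise cokernel\<close>
  have kerp: "{y \<in> elts (rep M) X. p X y = \<zero>\<^bsub>ob_map Q X\<^esub>} = ?f X ` elts (rep P) X" if X: "X \<in> Ob C" for X
  proof (intro equalityI subsetI)
    fix y assume "y \<in> ?f X ` elts (rep P) X"
    then obtain x where x: "x \<in> elts (rep P) X" "y = ?f X x" by blast
    have "p X (?f X x) = \<zero>\<^bsub>ob_map Q X\<^esub>"
      using fun_cong[OF fun_cong[OF pf, of X], of x] X x by (simp add: Mod_Comp Mod_zero)
    then show "y \<in> {y \<in> elts (rep M) X. p X y = \<zero>\<^bsub>ob_map Q X\<^esub>}" using x Mod_arr_in[OF f X] by simp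
  next
    fix y assume y: "y \<in> {y \<in> elts (rep M) X. p X y = \<zero>\<^bsub>ob_map Q X\<^esub>}"
    obtain Q' p' where Q': "Q' \<in> Ob fp" and p': "p' \<in> arr (Mod K C) (rep M) Q'"
      and cok': "is_cokernel fp (rep P) (rep M) ?f Q' p'"
      and ker': "\<forall>T\<in>Ob C. {y \<in> elts (rep M) T. p' T y = \<zero>\<^bsub>ob_map Q' T\<^esub>} = ?f T ` elts (rep P) T"
      by (rule fp_cokernel_of_rep[of P M f]) simp_all
    have "Comp (Mod K C) (rep P) (rep M) Q' p' ?f = \<zero>\<^bsub>Hom (Mod K C) (rep P) Q'\<^esub>"
      using cok' by (simp add: is_cokernel_def)
    then obtain s where s: "s \<in> arr (Mod K C) Q Q'" "Comp (Mod K C) (rep M) Q Q' s p = p'"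
      using fp.cokernel_factor[OF cok Q', of p'] p' by auto
    have "p' X y = s X (p X y)" using s(2) X y by (auto simp: Mod_Comp)
    also have "\<dots> = s X \<zero>\<^bsub>ob_map Q X\<^esub>" using y by simp
    also have "\<dots> = \<zero>\<^bsub>ob_map Q' X\<^esub>"
      by (rule linear_zero[OF Mod_arr_linear[OF s(1) X] Mod_module[OF fp_Ob_Mod[OF Q] X] Mod_module[OF fp_Ob_Mod[OF Q'] X]])
    finally show "y \<in> ?f X ` elts (rep P) X" using ker' X y by auto
  qed
  have "Comp fp (rep P) (rep M) Q p ?f = \<zero>\<^bsub>Hom fp (rep P) Q\<^esub>" using pf by simp
  then obtain q where q: "q \<in> arr (Mod K C) (rep P) Z" and iq: "Comp (Mod K C) (rep P) Z (rep M) i q = ?f"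
    using fp.kernel_factor[OF ker, of "rep P" ?f] by auto
  have iq': "i X (q X x) = ?f X x" if "X \<in> Ob C" "x \<in> elts (rep P) X" for X x
    using fun_cong[OF fun_cong[OF iq, of X], of x] that by (simp add: Mod_Comp)
  have zz: "i X \<zero>\<^bsub>ob_map Z X\<^esub> = \<zero>\<^bsub>ob_map (rep M) X\<^esub>" "\<zero>\<^bsub>ob_map Z X\<^esub> \<in> elts Z X" if X: "X \<in> Ob C" for X
    using linear_zero[OF Mod_arr_linear[OF i X] Mod_module[OF fp_Ob_Mod[OF Z] X] rep_module[OF _ X]]
      abelian_groupE(2)[OF module_abelian_group[OF Mod_module[OF fp_Ob_Mod[OF Z] X]]] by simp_all
  have q0: "q X x = \<zero>\<^bsub>ob_map Z X\<^esub> \<longleftrightarrow> ?f X x = \<zero>\<^bsub>ob_map (rep M) X\<^esub>" if X: "X \<in> Ob C" and x: "x \<in> elts (rep P) X" for X x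
    using inj_on_eq_iff[OF inj[OF X], of "q X x" "\<zero>\<^bsub>ob_map Z X\<^esub>"] iq'[OF X x] zz[OF X] Mod_arr_in[OF q X x] by simp
  have qs: "q X ` elts (rep P) X = elts Z X" if X: "X \<in> Ob C" for X
  proof (intro equalityI subsetI)
    fix z assume z: "z \<in> elts Z X"
    then have "i X z \<in> ?f X ` elts (rep P) X" using im[OF X] kerp[OF X] by blast
    then obtain x where x: "x \<in> elts (rep P) X" "i X z = i X (q X x)" using iq'[OF X] by auto
    then have "z = q X x" using inj_onD[OF inj[OF X]] z Mod_arr_in[OF q X] by blast
    then show "z \<in> q X ` elts (rep P) X" using x by blast
  qed (use Mod_arr_in[OF q X] in auto)
  have fg: "{x \<in> elts (rep P) X. ?f X x = \<zero>\<^bsub>ob_map (rep M) X\<^esub>} = ?g X ` elts (rep N) X" if X [simp]: "X \<in> Ob C" for X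
  proof (intro equalityI subsetI)
    fix x assume "x \<in> {x \<in> elts (rep P) X. ?f X x = \<zero>\<^bsub>ob_map (rep M) X\<^esub>}"
    then obtain h where h: "h \<in> arr C X P" "x = cd X P h" "cd X M (Comp C X P M f h) = cd X M \<zero>\<^bsub>Hom C X M\<^esub>"
      by (auto elim!: rep_cases simp: yo_apply rep_zero)
    then have "Comp C X P M f h = \<zero>\<^bsub>Hom C X M\<^esub>" by (simp add: cd_eq_iff)
    then obtain l where "l \<in> arr C X N" "Comp C X N P g l = h"
      using kernel_factor[OF g X h(1)] by blast
    then show "x \<in> ?g X ` elts (rep N) X"
      using h by (intro image_eqI[of _ _ "cd X N l"]) (simp_all add: yo_apply)
  next
    fix x assume "x \<in> ?g X ` elts (rep N) X"
    then obtain l where l: "l \<in> arr C X N" "x = cd X P (Comp C X N P g l)"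
      by (auto elim!: rep_cases simp: yo_apply)
    have "Comp C X P M f (Comp C X N P g l) = \<zero>\<^bsub>Hom C X M\<^esub>"
      using l g by (simp add: comp_assoc[symmetric] is_kernel_def)
    then show "x \<in> {x \<in> elts (rep P) X. ?f X x = \<zero>\<^bsub>ob_map (rep M) X\<^esub>}"
      using l by (simp add: yo_apply rep_zero)
  qed
  have gi: "inj_on (?g X) (elts (rep N) X)" if X [simp]: "X \<in> Ob C" for X
  proof (rule inj_onI)
    fix x y assume "x \<in> elts (rep N) X" "y \<in> elts (rep N) X" and eq: "?g X x = ?g X y"
    then obtain l m where lm: "l \<in> arr C X N" "x = cd X N l" "m \<in> arr C X N" "y = cd X N m" by (metis rep_cases)
    then have "Comp C X N P g l = Comp C X N P g m" using eq by (simp add: yo_apply cd_eq_iff)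
    then have "l = m" using monic_cancel[OF kernel_monic[OF g] X lm(1,3)] by simp
    then show "x = y" using lm by simp
  qed
  have qg: "{x \<in> elts (rep P) X. q X x = \<zero>\<^bsub>ob_map Z X\<^esub>} = ?g X ` elts (rep N) X" if X: "X \<in> Ob C" for X
    using fg[OF X] q0[OF X] by auto
  have "is_kernel fp (rep P) Z q (rep N) ?g"
    by (rule fp_kernel[OF Mod_kernelI[OF q gin gi]]) (use qg in simp_all)
  moreover have "is_cokernel fp (rep N) (rep P) ?g Z q"
    by (rule fp_cokernelI[OF gin q Z qs qg]) simp_all
  ultimately have "short_exact fp (rep N) (rep P) Z ?g q" by (simp add: short_exact_def Z)
  with q iq show ?thesis by (rule that)
qed

text \<open>
  A direct sum of two copies of a module with a presentation by representables is presented by the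
  direct sum of two copies of the presentation.
\<close>

lemma fp_direct_sum:
  assumes [simp]: "N \<in> Ob C" "P \<in> Ob C" "g \<in> arr C N P"
    and cok: "is_cokernel fp (rep N) (rep P) (hom_map yo N P g) Z q"
  obtains S \<iota> \<pi> where "is_direct_sum fp 2 (\<lambda>i. Z) S \<iota> \<pi>"
proof -
  let ?h = "Comp (Mod K C)"
  let ?g = "hom_map yo N P g"
  have Z [simp]: "Z \<in> Ob fp" and q [simp]: "q \<in> arr (Mod K C) (rep P) Z"
    and qg: "?h (rep N) (rep P) Z q ?g = \<zero>\<^bsub>Hom (Mod K C) (rep N) Z\<^esub>"
    using cok by (auto simp: is_cokernel_def)
  have qe: "s = t" if "T \<in> Ob fp" "s \<in> arr (Mod K C) Z T" "t \<in> arr (Mod K C) Z T"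
    "?h (rep P) Z T s q = ?h (rep P) Z T t q" for T s t
    using fp.epic_cancel[OF fp.cokernel_epic[OF cok] that(1), of s t] that by simp
  obtain P2 i0 i1 p0 p1 where [simp]: "P2 \<in> Ob C" "i0 \<in> arr C P P2" "i1 \<in> arr C P P2" "p0 \<in> arr C P2 P" "p1 \<in> arr C P2 P"
    and pi: "Comp C P P2 P p0 i0 = Ident C P" "Comp C P P2 P p1 i1 = Ident C P"
    "Comp C P P2 P p1 i0 = \<zero>\<^bsub>Hom C P P\<^esub>" "Comp C P P2 P p0 i1 = \<zero>\<^bsub>Hom C P P\<^esub>"
    and ip: "Comp C P2 P P2 i0 p0 \<oplus>\<^bsub>Hom C P2 P2\<^esub> Comp C P2 P P2 i1 p1 = Ident C P2"
    by (rule direct_sum[OF \<open>P \<in> Ob C\<close> \<open>P \<in> Ob C\<close>])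
  obtain N2 j0 j1 r0 r1 where [simp]: "N2 \<in> Ob C" "j0 \<in> arr C N N2" "j1 \<in> arr C N N2" "r0 \<in> arr C N2 N" "r1 \<in> arr C N2 N"
    and rj: "Comp C N N2 N r0 j0 = Ident C N" "Comp C N N2 N r1 j1 = Ident C N"
    "Comp C N N2 N r1 j0 = \<zero>\<^bsub>Hom C N N\<^esub>" "Comp C N N2 N r0 j1 = \<zero>\<^bsub>Hom C N N\<^esub>"
    by (rule direct_sum[OF \<open>N \<in> Ob C\<close> \<open>N \<in> Ob C\<close>])
  define G where "G = Comp C N2 P P2 i0 (Comp C N2 N P g r0) \<oplus>\<^bsub>Hom C N2 P2\<^esub> Comp C N2 P P2 i1 (Comp C N2 N P g r1)"
  have G [simp]: "G \<in> arr C N2 P2" by (simp add: G_def)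
  have Gj: "Comp C N N2 P2 G j0 = Comp C N P P2 i0 g" "Comp C N N2 P2 G j1 = Comp C N P P2 i1 g"
    by (simp_all add: G_def comp_add comp_assoc rj)
  have pG: "Comp C N2 P2 P p0 G = Comp C N2 N P g r0" "Comp C N2 P2 P p1 G = Comp C N2 N P g r1"
    by (simp_all add: G_def comp_add comp_assoc[symmetric] pi)
  let ?G = "hom_map yo N2 P2 G"
  obtain W w where W [simp]: "W \<in> Ob fp" and w [simp]: "w \<in> arr (Mod K C) (rep P2) W"
    and cokw: "is_cokernel fp (rep N2) (rep P2) ?G W w"
    by (rule fp_cokernel_of_rep[of N2 P2 G]) simp_all
  have wG: "?h (rep N2) (rep P2) W w ?G = \<zero>\<^bsub>Hom (Mod K C) (rep N2) W\<^esub>"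
    using cokw by (simp add: is_cokernel_def)
  have we: "s = t" if "T \<in> Ob fp" "s \<in> arr (Mod K C) W T" "t \<in> arr (Mod K C) W T"
    "?h (rep P2) W T s w = ?h (rep P2) W T t w" for T s t
    using fp.epic_cancel[OF fp.cokernel_epic[OF cokw] that(1), of s t] that by simp
  have inj: "\<exists>\<iota>\<in>arr (Mod K C) Z W. ?h (rep P) Z W \<iota> q = ?h (rep P) (rep P2) W w (hom_map yo P P2 i)"
    if i [simp]: "i \<in> arr C P P2" "j \<in> arr C N N2" and eq: "Comp C N N2 P2 G j = Comp C N P P2 i g" for i j
  proof -
    let ?t = "?h (rep P) (rep P2) W w (hom_map yo P P2 i)"
    have "?h (rep N) (rep P) W ?t ?g = ?h (rep N) (rep P2) W w (hom_map yo N P2 (Comp C N N2 P2 G j))"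
      unfolding eq by (simp add: Mod.comp_assoc yo.map_comp)
    also have "\<dots> = ?h (rep N) (rep N2) W (?h (rep N2) (rep P2) W w ?G) (hom_map yo N N2 j)"
      by (simp add: Mod.comp_assoc yo.map_comp)
    also have "\<dots> = \<zero>\<^bsub>Hom (Mod K C) (rep N) W\<^esub>" unfolding wG by simp
    finally show ?thesis using fp.cokernel_factor[OF cok W, of ?t] by auto
  qed
  have proj: "\<exists>\<pi>\<in>arr (Mod K C) W Z. ?h (rep P2) W Z \<pi> w = ?h (rep P2) (rep P) Z q (hom_map yo P2 P p)"
    if p [simp]: "p \<in> arr C P2 P" "r \<in> arr C N2 N" and eq: "Comp C N2 P2 P p G = Comp C N2 N P g r" for p r
  proof -
    let ?t = "?h (rep P2) (rep P) Z q (hom_map yo P2 P p)"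
    have "?h (rep N2) (rep P2) Z ?t ?G = ?h (rep N2) (rep P) Z q (hom_map yo N2 P (Comp C N2 P2 P p G))"
      by (simp add: Mod.comp_assoc yo.map_comp)
    also have "\<dots> = ?h (rep N2) (rep N) Z (?h (rep N) (rep P) Z q ?g) (hom_map yo N2 N r)"
      unfolding eq by (simp add: Mod.comp_assoc yo.map_comp)
    also have "\<dots> = \<zero>\<^bsub>Hom (Mod K C) (rep N2) Z\<^esub>" unfolding qg by simp
    finally show ?thesis using fp.cokernel_factor[OF cokw Z, of ?t] by auto
  qed
  obtain \<iota>0 where \<iota>0 [simp]: "\<iota>0 \<in> arr (Mod K C) Z W" "?h (rep P) Z W \<iota>0 q = ?h (rep P) (rep P2) W w (hom_map yo P P2 i0)"
    using inj[of i0 j0] Gj by auto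
  obtain \<iota>1 where \<iota>1 [simp]: "\<iota>1 \<in> arr (Mod K C) Z W" "?h (rep P) Z W \<iota>1 q = ?h (rep P) (rep P2) W w (hom_map yo P P2 i1)"
    using inj[of i1 j1] Gj by auto
  obtain \<pi>0 where \<pi>0 [simp]: "\<pi>0 \<in> arr (Mod K C) W Z" "?h (rep P2) W Z \<pi>0 w = ?h (rep P2) (rep P) Z q (hom_map yo P2 P p0)"
    using proj[of p0 r0] pG by auto
  obtain \<pi>1 where \<pi>1 [simp]: "\<pi>1 \<in> arr (Mod K C) W Z" "?h (rep P2) W Z \<pi>1 w = ?h (rep P2) (rep P) Z q (hom_map yo P2 P p1)"
    using proj[of p1 r1] pG by auto
  have comp: "?h Z W Z \<pi> \<iota> = c"
    if [simp]: "\<pi> \<in> arr (Mod K C) W Z" "\<iota> \<in> arr (Mod K C) Z W" "p \<in> arr C P2 P" "i \<in> arr C P P2" "c \<in> arr (Mod K C) Z Z"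
      and \<pi>: "?h (rep P2) W Z \<pi> w = ?h (rep P2) (rep P) Z q (hom_map yo P2 P p)"
      and \<iota>: "?h (rep P) Z W \<iota> q = ?h (rep P) (rep P2) W w (hom_map yo P P2 i)"
      and c: "?h (rep P) (rep P) Z q (hom_map yo P P (Comp C P P2 P p i)) = ?h (rep P) Z Z c q" for \<pi> \<iota> p i c
  proof (rule qe[OF Z])
    have "?h (rep P) Z Z (?h Z W Z \<pi> \<iota>) q = ?h (rep P) (rep P2) Z (?h (rep P2) W Z \<pi> w) (hom_map yo P P2 i)"
      by (simp add: Mod.comp_assoc \<iota>)
    also have "\<dots> = ?h (rep P) (rep P) Z q (hom_map yo P P (Comp C P P2 P p i))"
      unfolding \<pi> by (simp add: Mod.comp_assoc yo.map_comp)
    finally show "?h (rep P) Z Z (?h Z W Z \<pi> \<iota>) q = ?h (rep P) Z Z c q" using c by simp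
  qed simp_all
  have one: "?h (rep P) (rep P) Z q (hom_map yo P P (Ident C P)) = ?h (rep P) Z Z (Ident (Mod K C) Z) q"
    and zero: "?h (rep P) (rep P) Z q (hom_map yo P P \<zero>\<^bsub>Hom C P P\<^esub>) = ?h (rep P) Z Z \<zero>\<^bsub>Hom (Mod K C) Z Z\<^esub> q"
    using yo.map_ident[of P] yo.map_zero[of P P] by simp_all
  have c00: "?h Z W Z \<pi>0 \<iota>0 = Ident (Mod K C) Z"
    by (rule comp[of _ _ p0 i0]) (simp, simp, simp, simp, simp, rule \<pi>0, rule \<iota>0, simp only: pi one)
  have c11: "?h Z W Z \<pi>1 \<iota>1 = Ident (Mod K C) Z"
    by (rule comp[of _ _ p1 i1]) (simp, simp, simp, simp, simp, rule \<pi>1, rule \<iota>1, simp only: pi one)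
  have c10: "?h Z W Z \<pi>1 \<iota>0 = \<zero>\<^bsub>Hom (Mod K C) Z Z\<^esub>"
    by (rule comp[of _ _ p1 i0]) (simp, simp, simp, simp, simp, rule \<pi>1, rule \<iota>0, simp only: pi zero)
  have c01: "?h Z W Z \<pi>0 \<iota>1 = \<zero>\<^bsub>Hom (Mod K C) Z Z\<^esub>"
    by (rule comp[of _ _ p0 i1]) (simp, simp, simp, simp, simp, rule \<pi>0, rule \<iota>1, simp only: pi zero)
  have sum: "?h W Z W \<iota>0 \<pi>0 \<oplus>\<^bsub>Hom (Mod K C) W W\<^esub> ?h W Z W \<iota>1 \<pi>1 = Ident (Mod K C) W"
  proof (rule we[OF W])
    have t: "?h (rep P2) W W (?h W Z W \<iota> \<pi>) w = ?h (rep P2) (rep P2) W w (hom_map yo P2 P2 (Comp C P2 P P2 i p))"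
      if [simp]: "\<pi> \<in> arr (Mod K C) W Z" "\<iota> \<in> arr (Mod K C) Z W" "p \<in> arr C P2 P" "i \<in> arr C P P2"
        and \<pi>: "?h (rep P2) W Z \<pi> w = ?h (rep P2) (rep P) Z q (hom_map yo P2 P p)"
        and \<iota>: "?h (rep P) Z W \<iota> q = ?h (rep P) (rep P2) W w (hom_map yo P P2 i)" for \<pi> \<iota> p i
    proof -
      have "?h (rep P2) W W (?h W Z W \<iota> \<pi>) w = ?h (rep P2) (rep P) W (?h (rep P) Z W \<iota> q) (hom_map yo P2 P p)"
        by (simp add: Mod.comp_assoc \<pi>)
      also have "\<dots> = ?h (rep P2) (rep P2) W w (hom_map yo P2 P2 (Comp C P2 P P2 i p))"
        unfolding \<iota> by (simp add: Mod.comp_assoc yo.map_comp)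
      finally show ?thesis .
    qed
    have "?h (rep P2) W W (?h W Z W \<iota>0 \<pi>0 \<oplus>\<^bsub>Hom (Mod K C) W W\<^esub> ?h W Z W \<iota>1 \<pi>1) w =
        ?h (rep P2) W W (?h W Z W \<iota>0 \<pi>0) w \<oplus>\<^bsub>Hom (Mod K C) (rep P2) W\<^esub> ?h (rep P2) W W (?h W Z W \<iota>1 \<pi>1) w"
      by (rule Mod.comp_add) simp_all
    also have "\<dots> = ?h (rep P2) (rep P2) W w (hom_map yo P2 P2 (Comp C P2 P P2 i0 p0)) \<oplus>\<^bsub>Hom (Mod K C) (rep P2) W\<^esub>
        ?h (rep P2) (rep P2) W w (hom_map yo P2 P2 (Comp C P2 P P2 i1 p1))"
      using t[of \<pi>0 \<iota>0 p0 i0] t[of \<pi>1 \<iota>1 p1 i1] by simp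
    also have "\<dots> = ?h (rep P2) (rep P2) W w (hom_map yo P2 P2 (Comp C P2 P P2 i0 p0 \<oplus>\<^bsub>Hom C P2 P2\<^esub> Comp C P2 P P2 i1 p1))"
      using yo.map_add[of P2 P2 "Comp C P2 P P2 i0 p0" "Comp C P2 P P2 i1 p1"] by (simp add: Mod.comp_add)
    also have "\<dots> = ?h (rep P2) W W (Ident (Mod K C) W) w"
      unfolding ip using yo.map_ident[of P2] by simp
    finally show "?h (rep P2) W W (?h W Z W \<iota>0 \<pi>0 \<oplus>\<^bsub>Hom (Mod K C) W W\<^esub> ?h W Z W \<iota>1 \<pi>1) w =
        ?h (rep P2) W W (Ident (Mod K C) W) w" .
  qed simp_all
  show ?thesis
  proof (rule that[of W "\<lambda>i. if i = 0 then \<iota>0 else \<iota>1" "\<lambda>i. if i = 0 then \<pi>0 else \<pi>1"])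
    show "is_direct_sum fp 2 (\<lambda>i. Z) W (\<lambda>i. if i = 0 then \<iota>0 else \<iota>1) (\<lambda>i. if i = 0 then \<pi>0 else \<pi>1)"
      unfolding fp.is_direct_sum_2_iff using c00 c11 c10 c01 sum by simp
  qed
qed

end

section \<open>The right adjoint of restriction is the Yoneda embedding\<close>

text \<open>
  From here on modules over \<open>mod(P)\<close> occur, whose elements are encoded by means of the sets of morphisms of
  \<open>mod(P)\<close>. These sets must keep the form in which they appear in the encoding, so that
  \<open>mod(P)\<close> and \<open>Mod(P)\<close> are no longer exchanged automatically.
\<close>

declare fp_mod_simps [simp del]

locale coherent_category = small_linear_category K P V
  for K :: "'k ring" and P :: "('k, 'o, 'm) kcat" and V :: "'v itself" +
  assumes infinite: "infinite (UNIV :: 'v set)"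
    and abelian: "abelian K (fp_mod K P :: ('k, ('k, 'o, 'm, 'v) cmodule, 'o \<Rightarrow> 'v \<Rightarrow> 'v) kcat)"
begin

sublocale B: small_additive_category K fp V
proof (intro small_additive_category.intro small_linear_category.intro
    small_linear_category_axioms.intro small_additive_category_axioms.intro)
  show "linear_category K fp" by (rule fp.linear_category_axioms)
  show "cring K" by (rule cring)
  show "locally_small V fp" by (rule fp_locally_small[OF infinite])
  show "Ob fp \<noteq> {}" using abelian by (auto simp: abelian_def is_zero_object_def)
  show "\<exists>S \<iota> \<pi>. is_direct_sum fp 2 (\<lambda>i. if i = 0 then X else Y) S \<iota> \<pi>"
    if "X \<in> Ob fp" "Y \<in> Ob fp" for X Y
    using abelian that unfolding abelian_def by blast
qed

lemma fp_arr: "arr fp M N = arr (Mod K P) M N" and fp_Comp: "Comp fp = Comp (Mod K P)"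
  and A_arr: "arr B.fp F G = arr (Mod K fp) F G" and A_Comp: "Comp B.fp = Comp (Mod K fp)"
  by (simp_all add: fp_mod_simps)

lemma yo_in_fp: "X \<in> Ob P \<Longrightarrow> Y \<in> Ob P \<Longrightarrow> f \<in> arr P X Y \<Longrightarrow> hom_map yo X Y f \<in> arr fp (rep X) (rep Y)"
  by (simp add: fp_arr)

lemma yon_in_fp: "M \<in> Ob fp \<Longrightarrow> X \<in> Ob P \<Longrightarrow> x \<in> elts M X \<Longrightarrow> yon M X x \<in> arr fp (rep X) M"
  by (simp add: fp_arr)

lemma B_yo_functor: "kfunctor K fp B.fp B.yo"
  using B.yo_functor B.rep_fp by (simp add: kfunctor_def fp_mod_simps(1)[of _ fp] fp_mod_simps(2)[of _ fp] fp_mod_simps(3)[of _ fp])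

sublocale B_yo: linear_functor K fp B.fp B.yo
  by (unfold_locales) (rule B_yo_functor)

end

locale mod_mod_localization = coherent_category K P V
  for K :: "'k ring" and P :: "('k, 'o, 'm) kcat" and V :: "'v itself" +
  fixes KL KR \<eta>L \<epsilon>L \<eta>R \<epsilon>R
  assumes KL: "adjunction K fp B.fp KL (res P) \<eta>L \<epsilon>L"
    and KR: "adjunction K B.fp fp (res P) KR \<eta>R \<epsilon>R"
begin

abbreviation r :: "(('k, 'o, 'm, 'v) bmodule, ('k, 'o, 'm, 'v) cmodule \<Rightarrow> 'v \<Rightarrow> 'v,
    ('k, 'o, 'm, 'v) cmodule, 'o \<Rightarrow> 'v \<Rightarrow> 'v) kfun" where "r \<equiv> res P"

abbreviation A :: "('k, ('k, 'o, 'm, 'v) bmodule, ('k, 'o, 'm, 'v) cmodule \<Rightarrow> 'v \<Rightarrow> 'v) kcat" where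
  "A \<equiv> B.fp"

sublocale L: adjoint_functors K fp A KL r \<eta>L \<epsilon>L
  by unfold_locales (rule KL)

sublocale R: adjoint_functors K A fp r KR \<eta>R \<epsilon>R
  by unfold_locales (rule KR)

lemma res_ob [simp]: "ob_map (ob_map r F) X = ob_map F (rep X)"
  by (simp add: res_def comp_functor_def op_functor_def)

lemma res_act: "hom_map (ob_map r F) Y X f = hom_map F (rep Y) (rep X) (hom_map yo X Y f)"
  by (simp add: res_def comp_functor_def op_functor_def)

lemma res_apply: "X \<in> Ob P \<Longrightarrow> hom_map r F G \<alpha> X = \<alpha> (rep X)"
  by (simp add: res_def)

text \<open>Evaluation at the identity identifies the restriction of \<open>M\<^sup>\<and>\<close> with \<open>M\<close>.\<close>

definition ev :: "('k, 'o, 'm, 'v) cmodule \<Rightarrow> 'o \<Rightarrow> 'v \<Rightarrow> 'v" where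
  "ev M = nt P (ob_map r (B.rep M)) (\<lambda>X c. B.dc (rep X) M c X (cd X X (Ident P X)))"

lemma ev_apply:
  "M \<in> Ob fp \<Longrightarrow> X \<in> Ob P \<Longrightarrow> t \<in> arr fp (rep X) M \<Longrightarrow> ev M X (B.cd (rep X) M t) = t X (cd X X (Ident P X))"
  by (simp add: ev_def)

lemma ev_in [simp]:
  assumes M [simp]: "M \<in> Ob fp"
  shows "ev M \<in> arr fp (ob_map r (B.rep M)) M"
proof -
  have "nt P (ob_map r (B.rep M)) (\<lambda>X c. B.dc (rep X) M c X (cd X X (Ident P X)))
      \<in> arr (Mod K P) (ob_map r (B.rep M)) M"
  proof (rule Mod_arrI)
    show "ob_map r (B.rep M) \<in> Ob (Mod K P)" by simp
    fix X assume X [simp]: "X \<in> Ob P"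
    let ?id = "cd X X (Ident P X)"
    show "linear_map K (ob_map (ob_map r (B.rep M)) X) (ob_map M X) (\<lambda>c. B.dc (rep X) M c X ?id)"
    proof (rule linear_mapI)
      fix c assume "c \<in> elts (ob_map r (B.rep M)) X"
      then obtain t where "t \<in> arr fp (rep X) M" "c = B.cd (rep X) M t" by (auto elim: B.rep_cases)
      then show "B.dc (rep X) M c X ?id \<in> elts M X" by (simp add: fp_arr[of "rep X" M] Mod_arr_in B.dc_cd[simplified fp_arr])
    next
      fix c c' assume "c \<in> elts (ob_map r (B.rep M)) X" "c' \<in> elts (ob_map r (B.rep M)) X"
      then obtain t t' where t: "t \<in> arr fp (rep X) M" "c = B.cd (rep X) M t"
        "t' \<in> arr fp (rep X) M" "c' = B.cd (rep X) M t'" by (auto elim!: B.rep_cases)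
      then have "B.dc (rep X) M (c \<oplus>\<^bsub>ob_map (ob_map r (B.rep M)) X\<^esub> c') = t \<oplus>\<^bsub>Hom fp (rep X) M\<^esub> t'"
        by (simp add: B.rep_add)
      moreover have "(t \<oplus>\<^bsub>Hom fp (rep X) M\<^esub> t') X ?id = t X ?id \<oplus>\<^bsub>ob_map M X\<^esub> t' X ?id"
        by (simp add: fp_mod_simps(1)[of K P] Mod_add)
      ultimately show "B.dc (rep X) M (c \<oplus>\<^bsub>ob_map (ob_map r (B.rep M)) X\<^esub> c') X ?id =
         B.dc (rep X) M c X ?id \<oplus>\<^bsub>ob_map M X\<^esub> B.dc (rep X) M c' X ?id" using t by simp
    next
      fix a c assume a: "a \<in> carrier K" and "c \<in> elts (ob_map r (B.rep M)) X"
      then obtain t where t: "t \<in> arr fp (rep X) M" "c = B.cd (rep X) M t" by (auto elim: B.rep_cases)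
      then have "B.dc (rep X) M (a \<odot>\<^bsub>ob_map (ob_map r (B.rep M)) X\<^esub> c) = a \<odot>\<^bsub>Hom fp (rep X) M\<^esub> t"
        using a by (simp add: B.rep_smult)
      moreover have "(a \<odot>\<^bsub>Hom fp (rep X) M\<^esub> t) X ?id = a \<odot>\<^bsub>ob_map M X\<^esub> t X ?id"
        by (simp add: fp_mod_simps(1)[of K P] Mod_smult)
      ultimately show "B.dc (rep X) M (a \<odot>\<^bsub>ob_map (ob_map r (B.rep M)) X\<^esub> c) X ?id =
         a \<odot>\<^bsub>ob_map M X\<^esub> B.dc (rep X) M c X ?id" using t by simp
    qed
  next
    fix X Y f c assume X [simp]: "X \<in> Ob P" and Y [simp]: "Y \<in> Ob P" and f [simp]: "f \<in> arr P X Y"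
      and "c \<in> elts (ob_map r (B.rep M)) Y"
    then obtain t where t: "t \<in> arr fp (rep Y) M" "c = B.cd (rep Y) M t" by (auto elim: B.rep_cases)
    have t': "t \<in> arr (Mod K P) (rep Y) M" using t by (simp add: fp_arr)
    have "B.dc (rep X) M (hom_map (ob_map r (B.rep M)) Y X f c) = Comp fp (rep X) (rep Y) M t (hom_map yo X Y f)"
      using t by (simp add: res_act B.rep_map yo_in_fp)
    then have "B.dc (rep X) M (hom_map (ob_map r (B.rep M)) Y X f c) X (cd X X (Ident P X)) = t X (cd X Y f)"
      by (simp add: fp_Comp Mod_Comp yo_apply)
    also have "\<dots> = hom_map M Y X f (t Y (cd Y Y (Ident P Y)))" by (rule arr_rep_apply[OF t' Y X f])
    finally show "B.dc (rep X) M (hom_map (ob_map r (B.rep M)) Y X f c) X (cd X X (Ident P X)) =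
        hom_map M Y X f (B.dc (rep Y) M c Y (cd Y Y (Ident P Y)))" using t by simp
  qed simp
  then show ?thesis by (simp only: ev_def fp_arr)
qed

lemma fp_invertible:
  "F \<in> Ob fp \<Longrightarrow> G \<in> Ob fp \<Longrightarrow> invertible fp F G f \<longleftrightarrow> invertible (Mod K P) F G f"
  by (simp add: invertible_def inverse_arr_def fp_mod_simps)

lemma ev_invertible:
  assumes M [simp]: "M \<in> Ob fp"
  shows "invertible fp (ob_map r (B.rep M)) M (ev M)"
proof -
  have "invertible (Mod K P) (ob_map r (B.rep M)) M (ev M)"
  proof (rule Mod_invertibleI)
    show "ev M \<in> arr (Mod K P) (ob_map r (B.rep M)) M" using ev_in[OF M] by (simp add: fp_arr)
    fix X assume X [simp]: "X \<in> Ob P"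
    show "bij_betw (ev M X) (elts (ob_map r (B.rep M)) X) (elts M X)"
    proof (rule bij_betwI')
      fix c c' assume "c \<in> elts (ob_map r (B.rep M)) X" "c' \<in> elts (ob_map r (B.rep M)) X"
      then obtain t t' where t: "t \<in> arr fp (rep X) M" "c = B.cd (rep X) M t"
        "t' \<in> arr fp (rep X) M" "c' = B.cd (rep X) M t'" by (auto elim!: B.rep_cases)
      show "ev M X c = ev M X c' \<longleftrightarrow> c = c'"
        using t arr_rep_eqI[of t X M t'] by (auto simp: ev_apply B.cd_eq_iff fp_arr[of "rep X" M, symmetric])
    next
      fix c assume "c \<in> elts (ob_map r (B.rep M)) X"
      then show "ev M X c \<in> elts M X"
        using Mod_arr_in[OF ev_in[OF M, unfolded fp_arr] X] by simp
    next
      fix x assume x: "x \<in> elts M X"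
      then have "ev M X (B.cd (rep X) M (yon M X x)) = x" by (simp add: ev_apply yon_in_fp)
      moreover have "B.cd (rep X) M (yon M X x) \<in> elts (ob_map r (B.rep M)) X"
        using x by (simp add: yon_in_fp)
      ultimately show "\<exists>c\<in>elts (ob_map r (B.rep M)) X. x = ev M X c" by metis
    qed
  qed
  then show ?thesis by (simp add: fp_invertible)
qed

lemma ev_natural:
  assumes [simp]: "M \<in> Ob fp" "N \<in> Ob fp" "f \<in> arr fp M N"
  shows "Comp fp (ob_map r (B.rep M)) (ob_map r (B.rep N)) N (ev N) (hom_map r (B.rep M) (B.rep N) (hom_map B.yo M N f)) =
    Comp fp (ob_map r (B.rep M)) M N f (ev M)"
proof -
  have 1: "Comp fp (ob_map r (B.rep M)) (ob_map r (B.rep N)) N (ev N) (hom_map r (B.rep M) (B.rep N) (hom_map B.yo M N f))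
      \<in> arr fp (ob_map r (B.rep M)) N"
    using B_yo.map_in[of M N f] by simp
  have 2: "Comp fp (ob_map r (B.rep M)) M N f (ev M) \<in> arr fp (ob_map r (B.rep M)) N" by simp
  show ?thesis
  proof (rule Mod_arr_eqI[OF 1[unfolded fp_arr] 2[unfolded fp_arr]])
    fix X c assume X [simp]: "X \<in> Ob P" and c: "c \<in> elts (ob_map r (B.rep M)) X"
    then obtain t where t [simp]: "t \<in> arr fp (rep X) M" and ct: "c = B.cd (rep X) M t" by (auto elim: B.rep_cases)
    have ft: "Comp fp (rep X) M N f t \<in> arr fp (rep X) N" by simp
    show "Comp fp (ob_map r (B.rep M)) (ob_map r (B.rep N)) N (ev N) (hom_map r (B.rep M) (B.rep N) (hom_map B.yo M N f)) X c =
        Comp fp (ob_map r (B.rep M)) M N f (ev M) X c"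
      using c ft by (simp add: fp_Comp[THEN fun_cong, of "ob_map r (B.rep M)"] Mod_Comp res_apply ct B.yo_apply ev_apply)
        (simp add: fp_Comp Mod_Comp)
  qed
qed

lemma yon_add:
  assumes "M \<in> Ob (Mod K P)" "X \<in> Ob P" "x \<in> elts M X" "y \<in> elts M X"
  shows "yon M X (x \<oplus>\<^bsub>ob_map M X\<^esub> y) = yon M X x \<oplus>\<^bsub>Hom (Mod K P) (rep X) M\<^esub> yon M X y"
proof -
  have s: "x \<oplus>\<^bsub>ob_map M X\<^esub> y \<in> elts M X"
    using abelian_groupE(1)[OF module_abelian_group[OF Mod_module[OF assms(1,2)]]] assms by blast
  show ?thesis
    by (rule arr_rep_eqI[of _ X M]) (use assms s in \<open>simp, simp, simp, simp add: Mod_add\<close>)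
qed

lemma yon_smult:
  assumes "M \<in> Ob (Mod K P)" "X \<in> Ob P" "a \<in> carrier K" "x \<in> elts M X"
  shows "yon M X (a \<odot>\<^bsub>ob_map M X\<^esub> x) = a \<odot>\<^bsub>Hom (Mod K P) (rep X) M\<^esub> yon M X x"
proof -
  have s: "a \<odot>\<^bsub>ob_map M X\<^esub> x \<in> elts M X"
    using module.smult_closed[OF Mod_module[OF assms(1,2)]] assms by blast
  show ?thesis
    by (rule arr_rep_eqI[of _ X M])
      (use assms s in \<open>simp, simp add: module.smult_closed[OF Mod.Hom_module], simp, simp add: Mod_smult\<close>)
qed

text \<open>
  The morphism \<open>\<alpha>\<close> that corresponds to \<open>\<beta>\<close> sends \<open>x \<in> F(X)\<close> to the morphism \<open>X \<rightarrow> M\<close> which maps \<open>p \<in> X(T)\<close>,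
  viewed as a morphism \<open>T\<^sup>\<and> \<rightarrow> X\<close>, to the image of \<open>F(p)(x)\<close> under \<open>\<beta>\<close>. Together with the uniqueness
  below, this is the universal property of a right adjoint of restriction at \<open>M\<close>.
\<close>

lemma ev_existence:
  assumes F: "F \<in> Ob A" and M [simp]: "M \<in> Ob fp" and \<beta>: "\<beta> \<in> arr fp (ob_map r F) M"
  obtains \<alpha> where "\<alpha> \<in> arr A F (B.rep M)"
    "Comp fp (ob_map r F) (ob_map r (B.rep M)) M (ev M) (hom_map r F (B.rep M) \<alpha>) = \<beta>"
proof -
  have FM [simp]: "F \<in> Ob (Mod K fp)" using F by simp
  have \<beta>': "\<beta> \<in> arr (Mod K P) (ob_map r F) M" using \<beta> by (simp add: fp_arr)
  note \<beta>lin = Mod_arr_linear[OF \<beta>', simplified]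
  \<comment> \<open>\<open>u X x\<close> is the morphism \<open>X \<rightarrow> M\<close> that \<open>\<alpha>\<close> assigns to \<open>x\<close>\<close>
  define u where "u = (\<lambda>X x. nt P X (\<lambda>T p. \<beta> T (hom_map F X (rep T) (yon X T p) x)))"
  have fin: "hom_map F X (rep T) (yon X T p) x \<in> elts F (rep T)"
    if "X \<in> Ob fp" "T \<in> Ob P" "p \<in> elts X T" "x \<in> elts F X" for X T p x
    using that by (simp add: fp.Mod_hom_in[OF FM] yon_in_fp)
  have u_in: "u X x \<in> arr fp X M" if X: "X \<in> Ob fp" and x: "x \<in> elts F X" for X x
    unfolding fp_arr u_def
  proof (rule Mod_arrI)
    have XM: "X \<in> Ob (Mod K P)" using X by simp
    fix T assume T [simp]: "T \<in> Ob P"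
    show "linear_map K (ob_map X T) (ob_map M T) (\<lambda>p. \<beta> T (hom_map F X (rep T) (yon X T p) x))"
    proof (rule linear_mapI)
      fix p assume p: "p \<in> elts X T"
      show "\<beta> T (hom_map F X (rep T) (yon X T p) x) \<in> elts M T"
        by (rule linear_in[OF \<beta>lin]) (use X x p fin in simp_all)
    next
      fix p p' assume p: "p \<in> elts X T" "p' \<in> elts X T"
      have "hom_map F X (rep T) (yon X T (p \<oplus>\<^bsub>ob_map X T\<^esub> p')) x =
          hom_map F X (rep T) (yon X T p) x \<oplus>\<^bsub>ob_map F (rep T)\<^esub> hom_map F X (rep T) (yon X T p') x"
        using fp.Mod_hom_add[OF FM, of "rep T" X "yon X T p" "yon X T p'" x] X x p
        by (simp add: yon_add[OF XM] yon_in_fp fp_mod_simps(1)[of K P])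
      then show "\<beta> T (hom_map F X (rep T) (yon X T (p \<oplus>\<^bsub>ob_map X T\<^esub> p')) x) =
          \<beta> T (hom_map F X (rep T) (yon X T p) x) \<oplus>\<^bsub>ob_map M T\<^esub> \<beta> T (hom_map F X (rep T) (yon X T p') x)"
        using X x p by (simp add: linear_add[OF \<beta>lin] fin)
    next
      fix a p assume a: "a \<in> carrier K" and p: "p \<in> elts X T"
      have "hom_map F X (rep T) (yon X T (a \<odot>\<^bsub>ob_map X T\<^esub> p)) x =
          a \<odot>\<^bsub>ob_map F (rep T)\<^esub> hom_map F X (rep T) (yon X T p) x"
        using fp.Mod_hom_smult[OF FM, of "rep T" X a "yon X T p" x] X x p a
        by (simp add: yon_smult[OF XM] yon_in_fp fp_mod_simps(1)[of K P])
      then show "\<beta> T (hom_map F X (rep T) (yon X T (a \<odot>\<^bsub>ob_map X T\<^esub> p)) x) =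
          a \<odot>\<^bsub>ob_map M T\<^esub> \<beta> T (hom_map F X (rep T) (yon X T p) x)"
        using X x p a by (simp add: linear_smult[OF \<beta>lin] fin)
    qed
  next
    fix T T' f p assume *: "T \<in> Ob P" "T' \<in> Ob P" "f \<in> arr P T T'" "p \<in> elts X T'"
    have "yon X T (hom_map X T' T f p) = Comp fp (rep T) (rep T') X (yon X T' p) (hom_map yo T T' f)"
      using yon_comp_yo[of X T' T p f] * X by (simp add: fp_Comp)
    then have "hom_map F X (rep T) (yon X T (hom_map X T' T f p)) x =
        hom_map (ob_map r F) T' T f (hom_map F X (rep T') (yon X T' p) x)"
      using * X x by (simp add: res_act fp.Mod_hom_comp[OF FM] yon_in_fp yo_in_fp)
    then show "\<beta> T (hom_map F X (rep T) (yon X T (hom_map X T' T f p)) x) =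
        hom_map M T' T f (\<beta> T' (hom_map F X (rep T') (yon X T' p) x))"
      using Mod_arr_natural[OF \<beta>' *(1-3)] * X x by (simp add: fin)
  qed (use X in simp_all)
  have u_apply: "u X x T p = \<beta> T (hom_map F X (rep T) (yon X T p) x)" if "T \<in> Ob P" "p \<in> elts X T" for X x T p
    using that by (simp add: u_def)
  define \<alpha> where "\<alpha> = nt fp F (\<lambda>X x. B.cd X M (u X x))"
  have \<alpha>: "\<alpha> \<in> arr (Mod K fp) F (B.rep M)"
    unfolding \<alpha>_def
  proof (rule fp.Mod_arrI)
    fix X assume X: "X \<in> Ob fp"
    show "linear_map K (ob_map F X) (ob_map (B.rep M) X) (\<lambda>x. B.cd X M (u X x))"
    proof (rule linear_mapI)
      fix x assume "x \<in> elts F X" then show "B.cd X M (u X x) \<in> elts (B.rep M) X" using X u_in by simp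
    next
      fix x x' assume x: "x \<in> elts F X" "x' \<in> elts F X"
      have xx: "x \<oplus>\<^bsub>ob_map F X\<^esub> x' \<in> elts F X"
        using abelian_groupE(1)[OF module_abelian_group[OF fp.Mod_module[OF FM X]]] x by blast
      have "u X (x \<oplus>\<^bsub>ob_map F X\<^esub> x') = u X x \<oplus>\<^bsub>Hom fp X M\<^esub> u X x'"
      proof (rule Mod_arr_eqI)
        show "u X (x \<oplus>\<^bsub>ob_map F X\<^esub> x') \<in> arr (Mod K P) X M" using u_in[OF X xx] by (simp add: fp_arr)
        show "u X x \<oplus>\<^bsub>Hom fp X M\<^esub> u X x' \<in> arr (Mod K P) X M"
          using fp.add_in[OF X M u_in[OF X x(1)] u_in[OF X x(2)]] by (simp add: fp_arr)
        fix T p assume T: "T \<in> Ob P" "p \<in> elts X T"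
        show "u X (x \<oplus>\<^bsub>ob_map F X\<^esub> x') T p = (u X x \<oplus>\<^bsub>Hom fp X M\<^esub> u X x') T p"
          using T X x by (simp add: fp_mod_simps(1)[of K P] Mod_add u_apply linear_add[OF fp.Mod_hom_linear[OF FM]] yon_in_fp[unfolded fp_arr]
              fp_arr linear_add[OF \<beta>lin] fin)
      qed
      then show "B.cd X M (u X (x \<oplus>\<^bsub>ob_map F X\<^esub> x')) = B.cd X M (u X x) \<oplus>\<^bsub>ob_map (B.rep M) X\<^esub> B.cd X M (u X x')"
        using X x by (simp add: B.rep_add u_in)
    next
      fix a x assume a: "a \<in> carrier K" and x: "x \<in> elts F X"
      have xx: "a \<odot>\<^bsub>ob_map F X\<^esub> x \<in> elts F X"
        using module.smult_closed[OF fp.Mod_module[OF FM X]] x a by blast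
      have "u X (a \<odot>\<^bsub>ob_map F X\<^esub> x) = a \<odot>\<^bsub>Hom fp X M\<^esub> u X x"
      proof (rule Mod_arr_eqI)
        show "u X (a \<odot>\<^bsub>ob_map F X\<^esub> x) \<in> arr (Mod K P) X M" using u_in[OF X xx] by (simp add: fp_arr)
        show "a \<odot>\<^bsub>Hom fp X M\<^esub> u X x \<in> arr (Mod K P) X M"
          using module.smult_closed[OF fp.Hom_module[OF X M] a u_in[OF X x]] by (simp add: fp_arr)
        fix T p assume T: "T \<in> Ob P" "p \<in> elts X T"
        show "u X (a \<odot>\<^bsub>ob_map F X\<^esub> x) T p = (a \<odot>\<^bsub>Hom fp X M\<^esub> u X x) T p"
          using T X x a by (simp add: fp_mod_simps(1)[of K P] Mod_smult u_apply linear_smult[OF fp.Mod_hom_linear[OF FM]]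
              fp_arr linear_smult[OF \<beta>lin] fin)
      qed
      then show "B.cd X M (u X (a \<odot>\<^bsub>ob_map F X\<^esub> x)) = a \<odot>\<^bsub>ob_map (B.rep M) X\<^esub> B.cd X M (u X x)"
        using X x by (simp add: B.rep_smult u_in)
    qed
  next
    fix X Y s y assume X: "X \<in> Ob fp" and Y: "Y \<in> Ob fp" and s: "s \<in> arr fp X Y" and y: "y \<in> elts F Y"
    have sy: "hom_map F Y X s y \<in> elts F X" using fp.Mod_hom_in[OF FM X Y s y] .
    have "u X (hom_map F Y X s y) = Comp fp X Y M (u Y y) s"
    proof (rule Mod_arr_eqI)
      show "u X (hom_map F Y X s y) \<in> arr (Mod K P) X M" using u_in[OF X sy] by (simp add: fp_arr)
      show "Comp fp X Y M (u Y y) s \<in> arr (Mod K P) X M"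
        using fp.comp_in[OF X Y M s u_in[OF Y y]] by (simp add: fp_arr)
      fix T p assume T: "T \<in> Ob P" "p \<in> elts X T"
      have s': "s \<in> arr (Mod K P) X Y" using s by (simp add: fp_arr)
      have "hom_map F X (rep T) (yon X T p) (hom_map F Y X s y) = hom_map F Y (rep T) (Comp fp (rep T) X Y s (yon X T p)) y"
        using X Y s y T by (simp add: fp.Mod_hom_comp[OF FM] yon_in_fp)
      also have "Comp fp (rep T) X Y s (yon X T p) = yon Y T (s T p)"
        using comp_yon[OF _ T s'] X by (simp add: fp_Comp)
      finally show "u X (hom_map F Y X s y) T p = Comp fp X Y M (u Y y) s T p"
        using T Mod_arr_in[OF s' T] by (simp add: u_apply fp_Comp Mod_Comp)
    qed
    then show "B.cd X M (u X (hom_map F Y X s y)) = hom_map (B.rep M) Y X s (B.cd Y M (u Y y))"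
      using X Y s y by (simp add: B.rep_map u_in)
  qed simp_all
  have \<alpha>A: "\<alpha> \<in> arr A F (B.rep M)" using \<alpha> by (simp add: A_arr)
  have c: "Comp fp (ob_map r F) (ob_map r (B.rep M)) M (ev M) (hom_map r F (B.rep M) \<alpha>) \<in> arr fp (ob_map r F) M"
    using F \<alpha>A by simp
  have "Comp fp (ob_map r F) (ob_map r (B.rep M)) M (ev M) (hom_map r F (B.rep M) \<alpha>) = \<beta>"
  proof (rule Mod_arr_eqI[OF c[unfolded fp_arr] \<beta>'])
    fix T x assume T [simp]: "T \<in> Ob P" and x': "x \<in> elts (ob_map r F) T"
    then have x: "x \<in> elts F (rep T)" by simp
    have id: "yon (rep T) T (cd T T (Ident P T)) = Ident fp (rep T)"
    proof (rule arr_rep_eqI[of _ T "rep T"])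
      show "Ident fp (rep T) \<in> arr (Mod K P) (rep T) (rep T)"
        using fp.ident_in[OF rep_fp[OF T]] by (simp add: fp_arr)
    qed (simp_all add: fp_mod_simps(3)[of K P] Mod_Ident)
    have "Comp fp (ob_map r F) (ob_map r (B.rep M)) M (ev M) (hom_map r F (B.rep M) \<alpha>) T x = ev M T (\<alpha> (rep T) x)"
      using x by (simp add: fp_Comp Mod_Comp res_apply)
    also have "\<dots> = u (rep T) x T (cd T T (Ident P T))"
      using x by (simp add: \<alpha>_def ev_apply u_in)
    also have "\<dots> = \<beta> T x" using x by (simp add: u_apply id fp.Mod_hom_ident[OF FM])
    finally show "Comp fp (ob_map r F) (ob_map r (B.rep M)) M (ev M) (hom_map r F (B.rep M) \<alpha>) T x = \<beta> T x" .
  qed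
  with \<alpha>A show ?thesis by (rule that)
qed

text \<open>
  The value of \<open>\<alpha>\<close> at \<open>x \<in> F(X)\<close> is a morphism \<open>X \<rightarrow> M\<close>, determined by its effect on elements \<open>p \<in> X(T)\<close>.
  By naturality along \<open>p : T\<^sup>\<and> \<rightarrow> X\<close> that effect is read off from the restriction of \<open>\<alpha>\<close>.
\<close>

lemma ev_uniqueness:
  assumes M [simp]: "M \<in> Ob fp" and \<alpha>: "\<alpha> \<in> arr A F (B.rep M)" and \<alpha>': "\<alpha>' \<in> arr A F (B.rep M)"
    and eq: "Comp fp (ob_map r F) (ob_map r (B.rep M)) M (ev M) (hom_map r F (B.rep M) \<alpha>) =
       Comp fp (ob_map r F) (ob_map r (B.rep M)) M (ev M) (hom_map r F (B.rep M) \<alpha>')"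
  shows "\<alpha> = \<alpha>'"
proof -
  have a: "\<alpha> \<in> arr (Mod K fp) F (B.rep M)" "\<alpha>' \<in> arr (Mod K fp) F (B.rep M)" using \<alpha> \<alpha>' by (simp_all add: A_arr)
  have FM: "F \<in> Ob (Mod K fp)" by (rule fp.Mod_arr_source[OF a(1)])
  show ?thesis
  proof (rule fp.Mod_arr_eqI[OF a])
    fix X x assume X [simp]: "X \<in> Ob fp" and x: "x \<in> elts F X"
    have key: "m T p = Comp fp (ob_map r F) (ob_map r (B.rep M)) M (ev M) (hom_map r F (B.rep M) \<alpha>) T (hom_map F X (rep T) (yon X T p) x)"
      if \<alpha>: "\<alpha> \<in> arr (Mod K fp) F (B.rep M)" and m: "m \<in> arr fp X M" "\<alpha> X x = B.cd X M m"
        and T [simp]: "T \<in> Ob P" and p: "p \<in> elts X T" for \<alpha> m T p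
    proof -
      have y: "yon X T p \<in> arr fp (rep T) X" using p by (simp add: yon_in_fp)
      have "Comp fp (ob_map r F) (ob_map r (B.rep M)) M (ev M) (hom_map r F (B.rep M) \<alpha>) T (hom_map F X (rep T) (yon X T p) x) =
          ev M T (\<alpha> (rep T) (hom_map F X (rep T) (yon X T p) x))"
        using x y by (simp add: fp_Comp Mod_Comp res_apply fp.Mod_hom_in[OF FM])
      also have "\<dots> = ev M T (hom_map (B.rep M) X (rep T) (yon X T p) (B.cd X M m))"
        using fp.Mod_arr_natural[OF \<alpha> _ X y x] m by simp
      also have "\<dots> = Comp fp (rep T) X M m (yon X T p) T (cd T T (Ident P T))"
        using m y by (simp add: B.rep_map ev_apply)
      also have "\<dots> = m T p" using p by (simp add: fp_Comp Mod_Comp)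
      finally show ?thesis by simp
    qed
    obtain m where m: "m \<in> arr fp X M" "\<alpha> X x = B.cd X M m"
      using fp.Mod_arr_in[OF a(1) X x] by (rule B.rep_cases)
    obtain m' where m': "m' \<in> arr fp X M" "\<alpha>' X x = B.cd X M m'"
      using fp.Mod_arr_in[OF a(2) X x] by (rule B.rep_cases)
    have "m = m'"
    proof (rule Mod_arr_eqI[OF m(1)[unfolded fp_arr] m'(1)[unfolded fp_arr]])
      fix T p assume "T \<in> Ob P" "p \<in> elts X T"
      then show "m T p = m' T p" using key[OF a(1) m] key[OF a(2) m'] eq by simp
    qed
    then show "\<alpha> X x = \<alpha>' X x" using m m' by simp
  qed
qed

end

context mod_mod_localization
begin

text \<open>
  Both \<open>(M\<^sup>\<and>, ev M)\<close> and \<open>(KR M, \<epsilon>R M)\<close> are terminal among the modules \<open>F\<close> with a morphism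
  from the restriction of \<open>F\<close> to \<open>M\<close>.
\<close>

definition comparison :: "('k, 'o, 'm, 'v) cmodule \<Rightarrow> ('k, 'o, 'm, 'v) cmodule \<Rightarrow> 'v \<Rightarrow> 'v" where
  "comparison = (\<lambda>M\<in>Ob fp. Comp A (B.rep M) (ob_map KR (ob_map r (B.rep M))) (ob_map KR M)
     (hom_map KR (ob_map r (B.rep M)) M (ev M)) (\<eta>R (B.rep M)))"

lemma res_rep_Ob [simp]: "M \<in> Ob fp \<Longrightarrow> ob_map r (B.rep M) \<in> Ob fp"
  using L.G.ob_in[of "B.rep M"] by simp

lemma comparison_in [simp]: "M \<in> Ob fp \<Longrightarrow> comparison M \<in> arr A (B.rep M) (ob_map KR M)"
  using R.unit_in[of "B.rep M"] R.G.map_in[OF res_rep_Ob _ ev_in, of M] by (simp add: comparison_def)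

lemma counit_comparison:
  assumes M [simp]: "M \<in> Ob fp"
  shows "Comp fp (ob_map r (B.rep M)) (ob_map r (ob_map KR M)) M (\<epsilon>R M) (hom_map r (B.rep M) (ob_map KR M) (comparison M)) = ev M"
  using R.transpose_back[of "B.rep M" M "ev M"] by (simp add: comparison_def)

text \<open>
  The inverse is the morphism provided by the universal property of \<open>(M\<^sup>\<and>, ev M)\<close> for \<open>(KR M, \<epsilon>R M)\<close>.
\<close>

lemma comparison_inverse:
  assumes M [simp]: "M \<in> Ob fp"
  obtains \<psi> where "inverse_arr A (B.rep M) (ob_map KR M) (comparison M) \<psi>"
    "Comp fp (ob_map r (ob_map KR M)) (ob_map r (B.rep M)) M (ev M) (hom_map r (ob_map KR M) (B.rep M) \<psi>) = \<epsilon>R M"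
proof -
  let ?M = "B.rep M" and ?R = "ob_map KR M" and ?r = "ob_map r"
  obtain \<psi> where \<psi> [simp]: "\<psi> \<in> arr A ?R ?M"
    and ev\<psi>: "Comp fp (?r ?R) (?r ?M) M (ev M) (hom_map r ?R ?M \<psi>) = \<epsilon>R M"
    using ev_existence[of ?R M "\<epsilon>R M"] by auto
  have "Comp A ?R ?M ?R (comparison M) \<psi> = Ident A ?R"
  proof (rule R.transpose_right_unique[of ?R M])
    have "Comp fp (?r ?R) (?r ?R) M (\<epsilon>R M) (hom_map r ?R ?R (Comp A ?R ?M ?R (comparison M) \<psi>)) =
      Comp fp (?r ?R) (?r ?M) M (Comp fp (?r ?M) (?r ?R) M (\<epsilon>R M) (hom_map r ?M ?R (comparison M))) (hom_map r ?R ?M \<psi>)"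
      by (simp add: L.G.map_comp fp.comp_assoc)
    also have "\<dots> = Comp fp (?r ?R) (?r ?R) M (\<epsilon>R M) (hom_map r ?R ?R (Ident A ?R))"
      unfolding counit_comparison[OF M] by (simp add: ev\<psi>)
    finally show "Comp fp (?r ?R) (?r ?R) M (\<epsilon>R M) (hom_map r ?R ?R (Comp A ?R ?M ?R (comparison M) \<psi>)) =
      Comp fp (?r ?R) (?r ?R) M (\<epsilon>R M) (hom_map r ?R ?R (Ident A ?R))" .
  qed simp_all
  moreover have "Comp A ?M ?R ?M \<psi> (comparison M) = Ident A ?M"
  proof (rule ev_uniqueness[OF M, of _ ?M])
    have "Comp fp (?r ?M) (?r ?M) M (ev M) (hom_map r ?M ?M (Comp A ?M ?R ?M \<psi> (comparison M))) =
      Comp fp (?r ?M) (?r ?R) M (Comp fp (?r ?R) (?r ?M) M (ev M) (hom_map r ?R ?M \<psi>)) (hom_map r ?M ?R (comparison M))"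
      using L.G.map_in[of ?R ?M \<psi>] L.G.map_in[of ?M ?R "comparison M"] by (simp add: L.G.map_comp fp.comp_assoc del: L.G.map_in)
    also have "\<dots> = ev M" unfolding ev\<psi> by (rule counit_comparison[OF M])
    also have "\<dots> = Comp fp (?r ?M) (?r ?M) M (ev M) (hom_map r ?M ?M (Ident A ?M))"
      using L.G.map_ident[of ?M] by simp
    finally show "Comp fp (?r ?M) (?r ?M) M (ev M) (hom_map r ?M ?M (Comp A ?M ?R ?M \<psi> (comparison M))) =
       Comp fp (?r ?M) (?r ?M) M (ev M) (hom_map r ?M ?M (Ident A ?M))" .
  qed simp_all
  ultimately have "inverse_arr A ?M ?R (comparison M) \<psi>" by (simp add: inverse_arr_def)
  then show ?thesis using ev\<psi> by (rule that)
qed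

lemma comparison_invertible: "M \<in> Ob fp \<Longrightarrow> invertible A (B.rep M) (ob_map KR M) (comparison M)"
  by (rule comparison_inverse) (auto simp: invertible_def)

lemma comparison_nat_iso: "nat_iso K fp A B.yo KR comparison"
  unfolding nat_iso_def nat_trans_def
proof (intro conjI ballI)
  show "kfunctor K fp A B.yo" by (rule B_yo_functor)
  show "kfunctor K fp A KR" by (rule R.G.kfunctor)
  show "comparison \<in> extensional (Ob fp)" by (simp add: comparison_def)
  fix M assume M [simp]: "M \<in> Ob fp"
  show "comparison M \<in> arr A (ob_map B.yo M) (ob_map KR M)" by simp
  show "invertible A (ob_map B.yo M) (ob_map KR M) (comparison M)" by (simp add: comparison_invertible)
  fix N f assume N [simp]: "N \<in> Ob fp" and f [simp]: "f \<in> arr fp M N"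
  let ?M = "B.rep M" and ?N = "B.rep N" and ?r = "ob_map r" and ?R = "ob_map KR"
  have y [simp]: "hom_map B.yo M N f \<in> arr A ?M ?N" using B_yo.map_in[of M N f] by simp
  have "Comp A ?M (?R M) (?R N) (hom_map KR M N f) (comparison M) = Comp A ?M ?N (?R N) (comparison N) (hom_map B.yo M N f)"
  proof (rule R.transpose_right_unique[of ?M N])
    have "Comp fp (?r ?M) (?r (?R N)) N (\<epsilon>R N) (hom_map r ?M (?R N) (Comp A ?M (?R M) (?R N) (hom_map KR M N f) (comparison M))) =
       Comp fp (?r ?M) (?r (?R M)) N (Comp fp (?r (?R M)) (?r (?R N)) N (\<epsilon>R N) (hom_map r (?R M) (?R N) (hom_map KR M N f))) (hom_map r ?M (?R M) (comparison M))"
      by (simp add: L.G.map_comp fp.comp_assoc)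
    also have "\<dots> = Comp fp (?r ?M) M N f (Comp fp (?r ?M) (?r (?R M)) M (\<epsilon>R M) (hom_map r ?M (?R M) (comparison M)))"
      by (simp add: R.counit_natural fp.comp_assoc)
    also have "\<dots> = Comp fp (?r ?M) (?r ?N) N (ev N) (hom_map r ?M ?N (hom_map B.yo M N f))"
      unfolding counit_comparison[OF M] by (simp add: ev_natural)
    also have "\<dots> = Comp fp (?r ?M) (?r ?N) N (Comp fp (?r ?N) (?r (?R N)) N (\<epsilon>R N) (hom_map r ?N (?R N) (comparison N))) (hom_map r ?M ?N (hom_map B.yo M N f))"
      unfolding counit_comparison[OF N] ..
    also have "\<dots> = Comp fp (?r ?M) (?r (?R N)) N (\<epsilon>R N) (hom_map r ?M (?R N) (Comp A ?M ?N (?R N) (comparison N) (hom_map B.yo M N f)))"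
      by (simp add: L.G.map_comp fp.comp_assoc)
    finally show "Comp fp (?r ?M) (?r (?R N)) N (\<epsilon>R N) (hom_map r ?M (?R N) (Comp A ?M (?R M) (?R N) (hom_map KR M N f) (comparison M))) =
      Comp fp (?r ?M) (?r (?R N)) N (\<epsilon>R N) (hom_map r ?M (?R N) (Comp A ?M ?N (?R N) (comparison N) (hom_map B.yo M N f)))" .
  qed simp_all
  then show "Comp A (ob_map B.yo M) (ob_map KR M) (ob_map KR N) (hom_map KR M N f) (comparison M) =
       Comp A (ob_map B.yo M) (ob_map B.yo N) (ob_map KR N) (comparison N) (hom_map B.yo M N f)" by simp
qed

text \<open>
  Up to the comparison isomorphism the counit at \<open>M\<close> is \<open>ev M\<close>, so that \<open>KR\<close> is fully faithful.
\<close>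

lemma counit_invertible:
  assumes M [simp]: "M \<in> Ob fp"
  shows "invertible fp (ob_map r (ob_map KR M)) M (\<epsilon>R M)"
proof -
  let ?M = "B.rep M" and ?R = "ob_map KR M" and ?r = "ob_map r"
  obtain \<psi> where \<psi>: "inverse_arr A ?M ?R (comparison M) \<psi>"
    and ev\<psi>: "Comp fp (?r ?R) (?r ?M) M (ev M) (hom_map r ?R ?M \<psi>) = \<epsilon>R M"
    by (rule comparison_inverse[OF M])
  have \<psi>' [simp]: "\<psi> \<in> arr A ?R ?M" and c\<psi>: "Comp A ?R ?M ?R (comparison M) \<psi> = Ident A ?R"
    using \<psi> by (auto simp: inverse_arr_def)
  obtain e where e [simp]: "e \<in> arr fp M (?r ?M)" and
    ee: "Comp fp (?r ?M) M (?r ?M) e (ev M) = Ident fp (?r ?M)" "Comp fp M (?r ?M) M (ev M) e = Ident fp M"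
    using ev_invertible[OF M] by (rule fp.invertibleE)
  let ?c = "hom_map r ?M ?R (comparison M)" and ?p = "hom_map r ?R ?M \<psi>"
  have cp: "?c \<in> arr fp (?r ?M) (?r ?R)" "?p \<in> arr fp (?r ?R) (?r ?M)"
    using L.G.map_in[of ?M ?R "comparison M"] L.G.map_in[of ?R ?M \<psi>] by simp_all
  have rc: "Comp fp (?r ?R) (?r ?M) (?r ?R) ?c ?p = Ident fp (?r ?R)"
    using L.G.map_comp[of ?R ?M ?R \<psi> "comparison M"] L.G.map_ident[of ?R] by (simp add: c\<psi>)
  let ?i = "Comp fp M (?r ?M) (?r ?R) ?c e"
  have "Comp fp M (?r ?R) M (\<epsilon>R M) ?i = Comp fp M (?r ?M) M (Comp fp (?r ?M) (?r ?R) M (\<epsilon>R M) ?c) e"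
    using cp by (simp add: fp.comp_assoc)
  also have "\<dots> = Ident fp M" unfolding counit_comparison[OF M] by (rule ee)
  finally have 1: "Comp fp M (?r ?R) M (\<epsilon>R M) ?i = Ident fp M" .
  have "Comp fp (?r ?R) M (?r ?R) ?i (Comp fp (?r ?R) (?r ?M) M (ev M) ?p) =
      Comp fp (?r ?R) (?r ?M) (?r ?R) ?c (Comp fp (?r ?R) (?r ?M) (?r ?M) (Comp fp (?r ?M) M (?r ?M) e (ev M)) ?p)"
    using cp by (simp add: fp.comp_assoc)
  also have "\<dots> = Ident fp (?r ?R)" unfolding ee using cp by (simp add: rc)
  finally have 2: "Comp fp (?r ?R) M (?r ?R) ?i (\<epsilon>R M) = Ident fp (?r ?R)" unfolding ev\<psi> .
  have "inverse_arr fp (?r ?R) M (\<epsilon>R M) ?i" using 1 2 cp by (simp add: inverse_arr_def)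
  then show ?thesis by (auto simp: invertible_def)
qed

sublocale adjoint_triple K A fp r KL KR \<eta>L \<epsilon>L \<eta>R \<epsilon>R
  by unfold_locales (rule counit_invertible)

section \<open>The canonical morphism on projectives\<close>

text \<open>
  For a representable \<open>T = P(?, X)\<close>, the modules \<open>KL T\<close> and \<open>T\<^sup>\<and>\<close> both represent the functor
  \<open>F \<mapsto> F(T)\<close>. The morphism \<open>T\<^sup>\<and> \<rightarrow> KL T\<close> is the one given by the Yoneda lemma.
\<close>

lemma can_rep_invertible:
  assumes X [simp]: "X \<in> Ob P"
  shows "invertible A (ob_map KL (rep X)) (ob_map KR (rep X)) (can (rep X))"
proof -
  let ?T = "rep X" let ?LT = "ob_map KL ?T" and ?r = "ob_map r"
  define y where "y = \<eta>L ?T X (cd X X (Ident P X))"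
  have \<eta>: "\<eta>L ?T \<in> arr (Mod K P) ?T (?r ?LT)" using L.unit_in[of ?T] by (simp add: fp_arr)
  have y [simp]: "y \<in> elts ?LT ?T" using Mod_arr_in[OF \<eta> X, of "cd X X (Ident P X)"] by (simp add: y_def)
  let ?d = "B.yon ?LT ?T y"
  have LT [simp]: "?LT \<in> Ob A" by simp
  have d: "?d \<in> arr A (B.rep ?T) ?LT" using B.yon_in[of ?LT ?T y] by (simp add: A_arr)
  have rd: "hom_map r (B.rep ?T) ?LT ?d \<in> arr fp (?r (B.rep ?T)) (?r ?LT)"
    using L.G.map_in[OF _ _ d] by simp
  have c: "Comp fp (?r (B.rep ?T)) ?T (?r ?LT) (\<eta>L ?T) (ev ?T) \<in> arr fp (?r (B.rep ?T)) (?r ?LT)"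
    using L.unit_in[of ?T] L.G.ob_in[OF LT] by simp
  have eq: "hom_map r (B.rep ?T) ?LT ?d = Comp fp (?r (B.rep ?T)) ?T (?r ?LT) (\<eta>L ?T) (ev ?T)"
  proof (rule Mod_arr_eqI[OF rd[unfolded fp_arr] c[unfolded fp_arr]])
    fix U c assume U [simp]: "U \<in> Ob P" and c': "c \<in> elts (?r (B.rep ?T)) U"
    then obtain t where t [simp]: "t \<in> arr fp (rep U) ?T" and ct: "c = B.cd (rep U) ?T t" by (auto elim: B.rep_cases)
    obtain u where u [simp]: "u \<in> arr P U X" and tu: "t = hom_map yo U X u"
      using yo_full[OF t[unfolded fp_arr] U X] .
    have "hom_map r (B.rep ?T) ?LT ?d U c = hom_map ?LT ?T (rep U) t y"
      by (simp add: res_apply ct B.yon_apply)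
    also have "\<dots> = hom_map (?r ?LT) X U u y" by (simp add: res_act tu)
    also have "\<dots> = \<eta>L ?T U (cd U X u)"
      unfolding y_def by (rule arr_rep_apply[OF \<eta> X U u, symmetric])
    also have "\<dots> = \<eta>L ?T U (ev ?T U c)" by (simp add: ct ev_apply tu yo_in_fp yo_apply)
    also have "\<dots> = Comp fp (?r (B.rep ?T)) ?T (?r ?LT) (\<eta>L ?T) (ev ?T) U c"
      using c' by (simp add: fp_Comp Mod_Comp)
    finally show "hom_map r (B.rep ?T) ?LT ?d U c = Comp fp (?r (B.rep ?T)) ?T (?r ?LT) (\<eta>L ?T) (ev ?T) U c" .
  qed
  show ?thesis
    by (rule can_invertibleI[OF _ _ comparison_invertible d]) (simp_all add: counit_comparison eq)
qed

text \<open>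
  A finitely generated projective module is a direct factor of a finite sum of representables.
\<close>

lemma can_fg_projective_invertible:
  assumes Q: "fg_projective K P Q"
  shows "invertible A (ob_map KL Q) (ob_map KR Q) (can Q)"
proof -
  obtain n :: nat and X a b where X: "\<And>i. i < n \<Longrightarrow> X i \<in> Ob P"
    and a: "\<And>i. i < n \<Longrightarrow> a i \<in> arr (Mod K P) (rep (X i)) Q"
    and b: "\<And>i. i < n \<Longrightarrow> b i \<in> arr (Mod K P) Q (rep (X i))"
    and sum: "finsum (Hom (Mod K P) Q Q) (\<lambda>i. Comp (Mod K P) Q (rep (X i)) Q (a i) (b i)) {..<n} = Ident (Mod K P) Q"
    by (rule fg_projective_retract[OF Q]) (rule that; assumption?; blast)
  show ?thesis
  proof (rule can_invertible_sum[where X = "\<lambda>i. rep (X i)" and a = a and b = b and n = n])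
    show "Q \<in> Ob fp" by (rule fg_projective_fp[OF Q])
    show "finsum (Hom fp Q Q) (\<lambda>i. Comp fp Q (rep (X i)) Q (a i) (b i)) {..<n} = Ident fp Q"
      using sum by (simp add: fp_mod_simps[of K P])
  qed (use X a b can_rep_invertible in \<open>simp_all add: fp_arr\<close>)
qed

section \<open>Injectives and intermediate extensions\<close>

text \<open>
  Restriction is right adjoint to \<open>KL\<close>, hence preserves monomorphisms, hence its right adjoint preserves
  injectives.
\<close>

lemma KR_injective: "injective fp I \<Longrightarrow> injective A (ob_map KR I)"
  by (rule R.right_adjoint_injective[OF L.right_adjoint_monic])

lemma KR_projective:
  assumes "M \<in> Ob fp"
  shows "projective A (ob_map KR M)"
  using B.fp.projective_iso[OF B.rep_projective[OF assms] _ comparison_invertible[OF assms]] assms by simp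

lemma rep_injective:
  assumes I: "injective fp I"
  shows "injective A (B.rep I)"
proof -
  have M: "I \<in> Ob fp" using I by (simp add: injective_def)
  obtain \<psi> where "inverse_arr A (B.rep I) (ob_map KR I) (comparison I) \<psi>" by (rule comparison_inverse[OF M])
  then have "inverse_arr A (ob_map KR I) (B.rep I) \<psi> (comparison I)" by (simp add: inverse_arr_def)
  then show ?thesis
    using B.fp.injective_iso[OF KR_injective[OF I] B.rep_fp[OF M]] by (auto simp: invertible_def)
qed

text \<open>
  Since \<open>can P0\<close> is invertible, \<open>can M\<close> has the same cokernel as \<open>KR f\<close>. Transported along \<open>\<phi>\<close>, this makes \<open>Z\<close>
  the image of \<open>f\<^sup>\<and> : P0\<^sup>\<and> \<rightarrow> M\<^sup>\<and>\<close>.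
\<close>

lemma intermediate_extension_resolution:
  assumes P0: "fg_projective K P P0" and se: "short_exact fp N P0 M g f"
    and im: "is_image A (ob_map KL M) (ob_map KR M) (can M) Z i"
    and \<phi>: "nat_iso K fp A B.yo KR \<phi>"
  obtains q where "q \<in> arr A (B.rep P0) Z"
    "Comp A (B.rep P0) Z (ob_map KR M) i q = Comp A (B.rep P0) (B.rep M) (ob_map KR M) (\<phi> M) (hom_map B.yo P0 M f)"
    "short_exact A (B.rep N) (B.rep P0) Z (hom_map B.yo N P0 g) q"
proof -
  have [simp]: "N \<in> Ob fp" "P0 \<in> Ob fp" "M \<in> Ob fp" and ker: "is_kernel fp P0 M f N g" and cok: "is_cokernel fp N P0 g M f"
    using se by (auto simp: short_exact_def)
  have g [simp]: "g \<in> arr fp N P0" and f [simp]: "f \<in> arr fp P0 M" using ker cok by (auto simp: is_kernel_def is_cokernel_def)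
  have fe: "epic fp P0 M f" using fp.cokernel_epic[OF cok] by simp
  obtain Q p where cokp: "is_cokernel A (ob_map KL M) (ob_map KR M) (can M) Q p"
    and kerp: "is_kernel A (ob_map KR M) Q p Z i"
    using im unfolding is_image_def by blast
  have [simp]: "Q \<in> Ob A" "p \<in> arr A (ob_map KR M) Q" "Z \<in> Ob A" "i \<in> arr A Z (ob_map KR M)"
    using cokp kerp by (auto simp: is_kernel_def is_cokernel_def)
  have cokf: "is_cokernel A (ob_map KR P0) (ob_map KR M) (hom_map KR P0 M f) Q p"
    by (rule cokernel_can_imp_cokernel_KR[OF _ _ fe can_fg_projective_invertible[OF P0] cokp]) simp_all
  have \<phi>in: "\<phi> M' \<in> arr A (B.rep M') (ob_map KR M')" and \<phi>inv: "invertible A (B.rep M') (ob_map KR M') (\<phi> M')"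
    if "M' \<in> Ob fp" for M'
    using \<phi> that by (auto simp: nat_iso_def nat_trans_def)
  have \<phi>nat: "Comp A (B.rep P0) (ob_map KR P0) (ob_map KR M) (hom_map KR P0 M f) (\<phi> P0) =
      Comp A (B.rep P0) (B.rep M) (ob_map KR M) (\<phi> M) (hom_map B.yo P0 M f)"
    using \<phi> unfolding nat_iso_def nat_trans_def by simp
  have y [simp]: "hom_map B.yo P0 M f \<in> arr A (B.rep P0) (B.rep M)" using B_yo.map_in[of P0 M f] by simp
  note [simp] = \<phi>in[of P0] \<phi>in[of M]
  obtain \<psi> where \<psi> [simp]: "\<psi> \<in> arr A (ob_map KR M) (B.rep M)"
    and \<psi>\<phi>: "Comp A (B.rep M) (ob_map KR M) (B.rep M) \<psi> (\<phi> M) = Ident A (B.rep M)"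
    and \<phi>\<psi>: "Comp A (ob_map KR M) (B.rep M) (ob_map KR M) (\<phi> M) \<psi> = Ident A (ob_map KR M)"
    using \<phi>inv[OF \<open>M \<in> Ob fp\<close>] by (elim B.fp.invertibleE)
  have u: "invertible A (B.rep P0) (ob_map KR P0) (\<phi> P0)" and v: "inverse_arr A (B.rep M) (ob_map KR M) (\<phi> M) \<psi>"
    using \<phi>inv[of P0] \<psi>\<phi> \<phi>\<psi> by (simp_all add: inverse_arr_def)
  have cok': "is_cokernel A (B.rep P0) (B.rep M) (hom_map B.yo P0 M f) Q (Comp A (B.rep M) (ob_map KR M) Q p (\<phi> M))"
    by (rule B.fp.cokernel_iso[OF cokf u v]) (simp_all add: \<phi>nat)
  have ker': "is_kernel A (B.rep M) Q (Comp A (B.rep M) (ob_map KR M) Q p (\<phi> M)) Z (Comp A Z (ob_map KR M) (B.rep M) \<psi> i)"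
    by (rule B.fp.kernel_iso[OF kerp v]) simp_all
  obtain q where q: "q \<in> arr A (B.rep P0) Z"
    and iq: "Comp A (B.rep P0) Z (B.rep M) (Comp A Z (ob_map KR M) (B.rep M) \<psi> i) q = hom_map B.yo P0 M f"
    and se': "short_exact A (B.rep N) (B.rep P0) Z (hom_map B.yo N P0 g) q"
    using B.image_resolution[OF _ _ _ g f ker cok' ker'] by (auto simp: A_arr A_Comp)
  have "Comp A (B.rep P0) Z (ob_map KR M) i q =
      Comp A (B.rep P0) Z (ob_map KR M) (Comp A Z (ob_map KR M) (ob_map KR M) (Comp A (ob_map KR M) (B.rep M) (ob_map KR M) (\<phi> M) \<psi>) i) q"
    unfolding \<phi>\<psi> by simp
  also have "\<dots> = Comp A (B.rep P0) (B.rep M) (ob_map KR M) (\<phi> M)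
      (Comp A (B.rep P0) Z (B.rep M) (Comp A Z (ob_map KR M) (B.rep M) \<psi> i) q)"
    using q by (simp add: B.fp.comp_assoc)
  finally show ?thesis using q iq se' that by simp
qed

text \<open>
  If \<open>P0\<close> is injective, then so is \<open>P0\<^sup>\<and>\<close>, which is isomorphic to \<open>KR P0\<close>; now the general criterion
  for rigidity applies.
\<close>

lemma intermediate_extension_rigid:
  assumes N: "N \<in> Ob fp" and P0: "injective fp P0" and g: "g \<in> arr fp N P0"
    and se: "short_exact A (B.rep N) (B.rep P0) Z (hom_map B.yo N P0 g) q"
  shows "rigid A Z"
proof -
  have P0': "P0 \<in> Ob fp" using P0 by (simp add: injective_def)
  obtain S \<iota> \<pi> where "is_direct_sum A 2 (\<lambda>i. Z) S \<iota> \<pi>"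
    using B.fp_direct_sum[OF N P0' g] se unfolding short_exact_def by blast
  then show ?thesis
    by (rule B.fp.rigid_of_resolution[OF se B.rep_projective[OF N] B.rep_projective[OF P0'] rep_injective[OF P0]])
qed

end

theorem lemma2p6:
  fixes K :: "'k ring"
    and P :: "('k, 'o, 'm) kcat"
    and B :: "('k, ('k, 'o, 'm, 'v) cmodule, 'o \<Rightarrow> 'v \<Rightarrow> 'v) kcat"
    and A :: "('k, ('k, 'o, 'm, 'v) bmodule, ('k, 'o, 'm, 'v) cmodule \<Rightarrow> 'v \<Rightarrow> 'v) kcat"
    and KL KR :: "(('k, 'o, 'm, 'v) cmodule, 'o \<Rightarrow> 'v \<Rightarrow> 'v,
                   ('k, 'o, 'm, 'v) bmodule, ('k, 'o, 'm, 'v) cmodule \<Rightarrow> 'v \<Rightarrow> 'v) kfun"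
    and can :: "('k, 'o, 'm, 'v) cmodule \<Rightarrow> ('k, 'o, 'm, 'v) cmodule \<Rightarrow> 'v \<Rightarrow> 'v"
  assumes K: "field K"
    and P: "kcategory K P"
    and small: "infinite (UNIV :: 'v set)" "locally_small TYPE('v) P"
    and B: "B = fp_mod K P"
    and A: "A = fp_mod K B"
    and abelian: "abelian K B"
    and KL: "adjunction K B A KL (res P) \<eta>L \<epsilon>L"
    and KR: "adjunction K A B (res P) KR \<eta>R \<epsilon>R"
    and can: "\<And>M. can M = canonical_arr A B (res P) KL KR \<eta>L \<eta>R M"
  shows
    "((\<exists>\<phi>. nat_iso K B A (yoneda B) KR \<phi>) \<and>
      (\<forall>I. injective B I \<longrightarrow> projective A (ob_map KR I) \<and> injective A (ob_map KR I)))
     \<and>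
     (\<forall>Q. fg_projective K P Q \<longrightarrow> invertible A (ob_map KL Q) (ob_map KR Q) (can Q))
     \<and>
     (\<forall>M \<Omega>M P0 g f Z i \<phi>.
        fg_projective K P P0 \<and> short_exact B \<Omega>M P0 M g f \<and>
        is_image A (ob_map KL M) (ob_map KR M) (can M) Z i \<and>
        nat_iso K B A (yoneda B) KR \<phi>
        \<longrightarrow>
        (\<exists>q\<in>arr A (ob_map (yoneda B) P0) Z.
           Comp A (ob_map (yoneda B) P0) Z (ob_map KR M) i q =
             Comp A (ob_map (yoneda B) P0) (ob_map (yoneda B) M) (ob_map KR M)
               (\<phi> M) (hom_map (yoneda B) P0 M f) \<and>
           short_exact A (ob_map (yoneda B) \<Omega>M) (ob_map (yoneda B) P0) Z
             (hom_map (yoneda B) \<Omega>M P0 g) q \<and>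
           projective A (ob_map (yoneda B) \<Omega>M) \<and>
           projective A (ob_map (yoneda B) P0)) \<and>
        (injective B P0 \<longrightarrow> rigid A Z))"
proof -
  have "cring K" using K by (simp add: field_def domain_def)
  then interpret mod_mod_localization K P "TYPE('v)" KL KR \<eta>L \<epsilon>L \<eta>R \<epsilon>R
    using P small abelian KL KR unfolding A B
    by (intro mod_mod_localization.intro mod_mod_localization_axioms.intro coherent_category.intro
        coherent_category_axioms.intro small_linear_category.intro small_linear_category_axioms.intro
        linear_category.intro)
  have can': "can M = canonical_arr (fp_mod K (fp_mod K P)) (fp_mod K P) (res P) KL KR \<eta>L \<eta>R M" for M
    by (simp add: can A B)
  show ?thesis
    unfolding A B can'
  proof (intro conjI allI impI)
    show "\<exists>\<phi>. nat_iso K fp B.fp B.yo KR \<phi>" using comparison_nat_iso by blast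
    show "projective B.fp (ob_map KR I)" "injective B.fp (ob_map KR I)" if "injective fp I" for I
      using that KR_injective KR_projective by (auto simp: injective_def)
    show "invertible B.fp (ob_map KL Q) (ob_map KR Q)
        (canonical_arr B.fp fp (res P) KL KR \<eta>L \<eta>R Q)" if "fg_projective K P Q" for Q
      using can_fg_projective_invertible[OF that] .
    fix M N P0 g f Z i \<phi>
    assume *: "fg_projective K P P0 \<and> short_exact fp N P0 M g f \<and>
        is_image B.fp (ob_map KL M) (ob_map KR M)
          (canonical_arr B.fp fp (res P) KL KR \<eta>L \<eta>R M) Z i \<and>
        nat_iso K fp B.fp B.yo KR \<phi>"
    then have se: "short_exact fp N P0 M g f" by blast
    have Ob: "N \<in> Ob fp" "P0 \<in> Ob fp" and g: "g \<in> arr fp N P0"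
      using se by (auto simp: short_exact_def is_kernel_def)
    obtain q where q: "q \<in> arr B.fp (B.rep P0) Z"
      "Comp B.fp (B.rep P0) Z (ob_map KR M) i q =
        Comp B.fp (B.rep P0) (B.rep M) (ob_map KR M) (\<phi> M) (hom_map B.yo P0 M f)"
      "short_exact B.fp (B.rep N) (B.rep P0) Z (hom_map B.yo N P0 g) q"
      by (rule intermediate_extension_resolution[of P0 N M g f Z i \<phi>]) (use * in blast)+
    show "\<exists>q\<in>arr B.fp (ob_map B.yo P0) Z.
           Comp B.fp (ob_map B.yo P0) Z (ob_map KR M) i q =
             Comp B.fp (ob_map B.yo P0) (ob_map B.yo M) (ob_map KR M)
               (\<phi> M) (hom_map B.yo P0 M f) \<and>
           short_exact B.fp (ob_map B.yo N) (ob_map B.yo P0) Z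
             (hom_map B.yo N P0 g) q \<and>
           projective B.fp (ob_map B.yo N) \<and>
           projective B.fp (ob_map B.yo P0)"
      using q B.rep_projective Ob by (intro bexI[of _ q]) simp_all
    show "rigid B.fp Z" if "injective fp P0"
      by (rule intermediate_extension_rigid[OF Ob(1) that g q(3)])
  qed
qed

end
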